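(* Let $\emptyset$ be the empty 2-category and let $\mathsf{Bi}^{\mathsf{fbr}}_{\mathsf r}$ be the 2-category of flat small braided bimonoidal categories, robust braided bimonoidal functors, and bimonoidal natural transformations. The finite ordinal category $\Sigma$ is a lax bicolimit of the unique 2-functor $\emptyset\to\mathsf{Bi}^{\mathsf{fbr}}_{\mathsf r}$. That is, $\Sigma$ is an object of $\mathsf{Bi}^{\mathsf{fbr}}_{\mathsf r}$ and, for every flat small braided bimonoidal category $C$, the unique functor $\mathsf{Bi}^{\mathsf{fbr}}_{\mathsf r}(\Sigma,C)\to\mathbf 1$ to the terminal category is an equivalence of categories.
   Context: Write $AB$ for $A\otimes B$; $\otimes$ binds tighter than $\oplus$. A bimonoidal category is a category $C$ with a symmetric monoidal structure $(\oplus,0,\alpha^\oplus,\lambda^\oplus,\rho^\oplus,\zeta^\oplus)$, a monoidal structure $(\otimes,1,\alpha^\otimes,\lambda^\otimes,\rho^\otimes)$ (with $\alpha_{A,B,C}:(AB)C\to A(BC)$, $\lambda_A$, $\rho_A$ the left/right unit isomorphisms), natural isomorphisms $\lambda^\bullet_A:0A\to0$, $\rho^\bullet_A:A0\to 0$, and natural monomorphisms $\delta^l_{A,B,C}:A(B\oplus C)\to AB\oplus AC$, $\delta^r_{A,B,C}:(A\oplus B)C\to AC\oplus BC$, such that for all objects: $\delta^l_{A,C,B}(1\otimes\zeta^\oplus_{B,C})=\zeta^\oplus_{AB,AC}\delta^l_{A,B,C}$; $\delta^r_{B,A,C}(\zeta^\oplus_{A,B}\otimes1)=\zeta^\oplus_{AC,BC}\delta^r_{A,B,C}$;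 $\alpha^\oplus(\delta^r_{A,B,D}\oplus1)\delta^r_{A\oplus B,C,D}=(1\oplus\delta^r_{B,C,D})\delta^r_{A,B\oplus C,D}(\alpha^\oplus_{A,B,C}\otimes1)$; $\alpha^\oplus(\delta^l_{A,B,C}\oplus1)\delta^l_{A,B\oplus C,D}=(1\oplus\delta^l_{A,C,D})\delta^l_{A,B,C\oplus D}(1\otimes\alpha^\oplus_{B,C,D})$; $\delta^l_{A,BC,BD}(1\otimes\delta^l_{B,C,D})\alpha^\otimes_{A,B,C\oplus D}=(\alpha^\otimes_{A,B,C}\oplus\alpha^\otimes_{A,B,D})\delta^l_{AB,C,D}$; $(\alpha^\otimes_{A,C,D}\oplus\alpha^\otimes_{B,C,D})\delta^r_{AC,BC,D}(\delta^r_{A,B,C}\otimes1)=\delta^r_{A,B,CD}\alpha^\otimes_{A\oplus B,C,D}$; $(\alpha^\otimes_{A,B,D}\oplus\alpha^\otimes_{A,C,D})\delta^r_{AB,AC,D}(\delta^l_{A,B,C}\otimes1)=\delta^l_{A,BD,CD}(1\otimes\delta^r_{B,C,D})\alpha^\otimes_{A,B\oplus C,D}$; $\mu(\delta^l_{A,C,D}\oplus\delta^l_{B,C,D})\delta^r_{A,B,C\oplus D}=(\delta^r_{A,B,C}\oplus\delta^r_{A,B,D})\delta^l_{A\oplus B,C,D}$, where $\mu:(AC\oplus AD)\oplus(BC\oplus BD)\to(AC\oplus BC)\oplus(AD\oplus BD)$ is the coherence isomorphism exchanging the two middle summands; $\lambda^\bullet_0=\rho^\bullet_0$; $\lambda^\oplus_0(\lambda^\bullet_A\oplus\lambda^\bullet_B)\delta^l_{0,A,B}=\lambda^\bullet_{A\oplus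 B}$; $\lambda^\oplus_0(\rho^\bullet_A\oplus\rho^\bullet_B)\delta^r_{A,B,0}=\rho^\bullet_{A\oplus B}$; $\rho^\otimes_0=\lambda^\bullet_1$; $\lambda^\otimes_0=\rho^\bullet_1$; $\lambda^\bullet_{AB}\alpha^\otimes_{0,A,B}=\lambda^\bullet_B(\lambda^\bullet_A\otimes1)$; $\rho^\bullet_A(1\otimes\lambda^\bullet_B)\alpha^\otimes_{A,0,B}=\lambda^\bullet_B(\rho^\bullet_A\otimes1)$; $\rho^\bullet_A(1\otimes\rho^\bullet_B)\alpha^\otimes_{A,B,0}=\rho^\bullet_{AB}$; $\lambda^\oplus_{AB}(\rho^\bullet_A\oplus1)\delta^l_{A,0,B}=1\otimes\lambda^\oplus_B$; $\lambda^\oplus_{BA}(\lambda^\bullet_A\oplus1)\delta^r_{0,B,A}=\lambda^\oplus_B\otimes1$; $\rho^\oplus_{AB}(1\oplus\rho^\bullet_A)\delta^l_{A,B,0}=1\otimes\rho^\oplus_B$; $\rho^\oplus_{AB}(1\oplus\lambda^\bullet_B)\delta^r_{A,0,B}=\rho^\oplus_A\otimes1$; $(\lambda^\otimes_A\oplus\lambda^\otimes_B)\delta^l_{1,A,B}=\lambda^\otimes_{A\oplus B}$; $(\rho^\otimes_A\oplus\rho^\otimes_B)\delta^r_{A,B,1}=\rho^\otimes_{A\oplus B}$. A braided bimonoidal category is a bimonoidal category with a braiding $\zeta^\otimes$ making $\otimes$ braided monoidal, such that $\delta^l_{C,A,B}\zeta^\otimes_{A\oplus B,C}=(\zeta^\otimes_{A,C}\oplus\zeta^\otimes_{B,C})\delta^r_{A,B,C}$,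 $\delta^r_{B,C,A}\zeta^\otimes_{A,B\oplus C}=(\zeta^\otimes_{A,B}\oplus\zeta^\otimes_{A,C})\delta^l_{A,B,C}$, $\lambda^\bullet_A\zeta^\otimes_{A,0}=\rho^\bullet_A$, and $\rho^\bullet_A\zeta^\otimes_{0,A}=\lambda^\bullet_A$. It is flat if every morphism in the following class is a monomorphism: the smallest class containing all components of $\delta^l,\delta^r$ and closed under $f\mapsto f\oplus1_A,\ 1_A\oplus f,\ f\otimes1_A,\ 1_A\otimes f$ for all objects $A$. A braided bimonoidal functor $F:C\to D$ is a functor with a symmetric monoidal structure $(F^2_\oplus,F^0_\oplus)$ with respect to $\oplus$ and a braided monoidal structure $(F^2_\otimes,F^0_\otimes)$ with respect to $\otimes$ (lax direction: $FA\otimes FB\to F(A\otimes B)$, $1\to F1$, etc.) such that $F(\lambda^\bullet_A)F^2_\otimes(F^0_\oplus\otimes1_{FA})=F^0_\oplus\lambda^\bullet_{FA}$ and $F(\delta^l_{A,B,C})F^2_\otimes(1\otimes F^2_\oplus)=F^2_\oplus(F^2_\otimes\oplus F^2_\otimes)\delta^l_{FA,FB,FC}$. It is robust if $F^2_\oplus,F^0_\oplus,F^0_\otimes$ are isomorphisms. A bimonoidal natural transformation is a natural transformation that is monoidal with respect to both the $\oplus$ and the $\otimes$ structures. The finite ordinal category $\Sigma$ has objects the integers $n\ge0$; $\Sigma(n,n)$ is the symmetric group $\Sigma_n$ and there are no other morphisms. Sum: $m\oplus n=m+n$, block sum of permutations; $\zeta^\oplus_{m,n}$ swaps the two blocks.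 Product: $m\otimes n=mn$, where $(i,j)$ with $1\le i\le m$, $1\le j\le n$ is identified with $i+(j-1)m$, and $(\sigma\otimes\tau)(i,j)=(\sigma i,\tau j)$; $\zeta^\otimes_{m,n}(i,j)=(j,i)$. All associativity and unit isomorphisms, $\lambda^\bullet$, $\rho^\bullet$ and $\delta^l$ are identities; $\delta^r_{m,n,p}:(m+n)p\to mp+np$ is the permutation sending $(i,j)$ with $i\le m$ to $i+(j-1)m$ and $(m+i,j)$ with $1\le i\le n$ to $mp+i+(j-1)n$. *)

theory Defs
  imports "HOL-Library.FuncSet" "HOL-Combinatorics.Permutations"
begin

section \<open>Small categories, functors, natural transformations\<close>

text \<open>
  A category is given by sets of objects and arrows inside arbitrary types, hence is automatically
  small. The operations are total functions whose values matter only on these sets.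
  Composition \<open>g \<cdot> f\<close> is written in the usual (applicative) order.
\<close>

record ('o, 'm) cat =
  Obj  :: "'o set"
  Arr  :: "'m set"
  Src  :: "'m \<Rightarrow> 'o"
  Tgt  :: "'m \<Rightarrow> 'o"
  Ide  :: "'o \<Rightarrow> 'm" ("\<iota>\<index>")
  Comp :: "'m \<Rightarrow> 'm \<Rightarrow> 'm" (infixr "\<cdot>\<index>" 55)

definition Hom :: "('o, 'm, 'z) cat_scheme \<Rightarrow> 'o \<Rightarrow> 'o \<Rightarrow> 'm set" where
  "Hom \<C> A B = {f \<in> Arr \<C>. Src \<C> f = A \<and> Tgt \<C> f = B}"

locale category =
  fixes \<C> :: "('o, 'm, 'z) cat_scheme" (structure)
  assumes src_obj: "f \<in> Arr \<C> \<Longrightarrow> Src \<C> f \<in> Obj \<C>"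
    and tgt_obj: "f \<in> Arr \<C> \<Longrightarrow> Tgt \<C> f \<in> Obj \<C>"
    and ide_hom: "A \<in> Obj \<C> \<Longrightarrow> \<iota> A \<in> Hom \<C> A A"
    and comp_hom: "\<lbrakk>f \<in> Hom \<C> A B; g \<in> Hom \<C> B C\<rbrakk> \<Longrightarrow> g \<cdot> f \<in> Hom \<C> A C"
    and comp_assoc: "\<lbrakk>f \<in> Hom \<C> A B; g \<in> Hom \<C> B C; h \<in> Hom \<C> C D\<rbrakk>
          \<Longrightarrow> (h \<cdot> g) \<cdot> f = h \<cdot> (g \<cdot> f)"
    and comp_ide_left: "f \<in> Hom \<C> A B \<Longrightarrow> \<iota> B \<cdot> f = f"
    and comp_ide_right: "f \<in> Hom \<C> A B \<Longrightarrow> f \<cdot> \<iota> A = f"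

definition inverse_arrows :: "('o, 'm, 'z) cat_scheme \<Rightarrow> 'm \<Rightarrow> 'm \<Rightarrow> bool" where
  "inverse_arrows \<C> f g \<longleftrightarrow>
     f \<in> Arr \<C> \<and> g \<in> Hom \<C> (Tgt \<C> f) (Src \<C> f) \<and>
     g \<cdot>\<^bsub>\<C>\<^esub> f = \<iota>\<^bsub>\<C>\<^esub> (Src \<C> f) \<and> f \<cdot>\<^bsub>\<C>\<^esub> g = \<iota>\<^bsub>\<C>\<^esub> (Tgt \<C> f)"

definition is_iso :: "('o, 'm, 'z) cat_scheme \<Rightarrow> 'm \<Rightarrow> bool" where
  "is_iso \<C> f \<longleftrightarrow> (\<exists>g. inverse_arrows \<C> f g)"

definition arr_inv :: "('o, 'm, 'z) cat_scheme \<Rightarrow> 'm \<Rightarrow> 'm" where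
  "arr_inv \<C> f = (THE g. inverse_arrows \<C> f g)"

definition Iso :: "('o, 'm, 'z) cat_scheme \<Rightarrow> 'o \<Rightarrow> 'o \<Rightarrow> 'm set" where
  "Iso \<C> A B = {f \<in> Hom \<C> A B. is_iso \<C> f}"

definition monic :: "('o, 'm, 'z) cat_scheme \<Rightarrow> 'm \<Rightarrow> bool" where
  "monic \<C> f \<longleftrightarrow> f \<in> Arr \<C> \<and>
     (\<forall>A \<in> Obj \<C>. \<forall>g \<in> Hom \<C> A (Src \<C> f). \<forall>h \<in> Hom \<C> A (Src \<C> f).
        f \<cdot>\<^bsub>\<C>\<^esub> g = f \<cdot>\<^bsub>\<C>\<^esub> h \<longrightarrow> g = h)"

text \<open>
  Functors and transformations are required to be \<^const>\<open>undefined\<close> outside the relevant sets, so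
  that equality in HOL is equality of functors (transformations).
\<close>

record ('o, 'm, 'p, 'n) functor_data =
  ob_map :: "'o \<Rightarrow> 'p"
  ar_map :: "'m \<Rightarrow> 'n"

locale is_functor =
  source: category \<C> + target: category \<D>
  for \<C> :: "('o, 'm, 'y) cat_scheme" and \<D> :: "('p, 'n, 'z) cat_scheme" +
  fixes F :: "('o, 'm, 'p, 'n, 'w) functor_data_scheme"
  assumes ob_map_ext: "ob_map F \<in> extensional (Obj \<C>)"
    and ar_map_ext: "ar_map F \<in> extensional (Arr \<C>)"
    and ob_map_obj: "A \<in> Obj \<C> \<Longrightarrow> ob_map F A \<in> Obj \<D>"
    and ar_map_hom: "f \<in> Hom \<C> A B \<Longrightarrow> ar_map F f \<in> Hom \<D> (ob_map F A) (ob_map F B)"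
    and ar_map_ide: "A \<in> Obj \<C> \<Longrightarrow> ar_map F (\<iota>\<^bsub>\<C>\<^esub> A) = \<iota>\<^bsub>\<D>\<^esub> (ob_map F A)"
    and ar_map_comp: "\<lbrakk>f \<in> Hom \<C> A B; g \<in> Hom \<C> B C\<rbrakk>
          \<Longrightarrow> ar_map F (g \<cdot>\<^bsub>\<C>\<^esub> f) = ar_map F g \<cdot>\<^bsub>\<D>\<^esub> ar_map F f"

definition id_functor :: "('o, 'm, 'z) cat_scheme \<Rightarrow> ('o, 'm, 'o, 'm) functor_data" where
  "id_functor \<C> = \<lparr>ob_map = (\<lambda>A \<in> Obj \<C>. A), ar_map = (\<lambda>f \<in> Arr \<C>. f)\<rparr>"

definition comp_functor ::
  "('o, 'm, 'z) cat_scheme \<Rightarrow> ('p, 'n, 'q, 'l, 'v) functor_data_scheme \<Rightarrow>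
   ('o, 'm, 'p, 'n, 'w) functor_data_scheme \<Rightarrow> ('o, 'm, 'q, 'l) functor_data" where
  "comp_functor \<C> G F =
     \<lparr>ob_map = (\<lambda>A \<in> Obj \<C>. ob_map G (ob_map F A)), ar_map = (\<lambda>f \<in> Arr \<C>. ar_map G (ar_map F f))\<rparr>"

locale nat_trans =
  dom_functor: is_functor \<C> \<D> F + cod_functor: is_functor \<C> \<D> G
  for \<C> :: "('o, 'm, 'y) cat_scheme" and \<D> :: "('p, 'n, 'z) cat_scheme"
    and F :: "('o, 'm, 'p, 'n, 'v) functor_data_scheme"
    and G :: "('o, 'm, 'p, 'n, 'w) functor_data_scheme" +
  fixes \<tau> :: "'o \<Rightarrow> 'n"
  assumes component_ext: "\<tau> \<in> extensional (Obj \<C>)"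
    and component_hom: "A \<in> Obj \<C> \<Longrightarrow> \<tau> A \<in> Hom \<D> (ob_map F A) (ob_map G A)"
    and naturality: "f \<in> Hom \<C> A B \<Longrightarrow> \<tau> B \<cdot>\<^bsub>\<D>\<^esub> ar_map F f = ar_map G f \<cdot>\<^bsub>\<D>\<^esub> \<tau> A"

locale nat_iso = nat_trans +
  assumes component_iso: "A \<in> Obj \<C> \<Longrightarrow> is_iso \<D> (\<tau> A)"

definition is_equivalence ::
  "('o, 'm, 'y) cat_scheme \<Rightarrow> ('p, 'n, 'z) cat_scheme \<Rightarrow>
   ('o, 'm, 'p, 'n, 'w) functor_data_scheme \<Rightarrow> bool" where
  "is_equivalence \<C> \<D> F \<longleftrightarrow> is_functor \<C> \<D> F \<and>
     (\<exists>(G :: ('p, 'n, 'o, 'm) functor_data) \<eta> \<epsilon>. is_functor \<D> \<C> G \<and>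
        nat_iso \<C> \<C> (id_functor \<C>) (comp_functor \<C> G F) \<eta> \<and>
        nat_iso \<D> \<D> (comp_functor \<D> F G) (id_functor \<D>) \<epsilon>)"

definition terminal_category :: "(unit, unit) cat" where
  "terminal_category = \<lparr>Obj = UNIV, Arr = UNIV, Src = (\<lambda>_. ()), Tgt = (\<lambda>_. ()),
     Ide = (\<lambda>_. ()), Comp = (\<lambda>_ _. ())\<rparr>"


section \<open>Monoidal categories\<close>

record ('o, 'm) monoidal_data = "('o, 'm) cat" +
  tensorO :: "'o \<Rightarrow> 'o \<Rightarrow> 'o" (infixr "\<odot>\<index>" 70)
  tensorA :: "'m \<Rightarrow> 'm \<Rightarrow> 'm" (infixr "\<odot>\<^sub>a\<index>" 70)
  unitO   :: "'o" ("\<I>\<index>")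
  assoc   :: "'o \<Rightarrow> 'o \<Rightarrow> 'o \<Rightarrow> 'm"
  lunit   :: "'o \<Rightarrow> 'm"
  runit   :: "'o \<Rightarrow> 'm"

record ('o, 'm) braided_data = "('o, 'm) monoidal_data" +
  braid   :: "'o \<Rightarrow> 'o \<Rightarrow> 'm"

locale monoidal_category = category \<C>
  for \<C> :: "('o, 'm, 'z) monoidal_data_scheme" (structure) +
  assumes tensor_obj: "\<lbrakk>A \<in> Obj \<C>; B \<in> Obj \<C>\<rbrakk> \<Longrightarrow> A \<odot> B \<in> Obj \<C>"
    and tensor_hom: "\<lbrakk>f \<in> Hom \<C> A A'; g \<in> Hom \<C> B B'\<rbrakk> \<Longrightarrow> f \<odot>\<^sub>a g \<in> Hom \<C> (A \<odot> B) (A' \<odot> B')"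
    and tensor_ide: "\<lbrakk>A \<in> Obj \<C>; B \<in> Obj \<C>\<rbrakk> \<Longrightarrow> \<iota> A \<odot>\<^sub>a \<iota> B = \<iota> (A \<odot> B)"
    and tensor_comp: "\<lbrakk>f \<in> Hom \<C> A A'; f' \<in> Hom \<C> A' A''; g \<in> Hom \<C> B B'; g' \<in> Hom \<C> B' B''\<rbrakk>
          \<Longrightarrow> (f' \<cdot> f) \<odot>\<^sub>a (g' \<cdot> g) = (f' \<odot>\<^sub>a g') \<cdot> (f \<odot>\<^sub>a g)"
    and unit_obj: "\<I> \<in> Obj \<C>"
    and assoc_iso: "\<lbrakk>A \<in> Obj \<C>; B \<in> Obj \<C>; C \<in> Obj \<C>\<rbrakk>
          \<Longrightarrow> assoc \<C> A B C \<in> Iso \<C> ((A \<odot> B) \<odot> C) (A \<odot> (B \<odot> C))"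
    and assoc_nat: "\<lbrakk>f \<in> Hom \<C> A A'; g \<in> Hom \<C> B B'; h \<in> Hom \<C> C C'\<rbrakk>
          \<Longrightarrow> assoc \<C> A' B' C' \<cdot> ((f \<odot>\<^sub>a g) \<odot>\<^sub>a h) = (f \<odot>\<^sub>a (g \<odot>\<^sub>a h)) \<cdot> assoc \<C> A B C"
    and lunit_iso: "A \<in> Obj \<C> \<Longrightarrow> lunit \<C> A \<in> Iso \<C> (\<I> \<odot> A) A"
    and lunit_nat: "f \<in> Hom \<C> A A' \<Longrightarrow> lunit \<C> A' \<cdot> (\<iota> \<I> \<odot>\<^sub>a f) = f \<cdot> lunit \<C> A"
    and runit_iso: "A \<in> Obj \<C> \<Longrightarrow> runit \<C> A \<in> Iso \<C> (A \<odot> \<I>) A"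
    and runit_nat: "f \<in> Hom \<C> A A' \<Longrightarrow> runit \<C> A' \<cdot> (f \<odot>\<^sub>a \<iota> \<I>) = f \<cdot> runit \<C> A"
    and pentagon: "\<lbrakk>A \<in> Obj \<C>; B \<in> Obj \<C>; C \<in> Obj \<C>; D \<in> Obj \<C>\<rbrakk>
          \<Longrightarrow> (\<iota> A \<odot>\<^sub>a assoc \<C> B C D) \<cdot> assoc \<C> A (B \<odot> C) D \<cdot> (assoc \<C> A B C \<odot>\<^sub>a \<iota> D)
            = assoc \<C> A B (C \<odot> D) \<cdot> assoc \<C> (A \<odot> B) C D"
    and triangle: "\<lbrakk>A \<in> Obj \<C>; B \<in> Obj \<C>\<rbrakk>
          \<Longrightarrow> (\<iota> A \<odot>\<^sub>a lunit \<C> B) \<cdot> assoc \<C> A \<I> B = runit \<C> A \<odot>\<^sub>a \<iota> B"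

locale braided_monoidal_category = monoidal_category \<C>
  for \<C> :: "('o, 'm, 'z) braided_data_scheme" (structure) +
  assumes braid_iso: "\<lbrakk>A \<in> Obj \<C>; B \<in> Obj \<C>\<rbrakk> \<Longrightarrow> braid \<C> A B \<in> Iso \<C> (A \<odot> B) (B \<odot> A)"
    and braid_nat: "\<lbrakk>f \<in> Hom \<C> A A'; g \<in> Hom \<C> B B'\<rbrakk>
          \<Longrightarrow> braid \<C> A' B' \<cdot> (f \<odot>\<^sub>a g) = (g \<odot>\<^sub>a f) \<cdot> braid \<C> A B"
    and hexagon1: "\<lbrakk>A \<in> Obj \<C>; B \<in> Obj \<C>; C \<in> Obj \<C>\<rbrakk>
          \<Longrightarrow> assoc \<C> B C A \<cdot> braid \<C> A (B \<odot> C) \<cdot> assoc \<C> A B C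
            = (\<iota> B \<odot>\<^sub>a braid \<C> A C) \<cdot> assoc \<C> B A C \<cdot> (braid \<C> A B \<odot>\<^sub>a \<iota> C)"
    and hexagon2: "\<lbrakk>A \<in> Obj \<C>; B \<in> Obj \<C>; C \<in> Obj \<C>\<rbrakk>
          \<Longrightarrow> arr_inv \<C> (assoc \<C> C A B) \<cdot> braid \<C> (A \<odot> B) C \<cdot> arr_inv \<C> (assoc \<C> A B C)
            = (braid \<C> A C \<odot>\<^sub>a \<iota> B) \<cdot> arr_inv \<C> (assoc \<C> A C B) \<cdot> (\<iota> A \<odot>\<^sub>a braid \<C> B C)"

locale symmetric_monoidal_category = braided_monoidal_category \<C>
  for \<C> :: "('o, 'm, 'z) braided_data_scheme" (structure) +
  assumes symmetry: "\<lbrakk>A \<in> Obj \<C>; B \<in> Obj \<C>\<rbrakk> \<Longrightarrow> braid \<C> B A \<cdot> braid \<C> A B = \<iota> (A \<odot> B)"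

text \<open>
  The exchange of the two middle factors,
  \<open>(A \<odot> B) \<odot> (C \<odot> D) \<rightarrow> (A \<odot> C) \<odot> (B \<odot> D)\<close>.
\<close>

definition middle_exchange ::
  "('o, 'm, 'z) braided_data_scheme \<Rightarrow> 'o \<Rightarrow> 'o \<Rightarrow> 'o \<Rightarrow> 'o \<Rightarrow> 'm" where
  "middle_exchange \<C> A B C D =
     arr_inv \<C> (assoc \<C> A C (B \<odot>\<^bsub>\<C>\<^esub> D)) \<cdot>\<^bsub>\<C>\<^esub>
     (\<iota>\<^bsub>\<C>\<^esub> A \<odot>\<^sub>a\<^bsub>\<C>\<^esub>
        (assoc \<C> C B D \<cdot>\<^bsub>\<C>\<^esub> (braid \<C> B C \<odot>\<^sub>a\<^bsub>\<C>\<^esub> \<iota>\<^bsub>\<C>\<^esub> D) \<cdot>\<^bsub>\<C>\<^esub> arr_inv \<C> (assoc \<C> B C D))) \<cdot>\<^bsub>\<C>\<^esub>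
     assoc \<C> A B (C \<odot>\<^bsub>\<C>\<^esub> D)"

locale monoidal_functor =
  is_functor \<C> \<D> F + source: monoidal_category \<C> + target: monoidal_category \<D>
  for \<C> :: "('o, 'm, 'y) monoidal_data_scheme" and \<D> :: "('p, 'n, 'z) monoidal_data_scheme"
    and F :: "('o, 'm, 'p, 'n, 'w) functor_data_scheme" +
  fixes F2 :: "'o \<Rightarrow> 'o \<Rightarrow> 'n" and F0 :: 'n
  assumes F2_ext: "A \<notin> Obj \<C> \<or> B \<notin> Obj \<C> \<Longrightarrow> F2 A B = undefined"
    and F2_hom: "\<lbrakk>A \<in> Obj \<C>; B \<in> Obj \<C>\<rbrakk>
          \<Longrightarrow> F2 A B \<in> Hom \<D> (ob_map F A \<odot>\<^bsub>\<D>\<^esub> ob_map F B) (ob_map F (A \<odot>\<^bsub>\<C>\<^esub> B))"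
    and F2_nat: "\<lbrakk>f \<in> Hom \<C> A A'; g \<in> Hom \<C> B B'\<rbrakk>
          \<Longrightarrow> F2 A' B' \<cdot>\<^bsub>\<D>\<^esub> (ar_map F f \<odot>\<^sub>a\<^bsub>\<D>\<^esub> ar_map F g) = ar_map F (f \<odot>\<^sub>a\<^bsub>\<C>\<^esub> g) \<cdot>\<^bsub>\<D>\<^esub> F2 A B"
    and F0_hom: "F0 \<in> Hom \<D> \<I>\<^bsub>\<D>\<^esub> (ob_map F \<I>\<^bsub>\<C>\<^esub>)"
    and F2_assoc: "\<lbrakk>A \<in> Obj \<C>; B \<in> Obj \<C>; C \<in> Obj \<C>\<rbrakk>
          \<Longrightarrow> ar_map F (assoc \<C> A B C) \<cdot>\<^bsub>\<D>\<^esub> F2 (A \<odot>\<^bsub>\<C>\<^esub> B) C \<cdot>\<^bsub>\<D>\<^esub> (F2 A B \<odot>\<^sub>a\<^bsub>\<D>\<^esub> \<iota>\<^bsub>\<D>\<^esub> (ob_map F C))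
            = F2 A (B \<odot>\<^bsub>\<C>\<^esub> C) \<cdot>\<^bsub>\<D>\<^esub> (\<iota>\<^bsub>\<D>\<^esub> (ob_map F A) \<odot>\<^sub>a\<^bsub>\<D>\<^esub> F2 B C) \<cdot>\<^bsub>\<D>\<^esub>
              assoc \<D> (ob_map F A) (ob_map F B) (ob_map F C)"
    and F2_lunit: "A \<in> Obj \<C>
          \<Longrightarrow> ar_map F (lunit \<C> A) \<cdot>\<^bsub>\<D>\<^esub> F2 \<I>\<^bsub>\<C>\<^esub> A \<cdot>\<^bsub>\<D>\<^esub> (F0 \<odot>\<^sub>a\<^bsub>\<D>\<^esub> \<iota>\<^bsub>\<D>\<^esub> (ob_map F A)) = lunit \<D> (ob_map F A)"
    and F2_runit: "A \<in> Obj \<C>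
          \<Longrightarrow> ar_map F (runit \<C> A) \<cdot>\<^bsub>\<D>\<^esub> F2 A \<I>\<^bsub>\<C>\<^esub> \<cdot>\<^bsub>\<D>\<^esub> (\<iota>\<^bsub>\<D>\<^esub> (ob_map F A) \<odot>\<^sub>a\<^bsub>\<D>\<^esub> F0) = runit \<D> (ob_map F A)"

locale braided_monoidal_functor =
  monoidal_functor \<C> \<D> F F2 F0 +
  source: braided_monoidal_category \<C> + target: braided_monoidal_category \<D>
  for \<C> :: "('o, 'm, 'y) braided_data_scheme" and \<D> :: "('p, 'n, 'z) braided_data_scheme"
    and F :: "('o, 'm, 'p, 'n, 'w) functor_data_scheme" and F2 F0 +
  assumes F2_braid: "\<lbrakk>A \<in> Obj \<C>; B \<in> Obj \<C>\<rbrakk>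
    \<Longrightarrow> ar_map F (braid \<C> A B) \<cdot>\<^bsub>\<D>\<^esub> F2 A B = F2 B A \<cdot>\<^bsub>\<D>\<^esub> braid \<D> (ob_map F A) (ob_map F B)"

locale symmetric_monoidal_functor =
  braided_monoidal_functor \<C> \<D> F F2 F0 +
  source: symmetric_monoidal_category \<C> + target: symmetric_monoidal_category \<D>
  for \<C> :: "('o, 'm, 'y) braided_data_scheme" and \<D> :: "('p, 'n, 'z) braided_data_scheme"
    and F :: "('o, 'm, 'p, 'n, 'w) functor_data_scheme" and F2 F0

locale monoidal_nat_trans =
  nat_trans \<C> \<D> F G \<tau> +
  dom_functor: monoidal_functor \<C> \<D> F F2 F0 + cod_functor: monoidal_functor \<C> \<D> G G2 G0
  for \<C> :: "('o, 'm, 'y) monoidal_data_scheme" and \<D> :: "('p, 'n, 'z) monoidal_data_scheme"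
    and F :: "('o, 'm, 'p, 'n, 'v) functor_data_scheme" and F2 F0
    and G :: "('o, 'm, 'p, 'n, 'w) functor_data_scheme" and G2 G0 and \<tau> +
  assumes component_tensor: "\<lbrakk>A \<in> Obj \<C>; B \<in> Obj \<C>\<rbrakk>
          \<Longrightarrow> \<tau> (A \<odot>\<^bsub>\<C>\<^esub> B) \<cdot>\<^bsub>\<D>\<^esub> F2 A B = G2 A B \<cdot>\<^bsub>\<D>\<^esub> (\<tau> A \<odot>\<^sub>a\<^bsub>\<D>\<^esub> \<tau> B)"
    and component_unit: "\<tau> \<I>\<^bsub>\<C>\<^esub> \<cdot>\<^bsub>\<D>\<^esub> F0 = G0"


section \<open>Braided bimonoidal categories\<close>

text \<open>
  In the symbols for the structure isomorphisms \<open>\<Lambda>\<close> stands for the (reserved) letter lambda: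
  \<open>\<Lambda>\<^sub>+, \<rho>\<^sub>+\<close> and \<open>\<Lambda>\<^sub>\<times>, \<rho>\<^sub>\<times>\<close> are the unit isomorphisms of sum and product, and
  \<open>\<Lambda>\<^sub>\<bullet> A : \<zero> \<otimes> A \<rightarrow> \<zero>\<close>, \<open>\<rho>\<^sub>\<bullet> A : A \<otimes> \<zero> \<rightarrow> \<zero>\<close>. The symbols \<open>\<oplus>\<close>, \<open>\<otimes>\<close> act on objects,
  \<open>\<oplus>\<^sub>a\<close>, \<open>\<otimes>\<^sub>a\<close> on arrows.
\<close>

record ('o, 'm) bimonoidal_data = "('o, 'm) cat" +
  sumO      :: "'o \<Rightarrow> 'o \<Rightarrow> 'o" (infixr "\<oplus>\<index>" 65)
  sumA      :: "'m \<Rightarrow> 'm \<Rightarrow> 'm" (infixr "\<oplus>\<^sub>a\<index>" 65)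
  zeroO     :: "'o" ("\<zero>\<index>")
  sum_assoc :: "'o \<Rightarrow> 'o \<Rightarrow> 'o \<Rightarrow> 'm" ("\<alpha>\<^sub>+\<index>")
  sum_lunit :: "'o \<Rightarrow> 'm" ("\<Lambda>\<^sub>+\<index>")
  sum_runit :: "'o \<Rightarrow> 'm" ("\<rho>\<^sub>+\<index>")
  sum_braid :: "'o \<Rightarrow> 'o \<Rightarrow> 'm" ("\<zeta>\<^sub>+\<index>")
  prodO      :: "'o \<Rightarrow> 'o \<Rightarrow> 'o" (infixr "\<otimes>\<index>" 70)
  prodA      :: "'m \<Rightarrow> 'm \<Rightarrow> 'm" (infixr "\<otimes>\<^sub>a\<index>" 70)
  oneO       :: "'o" ("\<one>\<index>")
  prod_assoc :: "'o \<Rightarrow> 'o \<Rightarrow> 'o \<Rightarrow> 'm" ("\<alpha>\<^sub>\<times>\<index>")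
  prod_lunit :: "'o \<Rightarrow> 'm" ("\<Lambda>\<^sub>\<times>\<index>")
  prod_runit :: "'o \<Rightarrow> 'm" ("\<rho>\<^sub>\<times>\<index>")
  lnull :: "'o \<Rightarrow> 'm" ("\<Lambda>\<^sub>\<bullet>\<index>")
  rnull :: "'o \<Rightarrow> 'm" ("\<rho>\<^sub>\<bullet>\<index>")
  ldist :: "'o \<Rightarrow> 'o \<Rightarrow> 'o \<Rightarrow> 'm" ("\<delta>\<^sub>l\<index>")
  rdist :: "'o \<Rightarrow> 'o \<Rightarrow> 'o \<Rightarrow> 'm" ("\<delta>\<^sub>r\<index>")

record ('o, 'm) braided_bimonoidal_data = "('o, 'm) bimonoidal_data" +
  prod_braid :: "'o \<Rightarrow> 'o \<Rightarrow> 'm" ("\<zeta>\<^sub>\<times>\<index>")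

definition additive :: "('o, 'm, 'z) bimonoidal_data_scheme \<Rightarrow> ('o, 'm) braided_data" where
  "additive \<C> = \<lparr>Obj = Obj \<C>, Arr = Arr \<C>, Src = Src \<C>, Tgt = Tgt \<C>, Ide = Ide \<C>, Comp = Comp \<C>,
     tensorO = sumO \<C>, tensorA = sumA \<C>, unitO = zeroO \<C>,
     assoc = sum_assoc \<C>, lunit = sum_lunit \<C>, runit = sum_runit \<C>, braid = sum_braid \<C>\<rparr>"

definition multiplicative :: "('o, 'm, 'z) bimonoidal_data_scheme \<Rightarrow> ('o, 'm) monoidal_data" where
  "multiplicative \<C> = \<lparr>Obj = Obj \<C>, Arr = Arr \<C>, Src = Src \<C>, Tgt = Tgt \<C>, Ide = Ide \<C>, Comp = Comp \<C>,
     tensorO = prodO \<C>, tensorA = prodA \<C>, unitO = oneO \<C>,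
     assoc = prod_assoc \<C>, lunit = prod_lunit \<C>, runit = prod_runit \<C>\<rparr>"

definition braided_multiplicative ::
  "('o, 'm, 'z) braided_bimonoidal_data_scheme \<Rightarrow> ('o, 'm) braided_data" where
  "braided_multiplicative \<C> = monoidal_data.extend (multiplicative \<C>) \<lparr>braid = prod_braid \<C>\<rparr>"

locale bimonoidal_category = category \<C>
  for \<C> :: "('o, 'm, 'z) bimonoidal_data_scheme" (structure) +
  assumes additive_symmetric: "symmetric_monoidal_category (additive \<C>)"
    and multiplicative_monoidal: "monoidal_category (multiplicative \<C>)"
    and lnull_iso: "A \<in> Obj \<C> \<Longrightarrow> \<Lambda>\<^sub>\<bullet> A \<in> Iso \<C> (\<zero> \<otimes> A) \<zero>"
    and lnull_nat: "f \<in> Hom \<C> A B \<Longrightarrow> \<Lambda>\<^sub>\<bullet> B \<cdot> (\<iota> \<zero> \<otimes>\<^sub>a f) = \<Lambda>\<^sub>\<bullet> A"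
    and rnull_iso: "A \<in> Obj \<C> \<Longrightarrow> \<rho>\<^sub>\<bullet> A \<in> Iso \<C> (A \<otimes> \<zero>) \<zero>"
    and rnull_nat: "f \<in> Hom \<C> A B \<Longrightarrow> \<rho>\<^sub>\<bullet> B \<cdot> (f \<otimes>\<^sub>a \<iota> \<zero>) = \<rho>\<^sub>\<bullet> A"
    and ldist_hom: "\<lbrakk>A \<in> Obj \<C>; B \<in> Obj \<C>; C \<in> Obj \<C>\<rbrakk>
          \<Longrightarrow> \<delta>\<^sub>l A B C \<in> Hom \<C> (A \<otimes> (B \<oplus> C)) (A \<otimes> B \<oplus> A \<otimes> C)"
    and ldist_monic: "\<lbrakk>A \<in> Obj \<C>; B \<in> Obj \<C>; C \<in> Obj \<C>\<rbrakk> \<Longrightarrow> monic \<C> (\<delta>\<^sub>l A B C)"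
    and ldist_nat: "\<lbrakk>f \<in> Hom \<C> A A'; g \<in> Hom \<C> B B'; h \<in> Hom \<C> C C'\<rbrakk>
          \<Longrightarrow> \<delta>\<^sub>l A' B' C' \<cdot> (f \<otimes>\<^sub>a (g \<oplus>\<^sub>a h)) = (f \<otimes>\<^sub>a g \<oplus>\<^sub>a f \<otimes>\<^sub>a h) \<cdot> \<delta>\<^sub>l A B C"
    and rdist_hom: "\<lbrakk>A \<in> Obj \<C>; B \<in> Obj \<C>; C \<in> Obj \<C>\<rbrakk>
          \<Longrightarrow> \<delta>\<^sub>r A B C \<in> Hom \<C> ((A \<oplus> B) \<otimes> C) (A \<otimes> C \<oplus> B \<otimes> C)"
    and rdist_monic: "\<lbrakk>A \<in> Obj \<C>; B \<in> Obj \<C>; C \<in> Obj \<C>\<rbrakk> \<Longrightarrow> monic \<C> (\<delta>\<^sub>r A B C)"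
    and rdist_nat: "\<lbrakk>f \<in> Hom \<C> A A'; g \<in> Hom \<C> B B'; h \<in> Hom \<C> C C'\<rbrakk>
          \<Longrightarrow> \<delta>\<^sub>r A' B' C' \<cdot> ((f \<oplus>\<^sub>a g) \<otimes>\<^sub>a h) = (f \<otimes>\<^sub>a h \<oplus>\<^sub>a g \<otimes>\<^sub>a h) \<cdot> \<delta>\<^sub>r A B C"
    and ldist_sum_braid: "\<lbrakk>A \<in> Obj \<C>; B \<in> Obj \<C>; C \<in> Obj \<C>\<rbrakk>
          \<Longrightarrow> \<delta>\<^sub>l A C B \<cdot> (\<iota> A \<otimes>\<^sub>a \<zeta>\<^sub>+ B C) = \<zeta>\<^sub>+ (A \<otimes> B) (A \<otimes> C) \<cdot> \<delta>\<^sub>l A B C"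
    and rdist_sum_braid: "\<lbrakk>A \<in> Obj \<C>; B \<in> Obj \<C>; C \<in> Obj \<C>\<rbrakk>
          \<Longrightarrow> \<delta>\<^sub>r B A C \<cdot> (\<zeta>\<^sub>+ A B \<otimes>\<^sub>a \<iota> C) = \<zeta>\<^sub>+ (A \<otimes> C) (B \<otimes> C) \<cdot> \<delta>\<^sub>r A B C"
    and rdist_sum_assoc: "\<lbrakk>A \<in> Obj \<C>; B \<in> Obj \<C>; C \<in> Obj \<C>; D \<in> Obj \<C>\<rbrakk>
          \<Longrightarrow> \<alpha>\<^sub>+ (A \<otimes> D) (B \<otimes> D) (C \<otimes> D) \<cdot> (\<delta>\<^sub>r A B D \<oplus>\<^sub>a \<iota> (C \<otimes> D)) \<cdot> \<delta>\<^sub>r (A \<oplus> B) C D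
            = (\<iota> (A \<otimes> D) \<oplus>\<^sub>a \<delta>\<^sub>r B C D) \<cdot> \<delta>\<^sub>r A (B \<oplus> C) D \<cdot> (\<alpha>\<^sub>+ A B C \<otimes>\<^sub>a \<iota> D)"
    and ldist_sum_assoc: "\<lbrakk>A \<in> Obj \<C>; B \<in> Obj \<C>; C \<in> Obj \<C>; D \<in> Obj \<C>\<rbrakk>
          \<Longrightarrow> \<alpha>\<^sub>+ (A \<otimes> B) (A \<otimes> C) (A \<otimes> D) \<cdot> (\<delta>\<^sub>l A B C \<oplus>\<^sub>a \<iota> (A \<otimes> D)) \<cdot> \<delta>\<^sub>l A (B \<oplus> C) D
            = (\<iota> (A \<otimes> B) \<oplus>\<^sub>a \<delta>\<^sub>l A C D) \<cdot> \<delta>\<^sub>l A B (C \<oplus> D) \<cdot> (\<iota> A \<otimes>\<^sub>a \<alpha>\<^sub>+ B C D)"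
    and ldist_prod_assoc: "\<lbrakk>A \<in> Obj \<C>; B \<in> Obj \<C>; C \<in> Obj \<C>; D \<in> Obj \<C>\<rbrakk>
          \<Longrightarrow> \<delta>\<^sub>l A (B \<otimes> C) (B \<otimes> D) \<cdot> (\<iota> A \<otimes>\<^sub>a \<delta>\<^sub>l B C D) \<cdot> \<alpha>\<^sub>\<times> A B (C \<oplus> D)
            = (\<alpha>\<^sub>\<times> A B C \<oplus>\<^sub>a \<alpha>\<^sub>\<times> A B D) \<cdot> \<delta>\<^sub>l (A \<otimes> B) C D"
    and rdist_prod_assoc: "\<lbrakk>A \<in> Obj \<C>; B \<in> Obj \<C>; C \<in> Obj \<C>; D \<in> Obj \<C>\<rbrakk>
          \<Longrightarrow> (\<alpha>\<^sub>\<times> A C D \<oplus>\<^sub>a \<alpha>\<^sub>\<times> B C D) \<cdot> \<delta>\<^sub>r (A \<otimes> C) (B \<otimes> C) D \<cdot> (\<delta>\<^sub>r A B C \<otimes>\<^sub>a \<iota> D)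
            = \<delta>\<^sub>r A B (C \<otimes> D) \<cdot> \<alpha>\<^sub>\<times> (A \<oplus> B) C D"
    and ldist_rdist_prod_assoc: "\<lbrakk>A \<in> Obj \<C>; B \<in> Obj \<C>; C \<in> Obj \<C>; D \<in> Obj \<C>\<rbrakk>
          \<Longrightarrow> (\<alpha>\<^sub>\<times> A B D \<oplus>\<^sub>a \<alpha>\<^sub>\<times> A C D) \<cdot> \<delta>\<^sub>r (A \<otimes> B) (A \<otimes> C) D \<cdot> (\<delta>\<^sub>l A B C \<otimes>\<^sub>a \<iota> D)
            = \<delta>\<^sub>l A (B \<otimes> D) (C \<otimes> D) \<cdot> (\<iota> A \<otimes>\<^sub>a \<delta>\<^sub>r B C D) \<cdot> \<alpha>\<^sub>\<times> A (B \<oplus> C) D"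
    and ldist_rdist_exchange: "\<lbrakk>A \<in> Obj \<C>; B \<in> Obj \<C>; C \<in> Obj \<C>; D \<in> Obj \<C>\<rbrakk>
          \<Longrightarrow> middle_exchange (additive \<C>) (A \<otimes> C) (A \<otimes> D) (B \<otimes> C) (B \<otimes> D) \<cdot>
              (\<delta>\<^sub>l A C D \<oplus>\<^sub>a \<delta>\<^sub>l B C D) \<cdot> \<delta>\<^sub>r A B (C \<oplus> D)
            = (\<delta>\<^sub>r A B C \<oplus>\<^sub>a \<delta>\<^sub>r A B D) \<cdot> \<delta>\<^sub>l (A \<oplus> B) C D"
    and null_zero: "\<Lambda>\<^sub>\<bullet> \<zero> = \<rho>\<^sub>\<bullet> \<zero>"
    and lnull_sum: "\<lbrakk>A \<in> Obj \<C>; B \<in> Obj \<C>\<rbrakk>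
          \<Longrightarrow> \<Lambda>\<^sub>+ \<zero> \<cdot> (\<Lambda>\<^sub>\<bullet> A \<oplus>\<^sub>a \<Lambda>\<^sub>\<bullet> B) \<cdot> \<delta>\<^sub>l \<zero> A B = \<Lambda>\<^sub>\<bullet> (A \<oplus> B)"
    and rnull_sum: "\<lbrakk>A \<in> Obj \<C>; B \<in> Obj \<C>\<rbrakk>
          \<Longrightarrow> \<Lambda>\<^sub>+ \<zero> \<cdot> (\<rho>\<^sub>\<bullet> A \<oplus>\<^sub>a \<rho>\<^sub>\<bullet> B) \<cdot> \<delta>\<^sub>r A B \<zero> = \<rho>\<^sub>\<bullet> (A \<oplus> B)"
    and lnull_one: "\<rho>\<^sub>\<times> \<zero> = \<Lambda>\<^sub>\<bullet> \<one>"
    and rnull_one: "\<Lambda>\<^sub>\<times> \<zero> = \<rho>\<^sub>\<bullet> \<one>"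
    and lnull_prod: "\<lbrakk>A \<in> Obj \<C>; B \<in> Obj \<C>\<rbrakk>
          \<Longrightarrow> \<Lambda>\<^sub>\<bullet> (A \<otimes> B) \<cdot> \<alpha>\<^sub>\<times> \<zero> A B = \<Lambda>\<^sub>\<bullet> B \<cdot> (\<Lambda>\<^sub>\<bullet> A \<otimes>\<^sub>a \<iota> B)"
    and lnull_rnull_prod: "\<lbrakk>A \<in> Obj \<C>; B \<in> Obj \<C>\<rbrakk>
          \<Longrightarrow> \<rho>\<^sub>\<bullet> A \<cdot> (\<iota> A \<otimes>\<^sub>a \<Lambda>\<^sub>\<bullet> B) \<cdot> \<alpha>\<^sub>\<times> A \<zero> B = \<Lambda>\<^sub>\<bullet> B \<cdot> (\<rho>\<^sub>\<bullet> A \<otimes>\<^sub>a \<iota> B)"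
    and rnull_prod: "\<lbrakk>A \<in> Obj \<C>; B \<in> Obj \<C>\<rbrakk>
          \<Longrightarrow> \<rho>\<^sub>\<bullet> A \<cdot> (\<iota> A \<otimes>\<^sub>a \<rho>\<^sub>\<bullet> B) \<cdot> \<alpha>\<^sub>\<times> A B \<zero> = \<rho>\<^sub>\<bullet> (A \<otimes> B)"
    and ldist_zero_left: "\<lbrakk>A \<in> Obj \<C>; B \<in> Obj \<C>\<rbrakk>
          \<Longrightarrow> \<Lambda>\<^sub>+ (A \<otimes> B) \<cdot> (\<rho>\<^sub>\<bullet> A \<oplus>\<^sub>a \<iota> (A \<otimes> B)) \<cdot> \<delta>\<^sub>l A \<zero> B = \<iota> A \<otimes>\<^sub>a \<Lambda>\<^sub>+ B"
    and rdist_zero_left: "\<lbrakk>A \<in> Obj \<C>; B \<in> Obj \<C>\<rbrakk>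
          \<Longrightarrow> \<Lambda>\<^sub>+ (B \<otimes> A) \<cdot> (\<Lambda>\<^sub>\<bullet> A \<oplus>\<^sub>a \<iota> (B \<otimes> A)) \<cdot> \<delta>\<^sub>r \<zero> B A = \<Lambda>\<^sub>+ B \<otimes>\<^sub>a \<iota> A"
    and ldist_zero_right: "\<lbrakk>A \<in> Obj \<C>; B \<in> Obj \<C>\<rbrakk>
          \<Longrightarrow> \<rho>\<^sub>+ (A \<otimes> B) \<cdot> (\<iota> (A \<otimes> B) \<oplus>\<^sub>a \<rho>\<^sub>\<bullet> A) \<cdot> \<delta>\<^sub>l A B \<zero> = \<iota> A \<otimes>\<^sub>a \<rho>\<^sub>+ B"
    and rdist_zero_right: "\<lbrakk>A \<in> Obj \<C>; B \<in> Obj \<C>\<rbrakk>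
          \<Longrightarrow> \<rho>\<^sub>+ (A \<otimes> B) \<cdot> (\<iota> (A \<otimes> B) \<oplus>\<^sub>a \<Lambda>\<^sub>\<bullet> B) \<cdot> \<delta>\<^sub>r A \<zero> B = \<rho>\<^sub>+ A \<otimes>\<^sub>a \<iota> B"
    and ldist_one: "\<lbrakk>A \<in> Obj \<C>; B \<in> Obj \<C>\<rbrakk>
          \<Longrightarrow> (\<Lambda>\<^sub>\<times> A \<oplus>\<^sub>a \<Lambda>\<^sub>\<times> B) \<cdot> \<delta>\<^sub>l \<one> A B = \<Lambda>\<^sub>\<times> (A \<oplus> B)"
    and rdist_one: "\<lbrakk>A \<in> Obj \<C>; B \<in> Obj \<C>\<rbrakk>
          \<Longrightarrow> (\<rho>\<^sub>\<times> A \<oplus>\<^sub>a \<rho>\<^sub>\<times> B) \<cdot> \<delta>\<^sub>r A B \<one> = \<rho>\<^sub>\<times> (A \<oplus> B)"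

locale braided_bimonoidal_category = bimonoidal_category \<C>
  for \<C> :: "('o, 'm, 'z) braided_bimonoidal_data_scheme" (structure) +
  assumes multiplicative_braided: "braided_monoidal_category (braided_multiplicative \<C>)"
    and ldist_prod_braid: "\<lbrakk>A \<in> Obj \<C>; B \<in> Obj \<C>; C \<in> Obj \<C>\<rbrakk>
          \<Longrightarrow> \<delta>\<^sub>l C A B \<cdot> \<zeta>\<^sub>\<times> (A \<oplus> B) C = (\<zeta>\<^sub>\<times> A C \<oplus>\<^sub>a \<zeta>\<^sub>\<times> B C) \<cdot> \<delta>\<^sub>r A B C"
    and rdist_prod_braid: "\<lbrakk>A \<in> Obj \<C>; B \<in> Obj \<C>; C \<in> Obj \<C>\<rbrakk>
          \<Longrightarrow> \<delta>\<^sub>r B C A \<cdot> \<zeta>\<^sub>\<times> A (B \<oplus> C) = (\<zeta>\<^sub>\<times> A B \<oplus>\<^sub>a \<zeta>\<^sub>\<times> A C) \<cdot> \<delta>\<^sub>l A B C"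
    and lnull_prod_braid: "A \<in> Obj \<C> \<Longrightarrow> \<Lambda>\<^sub>\<bullet> A \<cdot> \<zeta>\<^sub>\<times> A \<zero> = \<rho>\<^sub>\<bullet> A"
    and rnull_prod_braid: "A \<in> Obj \<C> \<Longrightarrow> \<rho>\<^sub>\<bullet> A \<cdot> \<zeta>\<^sub>\<times> \<zero> A = \<Lambda>\<^sub>\<bullet> A"

inductive_set distributivity_class :: "('o, 'm, 'z) bimonoidal_data_scheme \<Rightarrow> 'm set"
  for \<C> :: "('o, 'm, 'z) bimonoidal_data_scheme" (structure) where
  ldist: "\<lbrakk>A \<in> Obj \<C>; B \<in> Obj \<C>; C \<in> Obj \<C>\<rbrakk> \<Longrightarrow> \<delta>\<^sub>l A B C \<in> distributivity_class \<C>"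
| rdist: "\<lbrakk>A \<in> Obj \<C>; B \<in> Obj \<C>; C \<in> Obj \<C>\<rbrakk> \<Longrightarrow> \<delta>\<^sub>r A B C \<in> distributivity_class \<C>"
| sum_right: "\<lbrakk>f \<in> distributivity_class \<C>; A \<in> Obj \<C>\<rbrakk> \<Longrightarrow> f \<oplus>\<^sub>a \<iota> A \<in> distributivity_class \<C>"
| sum_left: "\<lbrakk>f \<in> distributivity_class \<C>; A \<in> Obj \<C>\<rbrakk> \<Longrightarrow> \<iota> A \<oplus>\<^sub>a f \<in> distributivity_class \<C>"
| prod_right: "\<lbrakk>f \<in> distributivity_class \<C>; A \<in> Obj \<C>\<rbrakk> \<Longrightarrow> f \<otimes>\<^sub>a \<iota> A \<in> distributivity_class \<C>"
| prod_left: "\<lbrakk>f \<in> distributivity_class \<C>; A \<in> Obj \<C>\<rbrakk> \<Longrightarrow> \<iota> A \<otimes>\<^sub>a f \<in> distributivity_class \<C>"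

locale flat_braided_bimonoidal_category = braided_bimonoidal_category \<C>
  for \<C> :: "('o, 'm, 'z) braided_bimonoidal_data_scheme" (structure) +
  assumes flat: "f \<in> distributivity_class \<C> \<Longrightarrow> monic \<C> f"


section \<open>Braided bimonoidal functors and bimonoidal transformations\<close>

record ('o, 'm, 'p, 'n) bimonoidal_functor_data = "('o, 'm, 'p, 'n) functor_data" +
  sum2  :: "'o \<Rightarrow> 'o \<Rightarrow> 'n"
  sum0  :: "'n"
  prod2 :: "'o \<Rightarrow> 'o \<Rightarrow> 'n"
  prod0 :: "'n"

locale braided_bimonoidal_functor =
  is_functor \<C> \<D> F +
  source: braided_bimonoidal_category \<C> + target: braided_bimonoidal_category \<D>
  for \<C> :: "('o, 'm, 'y) braided_bimonoidal_data_scheme"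
    and \<D> :: "('p, 'n, 'z) braided_bimonoidal_data_scheme"
    and F :: "('o, 'm, 'p, 'n, 'w) bimonoidal_functor_data_scheme" +
  assumes additive_functor:
      "symmetric_monoidal_functor (additive \<C>) (additive \<D>) F (sum2 F) (sum0 F)"
    and multiplicative_functor:
      "braided_monoidal_functor (braided_multiplicative \<C>) (braided_multiplicative \<D>) F (prod2 F) (prod0 F)"
    and functor_lnull: "A \<in> Obj \<C>
          \<Longrightarrow> ar_map F (\<Lambda>\<^sub>\<bullet>\<^bsub>\<C>\<^esub> A) \<cdot>\<^bsub>\<D>\<^esub> prod2 F \<zero>\<^bsub>\<C>\<^esub> A \<cdot>\<^bsub>\<D>\<^esub> (sum0 F \<otimes>\<^sub>a\<^bsub>\<D>\<^esub> \<iota>\<^bsub>\<D>\<^esub> (ob_map F A))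
            = sum0 F \<cdot>\<^bsub>\<D>\<^esub> \<Lambda>\<^sub>\<bullet>\<^bsub>\<D>\<^esub> (ob_map F A)"
    and functor_ldist: "\<lbrakk>A \<in> Obj \<C>; B \<in> Obj \<C>; C \<in> Obj \<C>\<rbrakk>
          \<Longrightarrow> ar_map F (\<delta>\<^sub>l\<^bsub>\<C>\<^esub> A B C) \<cdot>\<^bsub>\<D>\<^esub> prod2 F A (B \<oplus>\<^bsub>\<C>\<^esub> C) \<cdot>\<^bsub>\<D>\<^esub>
                (\<iota>\<^bsub>\<D>\<^esub> (ob_map F A) \<otimes>\<^sub>a\<^bsub>\<D>\<^esub> sum2 F B C)
            = sum2 F (A \<otimes>\<^bsub>\<C>\<^esub> B) (A \<otimes>\<^bsub>\<C>\<^esub> C) \<cdot>\<^bsub>\<D>\<^esub> (prod2 F A B \<oplus>\<^sub>a\<^bsub>\<D>\<^esub> prod2 F A C) \<cdot>\<^bsub>\<D>\<^esub>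
                \<delta>\<^sub>l\<^bsub>\<D>\<^esub> (ob_map F A) (ob_map F B) (ob_map F C)"

locale robust_braided_bimonoidal_functor = braided_bimonoidal_functor +
  assumes sum2_iso: "\<lbrakk>A \<in> Obj \<C>; B \<in> Obj \<C>\<rbrakk> \<Longrightarrow> is_iso \<D> (sum2 F A B)"
    and sum0_iso: "is_iso \<D> (sum0 F)"
    and prod0_iso: "is_iso \<D> (prod0 F)"

locale bimonoidal_nat_trans = nat_trans \<C> \<D> F G \<tau>
  for \<C> :: "('o, 'm, 'y) braided_bimonoidal_data_scheme"
    and \<D> :: "('p, 'n, 'z) braided_bimonoidal_data_scheme"
    and F :: "('o, 'm, 'p, 'n, 'v) bimonoidal_functor_data_scheme"
    and G :: "('o, 'm, 'p, 'n, 'w) bimonoidal_functor_data_scheme" and \<tau> +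
  assumes additive_nat_trans:
      "monoidal_nat_trans (additive \<C>) (additive \<D>) F (sum2 F) (sum0 F) G (sum2 G) (sum0 G) \<tau>"
    and multiplicative_nat_trans:
      "monoidal_nat_trans (multiplicative \<C>) (multiplicative \<D>) F (prod2 F) (prod0 F) G (prod2 G) (prod0 G) \<tau>"

text \<open>
  The category of robust braided bimonoidal functors \<open>\<C> \<rightarrow> \<D>\<close> and bimonoidal transformations, that is,
  the hom-category of the 2-category of flat small braided bimonoidal categories. An arrow is a triple of its source, its
  target and the family of components.
\<close>

definition robust_functor_category ::
  "('o, 'm, 'y) braided_bimonoidal_data_scheme \<Rightarrow> ('p, 'n, 'z) braided_bimonoidal_data_scheme \<Rightarrow>
   (('o, 'm, 'p, 'n) bimonoidal_functor_data,
    ('o, 'm, 'p, 'n) bimonoidal_functor_data \<times> ('o, 'm, 'p, 'n) bimonoidal_functor_data \<times> ('o \<Rightarrow> 'n)) cat"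
  where
  "robust_functor_category \<C> \<D> =
     \<lparr>Obj = {F. robust_braided_bimonoidal_functor \<C> \<D> F},
      Arr = {(F, G, \<tau>). robust_braided_bimonoidal_functor \<C> \<D> F \<and>
               robust_braided_bimonoidal_functor \<C> \<D> G \<and> bimonoidal_nat_trans \<C> \<D> F G \<tau>},
      Src = (\<lambda>(F, G, \<tau>). F),
      Tgt = (\<lambda>(F, G, \<tau>). G),
      Ide = (\<lambda>F. (F, F, \<lambda>A \<in> Obj \<C>. \<iota>\<^bsub>\<D>\<^esub> (ob_map F A))),
      Comp = (\<lambda>(G', H, \<tau>) (F, G, \<sigma>). (F, H, \<lambda>A \<in> Obj \<C>. \<tau> A \<cdot>\<^bsub>\<D>\<^esub> \<sigma> A))\<rparr>"


section \<open>The finite ordinal category\<close>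

text \<open>
  An arrow \<open>n \<rightarrow> n\<close> is a pair \<open>(n, \<sigma>)\<close> with \<open>\<sigma>\<close> a permutation of \<open>{1..n}\<close>, extended by the identity
  to all natural numbers.
\<close>

definition perm_arrow :: "nat \<Rightarrow> (nat \<Rightarrow> nat) \<Rightarrow> nat \<times> (nat \<Rightarrow> nat)" where
  "perm_arrow n \<sigma> = (n, \<lambda>k. if k \<in> {1..n} then \<sigma> k else k)"

text \<open>
  The pair \<open>(i, j)\<close> with \<open>1 \<le> i \<le> m\<close> and \<open>1 \<le> j \<le> n\<close> is identified with \<open>pair_index m i j \<in> {1..m * n}\<close>;
  \<open>fst_index m\<close> and \<open>snd_index m\<close> recover \<open>i\<close> and \<open>j\<close>.
\<close>

definition pair_index :: "nat \<Rightarrow> nat \<Rightarrow> nat \<Rightarrow> nat" where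
  "pair_index m i j = i + (j - 1) * m"

definition fst_index :: "nat \<Rightarrow> nat \<Rightarrow> nat" where
  "fst_index m k = (k - 1) mod m + 1"

definition snd_index :: "nat \<Rightarrow> nat \<Rightarrow> nat" where
  "snd_index m k = (k - 1) div m + 1"

definition finite_ordinal_category :: "(nat, nat \<times> (nat \<Rightarrow> nat)) braided_bimonoidal_data" where
  "finite_ordinal_category =
     \<lparr>Obj = UNIV,
      Arr = {(n, \<sigma>). \<sigma> permutes {1..n}},
      Src = fst,
      Tgt = fst,
      Ide = (\<lambda>n. (n, id)),
      Comp = (\<lambda>(n, \<tau>) (m, \<sigma>). (m, \<tau> \<circ> \<sigma>)),
      sumO = (+),
      sumA = (\<lambda>(m, \<sigma>) (n, \<tau>). perm_arrow (m + n) (\<lambda>k. if k \<le> m then \<sigma> k else m + \<tau> (k - m))),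
      zeroO = 0,
      sum_assoc = (\<lambda>m n p. (m + n + p, id)),
      sum_lunit = (\<lambda>n. (n, id)),
      sum_runit = (\<lambda>n. (n, id)),
      sum_braid = (\<lambda>m n. perm_arrow (m + n) (\<lambda>k. if k \<le> m then n + k else k - m)),
      prodO = (*),
      prodA = (\<lambda>(m, \<sigma>) (n, \<tau>). perm_arrow (m * n)
                 (\<lambda>k. pair_index m (\<sigma> (fst_index m k)) (\<tau> (snd_index m k)))),
      oneO = 1,
      prod_assoc = (\<lambda>m n p. (m * n * p, id)),
      prod_lunit = (\<lambda>n. (n, id)),
      prod_runit = (\<lambda>n. (n, id)),
      lnull = (\<lambda>n. (0, id)),
      rnull = (\<lambda>n. (0, id)),
      ldist = (\<lambda>m n p. (m * (n + p), id)),
      rdist = (\<lambda>m n p. perm_arrow ((m + n) * p)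
                 (\<lambda>k. let i = fst_index (m + n) k; j = snd_index (m + n) k
                      in if i \<le> m then pair_index m i j else m * p + pair_index n (i - m) j)),
      prod_braid = (\<lambda>m n. perm_arrow (m * n) (\<lambda>k. pair_index n (snd_index m k) (fst_index m k)))\<rparr>"

end

theory Submission
  imports Defs
begin

text \<open>
  The groupoid of finite ordinals is generated, under composition and addition, by the identities and
  the exchange of two points. A robust functor \<open>F\<close> preserves sums and the objects \<open>0\<close> and \<open>1\<close> up to
  isomorphism, so a bimonoidal transformation \<open>F \<rightarrow> G\<close> is determined by its components at \<open>0\<close> and
  \<open>1\<close>, and these are forced by the unit isomorphisms. Conversely the components so
  determined are natural, because naturality holds at the generators and is inherited by composites
  and sums, and they are compatible with products, because \<open>n = 1 + \<dots> + 1\<close> and \<open>F\<close> and \<open>G\<close> are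
  compatible with distributivity (\<open>compare_natural\<close>, \<open>compare_prod\<close>, \<open>compare_unique\<close>). Hence there
  is exactly one arrow between any two objects of the category of robust functors, and such a category
  is equivalent to the terminal one as soon as it has an object.

  The remaining point is to construct one robust functor. On objects it takes \<open>n\<close> to the right-nested
  sum \<open>X n = 1 + (1 + \<dots> (1 + 0))\<close>. A permutation of \<open>n + 1\<close> points is uniquely a permutation of the last
  \<open>n\<close> points followed by a cycle that moves the first point to its place, and this prescribes its
  image (\<open>perm_map\<close>). Functoriality reduces to multiplication by an adjacent transposition from the
  left, hence to a multiplication table of adjacent transpositions and cycles (\<open>transp_cyc\<close>,
  \<open>transp_cyc_Suc\<close>, \<open>transp_cyc_less\<close>, \<open>transp_cyc_greater\<close>) that holds in every symmetric monoidal
  category, by symmetry, naturality and the Yang-Baxter equation; since the finite ordinals are such a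
  category too, the same table computes with permutations.

  The isomorphism \<open>X m + X n \<rightarrow> X (m + n)\<close> (\<open>merge\<close>) moves brackets. The arrow
  \<open>X m \<times> X n \<rightarrow> X (m \<times> n)\<close> (\<open>distribute\<close>) multiplies out the second factor by left distributivity.
  Most of its properties say that two ways of multiplying out agree and follow by
  induction on the factor that is multiplied out, where the induction step is one of the axioms on
  distributivity. The exception is the braiding, which interchanges left and right distributivity; it
  needs the analogue of \<open>distribute\<close> on the right, and the link is the axiom that
  equates the two ways to multiply out \<open>(A + B) \<times> (C + D)\<close> (\<open>distribute_rdist\<close>).
\<close>

section \<open>Composition of arrows\<close>

context category
begin

lemma hom_iff: "f \<in> Hom \<C> A B \<longleftrightarrow> f \<in> Arr \<C> \<and> Src \<C> f = A \<and> Tgt \<C> f = B"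
  by (auto simp: Hom_def)

lemma src_ob [simp]: "f \<in> Arr \<C> \<Longrightarrow> Src \<C> f \<in> Obj \<C>"
  by (rule src_obj)

lemma tgt_ob [simp]: "f \<in> Arr \<C> \<Longrightarrow> Tgt \<C> f \<in> Obj \<C>"
  by (rule tgt_obj)

lemma ide_arr [simp]:
  assumes "A \<in> Obj \<C>"
  shows "\<iota> A \<in> Arr \<C>" "Src \<C> (\<iota> A) = A" "Tgt \<C> (\<iota> A) = A"
  using ide_hom[OF assms] by (auto simp: hom_iff)

lemma comp_arr [simp]:
  assumes "f \<in> Arr \<C>" "g \<in> Arr \<C>" "Src \<C> g = Tgt \<C> f"
  shows "g \<cdot> f \<in> Arr \<C>" "Src \<C> (g \<cdot> f) = Src \<C> f" "Tgt \<C> (g \<cdot> f) = Tgt \<C> g"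
  using comp_hom[of f "Src \<C> f" "Src \<C> g" g "Tgt \<C> g"] assms by (auto simp: hom_iff)

lemma comp_ass [simp]:
  assumes "f \<in> Arr \<C>" "g \<in> Arr \<C>" "h \<in> Arr \<C>" "Src \<C> g = Tgt \<C> f" "Src \<C> h = Tgt \<C> g"
  shows "(h \<cdot> g) \<cdot> f = h \<cdot> (g \<cdot> f)"
  using comp_assoc[of f "Src \<C> f" "Src \<C> g" g "Src \<C> h" h "Tgt \<C> h"] assms by (auto simp: hom_iff)

lemma ide_left [simp]: "f \<in> Arr \<C> \<Longrightarrow> Tgt \<C> f = B \<Longrightarrow> \<iota> B \<cdot> f = f"
  using comp_ide_left[of f "Src \<C> f" "Tgt \<C> f"] by (auto simp: hom_iff)

lemma ide_right [simp]: "f \<in> Arr \<C> \<Longrightarrow> Src \<C> f = A \<Longrightarrow> f \<cdot> \<iota> A = f"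
  using comp_ide_right[of f "Src \<C> f" "Tgt \<C> f"] by (auto simp: hom_iff)

text \<open>
  Simplification brackets composites to the right; in this form an equation applies in the middle of
  such a chain.
\<close>

lemma reassoc:
  assumes "g \<cdot> f = h" "f \<in> Arr \<C>" "g \<in> Arr \<C>" "Src \<C> g = Tgt \<C> f"
    and "k \<in> Arr \<C>" "Tgt \<C> k = Src \<C> f"
  shows "g \<cdot> (f \<cdot> k) = h \<cdot> k"
  using assms by (metis comp_ass)

lemma inverse_arrows_unique:
  assumes "inverse_arrows \<C> f g" "inverse_arrows \<C> f h"
  shows "g = h"
proof -
  have "g = g \<cdot> (f \<cdot> h)"
    using assms by (auto simp: inverse_arrows_def hom_iff)
  also have "\<dots> = (g \<cdot> f) \<cdot> h"
    using assms by (intro comp_ass[symmetric]) (auto simp: inverse_arrows_def hom_iff)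
  also have "\<dots> = h"
    using assms by (auto simp: inverse_arrows_def hom_iff)
  finally show ?thesis .
qed

lemma arr_inv_eq: "inverse_arrows \<C> f g \<Longrightarrow> arr_inv \<C> f = g"
  unfolding arr_inv_def by (blast intro: inverse_arrows_unique)

lemma isoI:
  assumes "f \<in> Arr \<C>" "g \<in> Arr \<C>" "Src \<C> g = Tgt \<C> f" "Tgt \<C> g = Src \<C> f"
    "g \<cdot> f = \<iota> (Src \<C> f)" "f \<cdot> g = \<iota> (Tgt \<C> f)"
  shows "is_iso \<C> f" "arr_inv \<C> f = g"
proof -
  have "inverse_arrows \<C> f g"
    using assms by (auto simp: inverse_arrows_def hom_iff)
  then show "is_iso \<C> f" "arr_inv \<C> f = g"
    by (auto simp: is_iso_def arr_inv_eq)
qed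

lemma iso_arr: "is_iso \<C> f \<Longrightarrow> f \<in> Arr \<C>"
  by (auto simp: is_iso_def inverse_arrows_def)

lemma inv_facts [simp]:
  assumes "is_iso \<C> f"
  shows "arr_inv \<C> f \<in> Arr \<C>" "Src \<C> (arr_inv \<C> f) = Tgt \<C> f" "Tgt \<C> (arr_inv \<C> f) = Src \<C> f"
    "arr_inv \<C> f \<cdot> f = \<iota> (Src \<C> f)" "f \<cdot> arr_inv \<C> f = \<iota> (Tgt \<C> f)"
proof -
  obtain g where "inverse_arrows \<C> f g"
    using assms by (auto simp: is_iso_def)
  then show "arr_inv \<C> f \<in> Arr \<C>" "Src \<C> (arr_inv \<C> f) = Tgt \<C> f"
    "Tgt \<C> (arr_inv \<C> f) = Src \<C> f"
    "arr_inv \<C> f \<cdot> f = \<iota> (Src \<C> f)" "f \<cdot> arr_inv \<C> f = \<iota> (Tgt \<C> f)"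
    by (auto simp: arr_inv_eq inverse_arrows_def hom_iff)
qed

lemma inv_cancel [simp]:
  assumes "is_iso \<C> f" "k \<in> Arr \<C>"
  shows "Tgt \<C> k = Src \<C> f \<Longrightarrow> arr_inv \<C> f \<cdot> (f \<cdot> k) = k"
    and "Tgt \<C> k = Tgt \<C> f \<Longrightarrow> f \<cdot> (arr_inv \<C> f \<cdot> k) = k"
proof -
  have f: "f \<in> Arr \<C>"
    by (rule iso_arr[OF assms(1)])
  show "arr_inv \<C> f \<cdot> (f \<cdot> k) = k" if "Tgt \<C> k = Src \<C> f"
    using comp_ass[of k f "arr_inv \<C> f"] that assms f by simp
  show "f \<cdot> (arr_inv \<C> f \<cdot> k) = k" if "Tgt \<C> k = Tgt \<C> f"
    using comp_ass[of k "arr_inv \<C> f" f] that assms f by simp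
qed

lemma ide_iso [simp]:
  assumes "A \<in> Obj \<C>"
  shows "is_iso \<C> (\<iota> A)" "arr_inv \<C> (\<iota> A) = \<iota> A"
  using assms by (auto intro!: isoI(1)[where g = "\<iota> A"] isoI(2))

lemma inv_iso [simp]: "is_iso \<C> f \<Longrightarrow> is_iso \<C> (arr_inv \<C> f)"
  using iso_arr by (auto intro!: isoI(1)[where g = f])

lemma comp_iso [simp]:
  assumes "is_iso \<C> f" "is_iso \<C> g" "Src \<C> g = Tgt \<C> f"
  shows "is_iso \<C> (g \<cdot> f)" "arr_inv \<C> (g \<cdot> f) = arr_inv \<C> f \<cdot> arr_inv \<C> g"
proof -
  have [simp]: "f \<in> Arr \<C>" "g \<in> Arr \<C>"
    using assms iso_arr by auto
  show "is_iso \<C> (g \<cdot> f)" "arr_inv \<C> (g \<cdot> f) = arr_inv \<C> f \<cdot> arr_inv \<C> g"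
    by (rule isoI[where g = "arr_inv \<C> f \<cdot> arr_inv \<C> g"]; simp add: assms)+
qed

lemma iso_monic: "is_iso \<C> f \<Longrightarrow> monic \<C> f"
  unfolding monic_def using iso_arr by (metis hom_iff inv_cancel(1))

lemma iso_cancel_right:
  assumes "f \<cdot> h = g \<cdot> h" "is_iso \<C> h" "f \<in> Arr \<C>" "g \<in> Arr \<C>" "Src \<C> f = Tgt \<C> h" "Src \<C> g = Tgt \<C> h"
  shows "f = g"
proof -
  have "(f \<cdot> h) \<cdot> arr_inv \<C> h = (g \<cdot> h) \<cdot> arr_inv \<C> h"
    using assms(1) by simp
  moreover have "h \<in> Arr \<C>"
    by (rule iso_arr[OF assms(2)])
  ultimately show ?thesis
    using assms(2-) by simp
qed

lemma iso_cancel_left: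
  assumes "h \<cdot> f = h \<cdot> g" "is_iso \<C> h" "f \<in> Arr \<C>" "g \<in> Arr \<C>" "Tgt \<C> f = Src \<C> h" "Tgt \<C> g = Src \<C> h"
  shows "f = g"
  using assms by (metis inv_cancel(1))

lemma iso_move_right:
  assumes "f \<cdot> h = g" "is_iso \<C> h" "f \<in> Arr \<C>" "Src \<C> f = Tgt \<C> h"
  shows "f = g \<cdot> arr_inv \<C> h"
  using assms iso_arr by auto

end

section \<open>Monoidal categories\<close>

context monoidal_category
begin

lemma tensor_ob [simp]: "\<lbrakk>A \<in> Obj \<C>; B \<in> Obj \<C>\<rbrakk> \<Longrightarrow> A \<odot> B \<in> Obj \<C>"
  by (rule tensor_obj)

lemma unit_ob [simp]: "\<I> \<in> Obj \<C>"
  by (rule unit_obj)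

lemma tensor_arr [simp]:
  assumes "f \<in> Arr \<C>" "g \<in> Arr \<C>"
  shows "f \<odot>\<^sub>a g \<in> Arr \<C>" "Src \<C> (f \<odot>\<^sub>a g) = Src \<C> f \<odot> Src \<C> g" "Tgt \<C> (f \<odot>\<^sub>a g) = Tgt \<C> f \<odot> Tgt \<C> g"
  using tensor_hom[of f "Src \<C> f" "Tgt \<C> f" g "Src \<C> g" "Tgt \<C> g"] assms by (auto simp: hom_iff)

lemma tensor_id [simp]: "\<lbrakk>A \<in> Obj \<C>; B \<in> Obj \<C>\<rbrakk> \<Longrightarrow> \<iota> A \<odot>\<^sub>a \<iota> B = \<iota> (A \<odot> B)"
  by (rule tensor_ide)

lemma interchange [simp]:
  assumes "f \<in> Arr \<C>" "f' \<in> Arr \<C>" "Src \<C> f' = Tgt \<C> f" "g \<in> Arr \<C>" "g' \<in> Arr \<C>" "Src \<C> g' = Tgt \<C> g"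
  shows "(f' \<odot>\<^sub>a g') \<cdot> (f \<odot>\<^sub>a g) = (f' \<cdot> f) \<odot>\<^sub>a (g' \<cdot> g)"
  using tensor_comp[of f "Src \<C> f" "Tgt \<C> f" f' "Tgt \<C> f'" g "Src \<C> g" "Tgt \<C> g" g' "Tgt \<C> g'"] assms
  by (auto simp: hom_iff)

lemma interchange_assoc [simp]:
  assumes "f \<in> Arr \<C>" "f' \<in> Arr \<C>" "Src \<C> f' = Tgt \<C> f" "g \<in> Arr \<C>" "g' \<in> Arr \<C>" "Src \<C> g' = Tgt \<C> g"
    "k \<in> Arr \<C>" "Tgt \<C> k = Src \<C> f \<odot> Src \<C> g"
  shows "(f' \<odot>\<^sub>a g') \<cdot> (f \<odot>\<^sub>a g) \<cdot> k = ((f' \<cdot> f) \<odot>\<^sub>a (g' \<cdot> g)) \<cdot> k"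
  using assms by (intro reassoc) auto

lemma tensor_iso [simp]:
  assumes "is_iso \<C> f" "is_iso \<C> g"
  shows "is_iso \<C> (f \<odot>\<^sub>a g)" "arr_inv \<C> (f \<odot>\<^sub>a g) = arr_inv \<C> f \<odot>\<^sub>a arr_inv \<C> g"
proof -
  have [simp]: "f \<in> Arr \<C>" "g \<in> Arr \<C>"
    using assms iso_arr by auto
  show "is_iso \<C> (f \<odot>\<^sub>a g)" "arr_inv \<C> (f \<odot>\<^sub>a g) = arr_inv \<C> f \<odot>\<^sub>a arr_inv \<C> g"
    by (rule isoI[where g = "arr_inv \<C> f \<odot>\<^sub>a arr_inv \<C> g"]; simp add: assms)+
qed

lemma assoc_arr [simp]:
  assumes "A \<in> Obj \<C>" "B \<in> Obj \<C>" "C \<in> Obj \<C>"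
  shows "assoc \<C> A B C \<in> Arr \<C>" "Src \<C> (assoc \<C> A B C) = (A \<odot> B) \<odot> C"
    "Tgt \<C> (assoc \<C> A B C) = A \<odot> (B \<odot> C)" "is_iso \<C> (assoc \<C> A B C)"
  using assoc_iso[OF assms] by (auto simp: Iso_def hom_iff)

lemma lunit_arr [simp]:
  assumes "A \<in> Obj \<C>"
  shows "lunit \<C> A \<in> Arr \<C>" "Src \<C> (lunit \<C> A) = \<I> \<odot> A" "Tgt \<C> (lunit \<C> A) = A" "is_iso \<C> (lunit \<C> A)"
  using lunit_iso[OF assms] by (auto simp: Iso_def hom_iff)

lemma runit_arr [simp]:
  assumes "A \<in> Obj \<C>"
  shows "runit \<C> A \<in> Arr \<C>" "Src \<C> (runit \<C> A) = A \<odot> \<I>" "Tgt \<C> (runit \<C> A) = A" "is_iso \<C> (runit \<C> A)"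
  using runit_iso[OF assms] by (auto simp: Iso_def hom_iff)

lemma assoc_natural:
  assumes "f \<in> Arr \<C>" "g \<in> Arr \<C>" "h \<in> Arr \<C>"
    and "A = Tgt \<C> f" "B = Tgt \<C> g" "C = Tgt \<C> h"
  shows "assoc \<C> A B C \<cdot> ((f \<odot>\<^sub>a g) \<odot>\<^sub>a h)
       = (f \<odot>\<^sub>a (g \<odot>\<^sub>a h)) \<cdot> assoc \<C> (Src \<C> f) (Src \<C> g) (Src \<C> h)"
  using assms by (auto intro!: assoc_nat simp: hom_iff)

lemma lunit_natural:
  "f \<in> Arr \<C> \<Longrightarrow> A = Tgt \<C> f \<Longrightarrow> lunit \<C> A \<cdot> (\<iota> \<I> \<odot>\<^sub>a f) = f \<cdot> lunit \<C> (Src \<C> f)"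
  by (auto intro!: lunit_nat simp: hom_iff)

lemma runit_natural:
  "f \<in> Arr \<C> \<Longrightarrow> A = Tgt \<C> f \<Longrightarrow> runit \<C> A \<cdot> (f \<odot>\<^sub>a \<iota> \<I>) = f \<cdot> runit \<C> (Src \<C> f)"
  by (auto intro!: runit_nat simp: hom_iff)

text \<open>
  Tensoring with the unit is naturally isomorphic to the identity functor, hence faithful.
\<close>

lemma unit_tensor_faithful:
  assumes "\<iota> \<I> \<odot>\<^sub>a f = \<iota> \<I> \<odot>\<^sub>a g" "f \<in> Arr \<C>" "g \<in> Arr \<C>" "Src \<C> f = Src \<C> g" "Tgt \<C> f = Tgt \<C> g"
  shows "f = g"
proof (rule iso_cancel_right)
  show "f \<cdot> lunit \<C> (Src \<C> f) = g \<cdot> lunit \<C> (Src \<C> f)"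
    using lunit_natural[of f "Tgt \<C> f"] lunit_natural[of g "Tgt \<C> f"] assms by simp
qed (use assms in auto)

lemma tensor_unit_faithful:
  assumes "f \<odot>\<^sub>a \<iota> \<I> = g \<odot>\<^sub>a \<iota> \<I>" "f \<in> Arr \<C>" "g \<in> Arr \<C>" "Src \<C> f = Src \<C> g" "Tgt \<C> f = Tgt \<C> g"
  shows "f = g"
proof (rule iso_cancel_right)
  show "f \<cdot> runit \<C> (Src \<C> f) = g \<cdot> runit \<C> (Src \<C> f)"
    using runit_natural[of f "Tgt \<C> f"] runit_natural[of g "Tgt \<C> f"] assms by simp
qed (use assms in auto)

text \<open>
  Kelly's argument: after tensoring with the unit, both unit identities become pentagons in which
  all other faces are triangles or naturality squares.
\<close>

lemma lunit_tensor:
  assumes [simp]: "A \<in> Obj \<C>" "B \<in> Obj \<C>"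
  shows "lunit \<C> (A \<odot> B) \<cdot> assoc \<C> \<I> A B = lunit \<C> A \<odot>\<^sub>a \<iota> B"
proof (rule unit_tensor_faithful)
  let ?k = "assoc \<C> \<I> (\<I> \<odot> A) B \<cdot> (assoc \<C> \<I> \<I> A \<odot>\<^sub>a \<iota> B)"
  have "(\<iota> \<I> \<odot>\<^sub>a (lunit \<C> (A \<odot> B) \<cdot> assoc \<C> \<I> A B)) \<cdot> ?k
      = (\<iota> \<I> \<odot>\<^sub>a lunit \<C> (A \<odot> B)) \<cdot> ((\<iota> \<I> \<odot>\<^sub>a assoc \<C> \<I> A B) \<cdot> ?k)"
    by simp
  also have "\<dots> = (\<iota> \<I> \<odot>\<^sub>a lunit \<C> (A \<odot> B)) \<cdot> assoc \<C> \<I> \<I> (A \<odot> B) \<cdot> assoc \<C> (\<I> \<odot> \<I>) A B"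
    using pentagon[of \<I> \<I> A B] by (simp del: interchange_assoc)
  also have "\<dots> = (runit \<C> \<I> \<odot>\<^sub>a (\<iota> A \<odot>\<^sub>a \<iota> B)) \<cdot> assoc \<C> (\<I> \<odot> \<I>) A B"
    using reassoc[OF triangle[of \<I> "A \<odot> B"]] by simp
  also have "\<dots> = assoc \<C> \<I> A B \<cdot> ((runit \<C> \<I> \<odot>\<^sub>a \<iota> A) \<odot>\<^sub>a \<iota> B)"
    using assoc_natural[of "runit \<C> \<I>" "\<iota> A" "\<iota> B" \<I> A B] by simp
  also have "\<dots> = assoc \<C> \<I> A B \<cdot> (((\<iota> \<I> \<odot>\<^sub>a lunit \<C> A) \<cdot> assoc \<C> \<I> \<I> A) \<odot>\<^sub>a \<iota> B)"
    by (simp add: triangle)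
  also have "\<dots> = assoc \<C> \<I> A B \<cdot> (((\<iota> \<I> \<odot>\<^sub>a lunit \<C> A) \<odot>\<^sub>a \<iota> B) \<cdot> (assoc \<C> \<I> \<I> A \<odot>\<^sub>a \<iota> B))"
    by simp
  also have "\<dots> = (\<iota> \<I> \<odot>\<^sub>a (lunit \<C> A \<odot>\<^sub>a \<iota> B)) \<cdot> ?k"
    using reassoc[OF assoc_natural[of "\<iota> \<I>" "lunit \<C> A" "\<iota> B" \<I> A B],
        of "assoc \<C> \<I> \<I> A \<odot>\<^sub>a \<iota> B"] by (simp del: interchange interchange_assoc)
  finally show "\<iota> \<I> \<odot>\<^sub>a (lunit \<C> (A \<odot> B) \<cdot> assoc \<C> \<I> A B) = \<iota> \<I> \<odot>\<^sub>a (lunit \<C> A \<odot>\<^sub>a \<iota> B)"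
    by (rule iso_cancel_right) simp_all
qed simp_all

lemma runit_tensor:
  assumes [simp]: "A \<in> Obj \<C>" "B \<in> Obj \<C>"
  shows "(\<iota> A \<odot>\<^sub>a runit \<C> B) \<cdot> assoc \<C> A B \<I> = runit \<C> (A \<odot> B)"
proof (rule tensor_unit_faithful)
  let ?k = "(\<iota> A \<odot>\<^sub>a assoc \<C> B \<I> \<I>) \<cdot> assoc \<C> A (B \<odot> \<I>) \<I>"
  let ?l = "\<iota> A \<odot>\<^sub>a (\<iota> B \<odot>\<^sub>a lunit \<C> \<I>)"
  have "assoc \<C> A B \<I> \<cdot> (((\<iota> A \<odot>\<^sub>a runit \<C> B) \<cdot> assoc \<C> A B \<I>) \<odot>\<^sub>a \<iota> \<I>)
     = (assoc \<C> A B \<I> \<cdot> ((\<iota> A \<odot>\<^sub>a runit \<C> B) \<odot>\<^sub>a \<iota> \<I>)) \<cdot> (assoc \<C> A B \<I> \<odot>\<^sub>a \<iota> \<I>)"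
    by simp
  also have "\<dots> = ((\<iota> A \<odot>\<^sub>a (runit \<C> B \<odot>\<^sub>a \<iota> \<I>)) \<cdot> assoc \<C> A (B \<odot> \<I>) \<I>) \<cdot> (assoc \<C> A B \<I> \<odot>\<^sub>a \<iota> \<I>)"
    by (simp add: assoc_natural del: interchange interchange_assoc)
  also have "\<dots> = ?l \<cdot> ?k \<cdot> (assoc \<C> A B \<I> \<odot>\<^sub>a \<iota> \<I>)"
    by (simp add: triangle[symmetric])
  also have "\<dots> = ?l \<cdot> assoc \<C> A B (\<I> \<odot> \<I>) \<cdot> assoc \<C> (A \<odot> B) \<I> \<I>"
    using pentagon[of A B \<I> \<I>] by (simp del: interchange_assoc)
  also have "\<dots> = assoc \<C> A B \<I> \<cdot> ((\<iota> (A \<odot> B) \<odot>\<^sub>a lunit \<C> \<I>) \<cdot> assoc \<C> (A \<odot> B) \<I> \<I>)"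
    using reassoc[OF assoc_natural[of "\<iota> A" "\<iota> B" "lunit \<C> \<I>" A B \<I>],
        of "assoc \<C> (A \<odot> B) \<I> \<I>"] by simp
  also have "\<dots> = assoc \<C> A B \<I> \<cdot> (runit \<C> (A \<odot> B) \<odot>\<^sub>a \<iota> \<I>)"
    by (simp add: triangle)
  finally show "((\<iota> A \<odot>\<^sub>a runit \<C> B) \<cdot> assoc \<C> A B \<I>) \<odot>\<^sub>a \<iota> \<I> = runit \<C> (A \<odot> B) \<odot>\<^sub>a \<iota> \<I>"
    by (rule iso_cancel_left) simp_all
qed simp_all

text \<open>
  Naturality of \<open>\<lambda>\<close> at \<open>\<lambda>\<close> itself identifies \<open>1 \<odot> \<lambda>\<close> with \<open>\<lambda>\<close>, so that the triangle computes both sides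
  after tensoring with the unit.
\<close>

lemma lunit_unit: "lunit \<C> \<I> = runit \<C> \<I>"
proof -
  have "lunit \<C> \<I> \<cdot> (\<iota> \<I> \<odot>\<^sub>a lunit \<C> \<I>) = lunit \<C> \<I> \<cdot> lunit \<C> (\<I> \<odot> \<I>)"
    using lunit_natural[of "lunit \<C> \<I>" \<I>] by simp
  then have 1: "\<iota> \<I> \<odot>\<^sub>a lunit \<C> \<I> = lunit \<C> (\<I> \<odot> \<I>)"
    by (rule iso_cancel_left) simp_all
  have "lunit \<C> \<I> \<odot>\<^sub>a \<iota> \<I> = runit \<C> \<I> \<odot>\<^sub>a \<iota> \<I>"
    using lunit_tensor[of \<I> \<I>] triangle[of \<I> \<I>] by (simp add: 1)
  then show ?thesis
    by (rule tensor_unit_faithful) simp_all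
qed

end

context braided_monoidal_category
begin

lemma braid_arr [simp]:
  assumes "A \<in> Obj \<C>" "B \<in> Obj \<C>"
  shows "braid \<C> A B \<in> Arr \<C>" "Src \<C> (braid \<C> A B) = A \<odot> B"
    "Tgt \<C> (braid \<C> A B) = B \<odot> A" "is_iso \<C> (braid \<C> A B)"
  using braid_iso[OF assms] by (auto simp: Iso_def hom_iff)

lemma braid_natural:
  assumes "f \<in> Arr \<C>" "g \<in> Arr \<C>" "A = Tgt \<C> f" "B = Tgt \<C> g"
  shows "braid \<C> A B \<cdot> (f \<odot>\<^sub>a g) = (g \<odot>\<^sub>a f) \<cdot> braid \<C> (Src \<C> f) (Src \<C> g)"
  using assms by (auto intro!: braid_nat simp: hom_iff)

text \<open>
  The hexagon with two units collapses, by the triangle and naturality, to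
  \<open>\<phi> \<cdot> (\<rho> \<odot> 1) = \<phi> \<cdot> (\<phi> \<odot> 1)\<close> for \<open>\<phi> = \<lambda> \<cdot> \<zeta>\<close>.
\<close>

lemma lunit_braid:
  assumes [simp]: "A \<in> Obj \<C>"
  shows "lunit \<C> A \<cdot> braid \<C> A \<I> = runit \<C> A"
proof -
  let ?z = "braid \<C> A \<I>" and ?p = "lunit \<C> A \<cdot> braid \<C> A \<I>"
  have "?z \<cdot> (runit \<C> A \<odot>\<^sub>a \<iota> \<I>) = ?z \<cdot> ((\<iota> A \<odot>\<^sub>a lunit \<C> \<I>) \<cdot> assoc \<C> A \<I> \<I>)"
    by (simp add: triangle)
  also have "\<dots> = (lunit \<C> \<I> \<odot>\<^sub>a \<iota> A) \<cdot> braid \<C> A (\<I> \<odot> \<I>) \<cdot> assoc \<C> A \<I> \<I>"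
    using reassoc[OF braid_natural[of "\<iota> A" "lunit \<C> \<I>" A \<I>], of "assoc \<C> A \<I> \<I>"] by simp
  also have "\<dots> = (\<iota> \<I> \<odot>\<^sub>a lunit \<C> A) \<cdot> assoc \<C> \<I> \<I> A \<cdot> braid \<C> A (\<I> \<odot> \<I>) \<cdot> assoc \<C> A \<I> \<I>"
    using reassoc[OF triangle[of \<I> A]] by (simp add: lunit_unit)
  also have "\<dots> = (\<iota> \<I> \<odot>\<^sub>a lunit \<C> A) \<cdot> (\<iota> \<I> \<odot>\<^sub>a ?z) \<cdot> assoc \<C> \<I> A \<I> \<cdot> (?z \<odot>\<^sub>a \<iota> \<I>)"
    by (simp add: hexagon1 del: interchange_assoc)
  also have "\<dots> = (\<iota> \<I> \<odot>\<^sub>a ?p) \<cdot> assoc \<C> \<I> A \<I> \<cdot> (?z \<odot>\<^sub>a \<iota> \<I>)"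
    by simp
  finally have "?p \<cdot> (runit \<C> A \<odot>\<^sub>a \<iota> \<I>)
      = lunit \<C> A \<cdot> (\<iota> \<I> \<odot>\<^sub>a ?p) \<cdot> assoc \<C> \<I> A \<I> \<cdot> (?z \<odot>\<^sub>a \<iota> \<I>)"
    by simp
  also have "\<dots> = ?p \<cdot> (lunit \<C> (A \<odot> \<I>) \<cdot> assoc \<C> \<I> A \<I>) \<cdot> (?z \<odot>\<^sub>a \<iota> \<I>)"
    using reassoc[OF lunit_natural[of ?p A], of "assoc \<C> \<I> A \<I> \<cdot> (?z \<odot>\<^sub>a \<iota> \<I>)"] by simp
  also have "\<dots> = ?p \<cdot> (?p \<odot>\<^sub>a \<iota> \<I>)"
    by (simp add: lunit_tensor)
  finally have "runit \<C> A \<odot>\<^sub>a \<iota> \<I> = ?p \<odot>\<^sub>a \<iota> \<I>"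
    by (rule iso_cancel_left) simp_all
  then show ?thesis
    by (rule tensor_unit_faithful[symmetric]) simp_all
qed

text \<open>
  In right-nested products the natural elementary move is the exchange of two consecutive factors in
  front of a rest \<open>Y\<close>. The calculations with permutations below then do not mention associativity.
\<close>

definition twist :: "'o \<Rightarrow> 'o \<Rightarrow> 'o \<Rightarrow> 'm" where
  "twist A B Y = assoc \<C> B A Y \<cdot> (braid \<C> A B \<odot>\<^sub>a \<iota> Y) \<cdot> arr_inv \<C> (assoc \<C> A B Y)"

lemma twist_arr [simp]:
  assumes "A \<in> Obj \<C>" "B \<in> Obj \<C>" "Y \<in> Obj \<C>"
  shows "twist A B Y \<in> Arr \<C>" "Src \<C> (twist A B Y) = A \<odot> (B \<odot> Y)"
    "Tgt \<C> (twist A B Y) = B \<odot> (A \<odot> Y)" "is_iso \<C> (twist A B Y)"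
  using assms by (simp_all add: twist_def)

lemma twist_assoc:
  assumes "A \<in> Obj \<C>" "B \<in> Obj \<C>" "Y \<in> Obj \<C>"
  shows "twist A B Y \<cdot> assoc \<C> A B Y = assoc \<C> B A Y \<cdot> (braid \<C> A B \<odot>\<^sub>a \<iota> Y)"
  using assms by (simp add: twist_def)

lemma twist_natural:
  assumes [simp]: "f \<in> Arr \<C>" "g \<in> Arr \<C>" "h \<in> Arr \<C>"
    and t: "A = Tgt \<C> f" "B = Tgt \<C> g" "Y = Tgt \<C> h"
  shows "twist A B Y \<cdot> (f \<odot>\<^sub>a (g \<odot>\<^sub>a h)) = (g \<odot>\<^sub>a (f \<odot>\<^sub>a h)) \<cdot> twist (Src \<C> f) (Src \<C> g) (Src \<C> h)"
proof -
  let ?a = "assoc \<C> (Src \<C> f) (Src \<C> g) (Src \<C> h)"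
  have "(twist A B Y \<cdot> (f \<odot>\<^sub>a (g \<odot>\<^sub>a h))) \<cdot> ?a = twist A B Y \<cdot> assoc \<C> A B Y \<cdot> ((f \<odot>\<^sub>a g) \<odot>\<^sub>a h)"
    by (simp add: assoc_natural t)
  also have "\<dots> = assoc \<C> B A Y \<cdot> (braid \<C> A B \<odot>\<^sub>a \<iota> Y) \<cdot> ((f \<odot>\<^sub>a g) \<odot>\<^sub>a h)"
    using reassoc[OF twist_assoc[of A B Y]] by (simp add: t)
  also have "\<dots> = assoc \<C> B A Y \<cdot> (((g \<odot>\<^sub>a f) \<cdot> braid \<C> (Src \<C> f) (Src \<C> g)) \<odot>\<^sub>a h)"
    by (simp add: braid_natural t)
  also have "\<dots> = assoc \<C> B A Y \<cdot> ((g \<odot>\<^sub>a f) \<odot>\<^sub>a h) \<cdot> (braid \<C> (Src \<C> f) (Src \<C> g) \<odot>\<^sub>a \<iota> (Src \<C> h))"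
    by simp
  also have "\<dots> = (g \<odot>\<^sub>a (f \<odot>\<^sub>a h)) \<cdot> assoc \<C> (Src \<C> g) (Src \<C> f) (Src \<C> h)
                  \<cdot> (braid \<C> (Src \<C> f) (Src \<C> g) \<odot>\<^sub>a \<iota> (Src \<C> h))"
    using reassoc[OF assoc_natural[of g f h B A Y],
        of "braid \<C> (Src \<C> f) (Src \<C> g) \<odot>\<^sub>a \<iota> (Src \<C> h)"]
    by (simp add: t del: interchange_assoc interchange)
  also have "\<dots> = ((g \<odot>\<^sub>a (f \<odot>\<^sub>a h)) \<cdot> twist (Src \<C> f) (Src \<C> g) (Src \<C> h)) \<cdot> ?a"
    by (simp add: twist_assoc)
  finally show ?thesis
    by (rule iso_cancel_right) (simp_all add: t)
qed

text \<open>
  This is the hexagon, transported by two pentagons.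
\<close>

lemma twist_sum:
  assumes [simp]: "A \<in> Obj \<C>" "B \<in> Obj \<C>" "C \<in> Obj \<C>" "Y \<in> Obj \<C>"
  shows "assoc \<C> B C (A \<odot> Y) \<cdot> twist A (B \<odot> C) Y
       = ((\<iota> B \<odot>\<^sub>a twist A C Y) \<cdot> twist A B (C \<odot> Y)) \<cdot> (\<iota> A \<odot>\<^sub>a assoc \<C> B C Y)"
proof -
  let ?k = "assoc \<C> A (B \<odot> C) Y \<cdot> (assoc \<C> A B C \<odot>\<^sub>a \<iota> Y)"
  let ?x = "(braid \<C> A B \<odot>\<^sub>a \<iota> C) \<odot>\<^sub>a \<iota> Y"
  have "(((\<iota> B \<odot>\<^sub>a twist A C Y) \<cdot> twist A B (C \<odot> Y)) \<cdot> (\<iota> A \<odot>\<^sub>a assoc \<C> B C Y)) \<cdot> ?k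
      = (\<iota> B \<odot>\<^sub>a twist A C Y) \<cdot> twist A B (C \<odot> Y) \<cdot> ((\<iota> A \<odot>\<^sub>a assoc \<C> B C Y) \<cdot> ?k)"
    by (simp del: interchange_assoc)
  also have "\<dots> = (\<iota> B \<odot>\<^sub>a twist A C Y) \<cdot> (twist A B (C \<odot> Y) \<cdot> assoc \<C> A B (C \<odot> Y)) \<cdot> assoc \<C> (A \<odot> B) C Y"
    by (simp add: pentagon del: interchange_assoc)
  also have "\<dots> = (\<iota> B \<odot>\<^sub>a twist A C Y) \<cdot> assoc \<C> B A (C \<odot> Y) \<cdot> ((braid \<C> A B \<odot>\<^sub>a (\<iota> C \<odot>\<^sub>a \<iota> Y)) \<cdot> assoc \<C> (A \<odot> B) C Y)"
    by (simp add: twist_assoc)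
  also have "\<dots> = (\<iota> B \<odot>\<^sub>a twist A C Y) \<cdot> (assoc \<C> B A (C \<odot> Y) \<cdot> assoc \<C> (B \<odot> A) C Y) \<cdot> ?x"
    using assoc_natural[of "braid \<C> A B" "\<iota> C" "\<iota> Y" "B \<odot> A" C Y] by simp
  also have "\<dots> = (\<iota> B \<odot>\<^sub>a twist A C Y) \<cdot> ((\<iota> B \<odot>\<^sub>a assoc \<C> A C Y) \<cdot> assoc \<C> B (A \<odot> C) Y \<cdot> (assoc \<C> B A C \<odot>\<^sub>a \<iota> Y)) \<cdot> ?x"
    by (simp add: pentagon del: interchange_assoc interchange)
  also have "\<dots> = (\<iota> B \<odot>\<^sub>a (twist A C Y \<cdot> assoc \<C> A C Y)) \<cdot> assoc \<C> B (A \<odot> C) Y \<cdot> (assoc \<C> B A C \<odot>\<^sub>a \<iota> Y) \<cdot> ?x"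
    by simp
  also have "\<dots> = (\<iota> B \<odot>\<^sub>a assoc \<C> C A Y) \<cdot> ((\<iota> B \<odot>\<^sub>a (braid \<C> A C \<odot>\<^sub>a \<iota> Y)) \<cdot> assoc \<C> B (A \<odot> C) Y) \<cdot> (assoc \<C> B A C \<odot>\<^sub>a \<iota> Y) \<cdot> ?x"
    by (simp add: twist_assoc)
  also have "\<dots> = (\<iota> B \<odot>\<^sub>a assoc \<C> C A Y) \<cdot> (assoc \<C> B (C \<odot> A) Y \<cdot> ((\<iota> B \<odot>\<^sub>a braid \<C> A C) \<odot>\<^sub>a \<iota> Y)) \<cdot> (assoc \<C> B A C \<odot>\<^sub>a \<iota> Y) \<cdot> ?x"
    using assoc_natural[of "\<iota> B" "braid \<C> A C" "\<iota> Y" B "C \<odot> A" Y] by (simp del: interchange_assoc interchange)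
  also have "\<dots> = (\<iota> B \<odot>\<^sub>a assoc \<C> C A Y) \<cdot> assoc \<C> B (C \<odot> A) Y \<cdot> (((\<iota> B \<odot>\<^sub>a braid \<C> A C) \<cdot> assoc \<C> B A C \<cdot> (braid \<C> A B \<odot>\<^sub>a \<iota> C)) \<odot>\<^sub>a \<iota> Y)"
    by simp
  also have "\<dots> = (\<iota> B \<odot>\<^sub>a assoc \<C> C A Y) \<cdot> assoc \<C> B (C \<odot> A) Y \<cdot> ((assoc \<C> B C A \<cdot> braid \<C> A (B \<odot> C) \<cdot> assoc \<C> A B C) \<odot>\<^sub>a \<iota> Y)"
    by (simp only: hexagon1 assms)
  also have "\<dots> = ((\<iota> B \<odot>\<^sub>a assoc \<C> C A Y) \<cdot> assoc \<C> B (C \<odot> A) Y \<cdot> (assoc \<C> B C A \<odot>\<^sub>a \<iota> Y)) \<cdot> (braid \<C> A (B \<odot> C) \<odot>\<^sub>a \<iota> Y) \<cdot> (assoc \<C> A B C \<odot>\<^sub>a \<iota> Y)"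
    by simp
  also have "\<dots> = assoc \<C> B C (A \<odot> Y) \<cdot> (assoc \<C> (B \<odot> C) A Y \<cdot> (braid \<C> A (B \<odot> C) \<odot>\<^sub>a \<iota> Y)) \<cdot> (assoc \<C> A B C \<odot>\<^sub>a \<iota> Y)"
    by (simp only: pentagon assms) (simp del: interchange_assoc interchange)
  also have "\<dots> = (assoc \<C> B C (A \<odot> Y) \<cdot> twist A (B \<odot> C) Y) \<cdot> ?k"
    by (simp add: twist_assoc[symmetric] del: interchange_assoc interchange)
  finally show ?thesis
    by (rule iso_cancel_right[symmetric, where h = ?k]) simp_all
qed

text \<open>
  Moving \<open>A\<close> past \<open>B \<odot> C\<close> is natural with respect to the braiding of \<open>B\<close> and \<open>C\<close>.
\<close>

lemma yang_baxter:
  assumes [simp]: "A \<in> Obj \<C>" "B \<in> Obj \<C>" "C \<in> Obj \<C>" "Y \<in> Obj \<C>"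
  shows "(\<iota> C \<odot>\<^sub>a twist A B Y) \<cdot> twist A C (B \<odot> Y) \<cdot> (\<iota> A \<odot>\<^sub>a twist B C Y)
       = twist B C (A \<odot> Y) \<cdot> (\<iota> B \<odot>\<^sub>a twist A C Y) \<cdot> twist A B (C \<odot> Y)"
proof -
  let ?k = "\<iota> A \<odot>\<^sub>a assoc \<C> B C Y"
  have "((\<iota> C \<odot>\<^sub>a twist A B Y) \<cdot> twist A C (B \<odot> Y) \<cdot> (\<iota> A \<odot>\<^sub>a twist B C Y)) \<cdot> ?k
      = (((\<iota> C \<odot>\<^sub>a twist A B Y) \<cdot> twist A C (B \<odot> Y)) \<cdot> (\<iota> A \<odot>\<^sub>a assoc \<C> C B Y)) \<cdot> (\<iota> A \<odot>\<^sub>a (braid \<C> B C \<odot>\<^sub>a \<iota> Y))"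
    by (simp add: twist_assoc)
  also have "\<dots> = assoc \<C> C B (A \<odot> Y) \<cdot> (twist A (C \<odot> B) Y \<cdot> (\<iota> A \<odot>\<^sub>a (braid \<C> B C \<odot>\<^sub>a \<iota> Y)))"
    by (simp only: twist_sum[symmetric] assms) (simp del: interchange_assoc interchange)
  also have "\<dots> = (assoc \<C> C B (A \<odot> Y) \<cdot> (braid \<C> B C \<odot>\<^sub>a \<iota> (A \<odot> Y))) \<cdot> twist A (B \<odot> C) Y"
    using twist_natural[of "\<iota> A" "braid \<C> B C" "\<iota> Y" A "C \<odot> B" Y] by simp
  also have "\<dots> = twist B C (A \<odot> Y) \<cdot> (assoc \<C> B C (A \<odot> Y) \<cdot> twist A (B \<odot> C) Y)"
    by (simp add: twist_assoc[symmetric])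
  also have "\<dots> = (twist B C (A \<odot> Y) \<cdot> (\<iota> B \<odot>\<^sub>a twist A C Y) \<cdot> twist A B (C \<odot> Y)) \<cdot> ?k"
    by (simp add: twist_sum)
  finally show ?thesis
    by (rule iso_cancel_right) simp_all
qed

text \<open>
  This makes the rebracketing \<open>merge\<close> below natural with respect to transpositions.
\<close>

lemma twist_tensor:
  assumes [simp]: "A \<in> Obj \<C>" "B \<in> Obj \<C>" "C \<in> Obj \<C>" "Y \<in> Obj \<C>"
  shows "((\<iota> B \<odot>\<^sub>a assoc \<C> A C Y) \<cdot> assoc \<C> B (A \<odot> C) Y) \<cdot> (twist A B C \<odot>\<^sub>a \<iota> Y)
       = twist A B (C \<odot> Y) \<cdot> (\<iota> A \<odot>\<^sub>a assoc \<C> B C Y) \<cdot> assoc \<C> A (B \<odot> C) Y"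
proof -
  let ?k = "assoc \<C> A B C \<odot>\<^sub>a \<iota> Y"
  have "(((\<iota> B \<odot>\<^sub>a assoc \<C> A C Y) \<cdot> assoc \<C> B (A \<odot> C) Y) \<cdot> (twist A B C \<odot>\<^sub>a \<iota> Y)) \<cdot> ?k
      = ((\<iota> B \<odot>\<^sub>a assoc \<C> A C Y) \<cdot> assoc \<C> B (A \<odot> C) Y \<cdot> (assoc \<C> B A C \<odot>\<^sub>a \<iota> Y)) \<cdot> ((braid \<C> A B \<odot>\<^sub>a \<iota> C) \<odot>\<^sub>a \<iota> Y)"
    by (simp add: twist_assoc)
  also have "\<dots> = assoc \<C> B A (C \<odot> Y) \<cdot> (assoc \<C> (B \<odot> A) C Y \<cdot> ((braid \<C> A B \<odot>\<^sub>a \<iota> C) \<odot>\<^sub>a \<iota> Y))"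
    by (simp only: pentagon assms) simp
  also have "\<dots> = (assoc \<C> B A (C \<odot> Y) \<cdot> (braid \<C> A B \<odot>\<^sub>a \<iota> (C \<odot> Y))) \<cdot> assoc \<C> (A \<odot> B) C Y"
    using assoc_natural[of "braid \<C> A B" "\<iota> C" "\<iota> Y" "B \<odot> A" C Y] by simp
  also have "\<dots> = twist A B (C \<odot> Y) \<cdot> (assoc \<C> A B (C \<odot> Y) \<cdot> assoc \<C> (A \<odot> B) C Y)"
    by (simp add: twist_assoc[symmetric])
  also have "\<dots> = (twist A B (C \<odot> Y) \<cdot> (\<iota> A \<odot>\<^sub>a assoc \<C> B C Y) \<cdot> assoc \<C> A (B \<odot> C) Y) \<cdot> ?k"
    by (simp add: pentagon[symmetric] del: interchange_assoc interchange)
  finally show ?thesis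
    by (rule iso_cancel_right) simp_all
qed

end

context symmetric_monoidal_category
begin

lemma braid_braid [simp]:
  assumes [simp]: "A \<in> Obj \<C>" "B \<in> Obj \<C>"
  shows "braid \<C> B A \<cdot> braid \<C> A B = \<iota> (A \<odot> B)"
    "k \<in> Arr \<C> \<Longrightarrow> Tgt \<C> k = A \<odot> B \<Longrightarrow> braid \<C> B A \<cdot> braid \<C> A B \<cdot> k = k"
  using reassoc[OF symmetry[of A B], of k] by (auto simp: symmetry)

lemma twist_twist [simp]:
  assumes [simp]: "A \<in> Obj \<C>" "B \<in> Obj \<C>" "Y \<in> Obj \<C>"
  shows "twist B A Y \<cdot> twist A B Y = \<iota> (A \<odot> (B \<odot> Y))"
    "k \<in> Arr \<C> \<Longrightarrow> Tgt \<C> k = A \<odot> (B \<odot> Y) \<Longrightarrow> twist B A Y \<cdot> twist A B Y \<cdot> k = k"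
proof -
  show 1: "twist B A Y \<cdot> twist A B Y = \<iota> (A \<odot> (B \<odot> Y))"
    by (simp add: twist_def)
  show "twist B A Y \<cdot> twist A B Y \<cdot> k = k" if "k \<in> Arr \<C>" "Tgt \<C> k = A \<odot> (B \<odot> Y)"
    using reassoc[OF 1, of k] that by simp
qed

end

section \<open>Additive and multiplicative structure\<close>

lemma additive_simps [simp]:
  "Obj (additive \<C>) = Obj \<C>" "Arr (additive \<C>) = Arr \<C>" "Src (additive \<C>) = Src \<C>"
  "Tgt (additive \<C>) = Tgt \<C>" "Ide (additive \<C>) = Ide \<C>" "Comp (additive \<C>) = Comp \<C>"
  "tensorO (additive \<C>) = sumO \<C>" "tensorA (additive \<C>) = sumA \<C>" "unitO (additive \<C>) = zeroO \<C>"
  "assoc (additive \<C>) = sum_assoc \<C>" "lunit (additive \<C>) = sum_lunit \<C>"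
  "runit (additive \<C>) = sum_runit \<C>" "braid (additive \<C>) = sum_braid \<C>"
  by (simp_all add: additive_def)

lemma multiplicative_simps [simp]:
  "Obj (multiplicative \<C>) = Obj \<C>" "Arr (multiplicative \<C>) = Arr \<C>" "Src (multiplicative \<C>) = Src \<C>"
  "Tgt (multiplicative \<C>) = Tgt \<C>" "Ide (multiplicative \<C>) = Ide \<C>" "Comp (multiplicative \<C>) = Comp \<C>"
  "tensorO (multiplicative \<C>) = prodO \<C>" "tensorA (multiplicative \<C>) = prodA \<C>"
  "unitO (multiplicative \<C>) = oneO \<C>" "assoc (multiplicative \<C>) = prod_assoc \<C>"
  "lunit (multiplicative \<C>) = prod_lunit \<C>" "runit (multiplicative \<C>) = prod_runit \<C>"
  by (simp_all add: multiplicative_def)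

lemma braided_multiplicative_simps [simp]:
  "Obj (braided_multiplicative \<C>) = Obj \<C>" "Arr (braided_multiplicative \<C>) = Arr \<C>"
  "Src (braided_multiplicative \<C>) = Src \<C>" "Tgt (braided_multiplicative \<C>) = Tgt \<C>"
  "Ide (braided_multiplicative \<C>) = Ide \<C>" "Comp (braided_multiplicative \<C>) = Comp \<C>"
  "tensorO (braided_multiplicative \<C>) = prodO \<C>" "tensorA (braided_multiplicative \<C>) = prodA \<C>"
  "unitO (braided_multiplicative \<C>) = oneO \<C>" "assoc (braided_multiplicative \<C>) = prod_assoc \<C>"
  "lunit (braided_multiplicative \<C>) = prod_lunit \<C>" "runit (braided_multiplicative \<C>) = prod_runit \<C>"
  "braid (braided_multiplicative \<C>) = prod_braid \<C>"
  by (simp_all add: braided_multiplicative_def multiplicative_def monoidal_data.defs)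

lemma underlying_simps [simp]:
  "Hom (additive \<C>) = Hom \<C>" "Hom (multiplicative \<C>) = Hom \<C>" "Hom (braided_multiplicative \<D>) = Hom \<D>"
  "is_iso (additive \<C>) = is_iso \<C>" "is_iso (multiplicative \<C>) = is_iso \<C>"
  "is_iso (braided_multiplicative \<D>) = is_iso \<D>"
  "Iso (additive \<C>) = Iso \<C>" "Iso (multiplicative \<C>) = Iso \<C>" "Iso (braided_multiplicative \<D>) = Iso \<D>"
  "arr_inv (additive \<C>) = arr_inv \<C>" "arr_inv (multiplicative \<C>) = arr_inv \<C>"
  "arr_inv (braided_multiplicative \<D>) = arr_inv \<D>"
  by (auto simp: Hom_def is_iso_def Iso_def arr_inv_def inverse_arrows_def fun_eq_iff)

section \<open>The finite ordinal category\<close>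

abbreviation FO :: "(nat, nat \<times> (nat \<Rightarrow> nat)) braided_bimonoidal_data" where
  "FO \<equiv> finite_ordinal_category"

abbreviation FOcomp (infixr "\<cdot>\<^sub>F" 55) where "g \<cdot>\<^sub>F f \<equiv> Comp FO g f"
abbreviation FOsum (infixr "\<oplus>\<^sub>F" 65) where "f \<oplus>\<^sub>F g \<equiv> sumA FO f g"
abbreviation FOprod (infixr "\<otimes>\<^sub>F" 70) where "f \<otimes>\<^sub>F g \<equiv> prodA FO f g"
abbreviation FOsum_braid ("\<zeta>\<^sub>F") where "\<zeta>\<^sub>F \<equiv> sum_braid FO"
abbreviation FOprod_braid ("\<xi>\<^sub>F") where "\<xi>\<^sub>F \<equiv> prod_braid FO"
abbreviation FOrdist ("\<delta>\<^sub>F") where "\<delta>\<^sub>F \<equiv> rdist FO"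

lemma FO_simps [simp]:
  "Obj FO = UNIV" "Src FO = fst" "Tgt FO = fst" "Ide FO n = (n, id)"
  "sumO FO = (+)" "zeroO FO = 0" "sum_assoc FO m n p = (m + n + p, id)" "sum_lunit FO n = (n, id)"
  "sum_runit FO n = (n, id)" "prodO FO = (*)" "oneO FO = 1"
  "prod_assoc FO m n p = (m * n * p, id)" "prod_lunit FO n = (n, id)" "prod_runit FO n = (n, id)"
  "lnull FO n = (0, id)" "rnull FO n = (0, id)" "ldist FO m n p = (m * (n + p), id)"
  by (simp_all add: finite_ordinal_category_def)

lemma FO_Arr: "f \<in> Arr FO \<longleftrightarrow> snd f permutes {1..fst f}"
  by (auto simp: finite_ordinal_category_def split: prod.splits)

lemma FO_Hom: "f \<in> Hom FO m n \<longleftrightarrow> f \<in> Arr FO \<and> fst f = m \<and> m = n"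
  by (auto simp: Hom_def)

lemma FO_ide_arr [simp]: "(n, id) \<in> Arr FO"
  by (simp add: FO_Arr permutes_id)

lemma FO_comp [simp]: "fst (g \<cdot>\<^sub>F f) = fst f" "snd (g \<cdot>\<^sub>F f) k = snd g (snd f k)"
  by (cases f; cases g; simp add: finite_ordinal_category_def)+

lemma FO_comp_arr [simp]: "f \<in> Arr FO \<Longrightarrow> g \<in> Arr FO \<Longrightarrow> fst g = fst f \<Longrightarrow> g \<cdot>\<^sub>F f \<in> Arr FO"
  by (cases f; cases g) (auto simp: finite_ordinal_category_def permutes_compose)

lemma FO_comp_ide [simp]: "(n, id) \<cdot>\<^sub>F f = f" "fst f = n \<Longrightarrow> f \<cdot>\<^sub>F (n, id) = f"
  by (cases f; auto simp: finite_ordinal_category_def)+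

lemma FO_range:
  assumes "f \<in> Arr FO" "0 < k" "k \<le> fst f"
  shows "0 < snd f k" "snd f k \<le> fst f"
  using permutes_in_image[of "snd f" "{1..fst f}" k] assms by (auto simp: FO_Arr)

lemma FO_range' [simp]:
  assumes "f \<in> Arr FO" "0 < k" "k \<le> fst f" "fst f = n"
  shows "0 < snd f k" "snd f k \<le> n"
  using FO_range[of f k] assms by auto

lemma FO_eqI:
  assumes "f \<in> Arr FO" "g \<in> Arr FO" "fst f = n" "fst g = n"
    and "\<And>k. 0 < k \<Longrightarrow> k \<le> n \<Longrightarrow> snd f k = snd g k"
  shows "f = g"
proof -
  have "snd f k = snd g k" for k
  proof (cases "k \<in> {1..n}")
    case False
    then show ?thesis
      using assms(1-4) by (auto simp: FO_Arr permutes_not_in)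
  qed (use assms(5) in auto)
  then show ?thesis
    using assms(3,4) by (auto simp: prod_eq_iff)
qed

lemma FO_eqI2:
  assumes "f \<in> Arr FO" "g \<in> Arr FO" "fst f = m + n" "fst g = m + n"
    and "\<And>k. 0 < k \<Longrightarrow> k \<le> m \<Longrightarrow> snd f k = snd g k"
    and "\<And>k. 0 < k \<Longrightarrow> k \<le> n \<Longrightarrow> snd f (m + k) = snd g (m + k)"
  shows "f = g"
proof (rule FO_eqI)
  fix k
  assume "0 < k" "k \<le> m + n"
  then show "snd f k = snd g k"
    using assms(5)[of k] assms(6)[of "k - m"] by (cases "k \<le> m") auto
qed (use assms in auto)

lemma FO_eqI3:
  assumes "f \<in> Arr FO" "g \<in> Arr FO" "fst f = m + (n + p)" "fst g = m + (n + p)"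
    and "\<And>k. 0 < k \<Longrightarrow> k \<le> m \<Longrightarrow> snd f k = snd g k"
    and "\<And>k. 0 < k \<Longrightarrow> k \<le> n \<Longrightarrow> snd f (m + k) = snd g (m + k)"
    and "\<And>k. 0 < k \<Longrightarrow> k \<le> p \<Longrightarrow> snd f (m + (n + k)) = snd g (m + (n + k))"
  shows "f = g"
proof (rule FO_eqI2)
  fix k
  assume "0 < k" "k \<le> n + p"
  then show "snd f (m + k) = snd g (m + k)"
    using assms(6)[of k] assms(7)[of "k - n"] by (cases "k \<le> n") auto
qed (use assms in auto)

lemma perm_arrow_simps [simp]:
  "fst (perm_arrow n \<sigma>) = n" "0 < k \<Longrightarrow> k \<le> n \<Longrightarrow> snd (perm_arrow n \<sigma>) k = \<sigma> k"
  by (auto simp: perm_arrow_def)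

lemma perm_arrow_arr:
  assumes "\<And>a b. \<lbrakk>0 < a; a \<le> n; 0 < b; b \<le> n; \<sigma> a = \<sigma> b\<rbrakk> \<Longrightarrow> a = b"
    and "\<And>k. 0 < k \<Longrightarrow> k \<le> n \<Longrightarrow> 0 < \<sigma> k \<and> \<sigma> k \<le> n"
  shows "perm_arrow n \<sigma> \<in> Arr FO"
proof -
  let ?s = "\<lambda>k. if k \<in> {1..n} then \<sigma> k else k"
  have i: "inj_on \<sigma> {1..n}"
    using assms(1) by (auto simp: inj_on_def)
  have "\<sigma> ` {1..n} = {1..n}"
    using assms(2) i by (intro endo_inj_surj) (auto simp: Suc_le_eq)
  then have "bij_betw \<sigma> {1..n} {1..n}"
    using i by (simp add: bij_betw_def)
  then have "bij_betw ?s {1..n} {1..n}"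
    by (rule bij_betw_cong[THEN iffD1, rotated]) simp
  then have "?s permutes {1..n}"
    by (rule bij_imp_permutes) auto
  then show ?thesis
    by (simp add: FO_Arr perm_arrow_def)
qed

lemma FO_arr_inj: "f \<in> Arr FO \<Longrightarrow> snd f a = snd f b \<longleftrightarrow> a = b"
  by (auto simp: FO_Arr dest: permutes_inj injD)

lemma FO_inverse:
  assumes "f \<in> Arr FO"
  shows "inverse_arrows FO f (fst f, inv (snd f))"
proof -
  have p: "snd f permutes {1..fst f}"
    using assms by (simp add: FO_Arr)
  then have "inv (snd f) permutes {1..fst f}"
    by (rule permutes_inv)
  then show ?thesis
    using p assms by (auto simp: inverse_arrows_def FO_Hom FO_Arr prod_eq_iff fun_eq_iff permutes_inverses)
qed

lemma FO_category: "category FO"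
  by standard (auto simp: FO_Hom prod_eq_iff fun_eq_iff)

interpretation FO: category FO
  by (rule FO_category)

lemma FO_iso: "f \<in> Arr FO \<Longrightarrow> is_iso FO f"
  unfolding is_iso_def by (blast intro: FO_inverse)

lemma FO_Iso: "f \<in> Iso FO m n \<longleftrightarrow> f \<in> Arr FO \<and> fst f = m \<and> m = n"
  using FO_iso[of f] by (auto simp: Iso_def FO_Hom)

lemma FO_inv_ide [simp]: "arr_inv FO (n, id) = (n, id)"
  using FO.ide_iso(2)[of n] by simp

subsection \<open>Sums of permutations\<close>

lemma FO_sum_fst [simp]: "fst (f \<oplus>\<^sub>F g) = fst f + fst g"
  by (cases f; cases g) (simp add: finite_ordinal_category_def)

lemma FO_sum_snd [simp]:
  "0 < k \<Longrightarrow> k \<le> fst f \<Longrightarrow> snd (f \<oplus>\<^sub>F g) k = snd f k"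
  "0 < k \<Longrightarrow> k \<le> fst g \<Longrightarrow> fst f = m \<Longrightarrow> snd (f \<oplus>\<^sub>F g) (m + k) = m + snd g k"
  "0 < k \<Longrightarrow> k \<le> fst g \<Longrightarrow> fst f = m + n \<Longrightarrow> snd (f \<oplus>\<^sub>F g) (m + (n + k)) = m + (n + snd g k)"
  by (cases f; cases g; simp add: finite_ordinal_category_def add.assoc)+

lemma FO_sum_arr [simp]:
  assumes "f \<in> Arr FO" "g \<in> Arr FO"
  shows "f \<oplus>\<^sub>F g \<in> Arr FO"
proof -
  obtain m \<sigma> n \<tau> where fg: "f = (m, \<sigma>)" "g = (n, \<tau>)"
    by (cases f; cases g)
  let ?s = "\<lambda>k. if k \<le> m then \<sigma> k else m + \<tau> (k - m)"
  have r: "0 < \<sigma> k" "\<sigma> k \<le> m" if "0 < k" "k \<le> m" for k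
    using FO_range[OF assms(1), of k] that by (auto simp: fg)
  have r': "0 < \<tau> k" "\<tau> k \<le> n" if "0 < k" "k \<le> n" for k
    using FO_range[OF assms(2), of k] that by (auto simp: fg)
  have i: "\<sigma> a = \<sigma> b \<longleftrightarrow> a = b" "\<tau> a = \<tau> b \<longleftrightarrow> a = b" for a b
    using FO_arr_inj[OF assms(1)] FO_arr_inj[OF assms(2)] by (auto simp: fg)
  have "perm_arrow (m + n) ?s \<in> Arr FO"
  proof (rule perm_arrow_arr)
    show "a = b" if h: "0 < a" "a \<le> m + n" "0 < b" "b \<le> m + n" "?s a = ?s b" for a b
      using h r[of a] r[of b] r'[of "a - m"] r'[of "b - m"] i(1)[of a b] i(2)[of "a - m" "b - m"]
      by (cases "a \<le> m"; cases "b \<le> m"; simp add: le_diff_conv)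
    show "0 < ?s k \<and> ?s k \<le> m + n" if "0 < k" "k \<le> m + n" for k
      using r[of k] r'[of "k - m"] that by auto
  qed
  then show ?thesis
    by (simp add: fg finite_ordinal_category_def)
qed

lemma FO_sum_ide [simp]: "(m, id) \<oplus>\<^sub>F (n, id) = (m + n, id)"
  by (rule FO_eqI2[where m = m and n = n]) auto

lemma FO_sum_braid [simp]:
  "fst (\<zeta>\<^sub>F m n) = m + n"
  "0 < k \<Longrightarrow> k \<le> m \<Longrightarrow> snd (\<zeta>\<^sub>F m n) k = n + k"
  "0 < k \<Longrightarrow> k \<le> n \<Longrightarrow> snd (\<zeta>\<^sub>F m n) (m + k) = k"
  "0 < k \<Longrightarrow> k \<le> n \<Longrightarrow> snd (\<zeta>\<^sub>F (m + p) n) (m + (p + k)) = k"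
  by (simp_all add: finite_ordinal_category_def add.assoc[symmetric])

lemma FO_sum_braid_arr [simp]: "\<zeta>\<^sub>F m n \<in> Arr FO"
proof -
  have "perm_arrow (m + n) (\<lambda>k. if k \<le> m then n + k else k - m) \<in> Arr FO"
    by (rule perm_arrow_arr) (auto split: if_splits)
  then show ?thesis
    by (simp add: finite_ordinal_category_def)
qed

lemma FO_sum_comp:
  assumes "f \<in> Arr FO" "f' \<in> Arr FO" "g \<in> Arr FO" "g' \<in> Arr FO" "fst f' = fst f" "fst g' = fst g"
  shows "(f' \<cdot>\<^sub>F f) \<oplus>\<^sub>F (g' \<cdot>\<^sub>F g) = (f' \<oplus>\<^sub>F g') \<cdot>\<^sub>F (f \<oplus>\<^sub>F g)"
  using assms by (intro FO_eqI2[where m = "fst f" and n = "fst g"]) auto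

lemma FO_sum_assoc:
  assumes "f \<in> Arr FO" "g \<in> Arr FO" "h \<in> Arr FO"
  shows "(f \<oplus>\<^sub>F g) \<oplus>\<^sub>F h = f \<oplus>\<^sub>F (g \<oplus>\<^sub>F h)"
  using assms by (intro FO_eqI3[where m = "fst f" and n = "fst g" and p = "fst h"]) auto

lemma FO_sum_zero:
  assumes "f \<in> Arr FO"
  shows "(0, id) \<oplus>\<^sub>F f = f" "f \<oplus>\<^sub>F (0, id) = f"
  using assms FO_sum_snd(2)[of _ f "(0, id)"] by (auto intro!: FO_eqI)

lemma FO_sum_braid_sum:
  "\<zeta>\<^sub>F m (n + p) = ((n, id) \<oplus>\<^sub>F \<zeta>\<^sub>F m p) \<cdot>\<^sub>F (\<zeta>\<^sub>F m n \<oplus>\<^sub>F (p, id))"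
  "\<zeta>\<^sub>F (m + n) p = (\<zeta>\<^sub>F m p \<oplus>\<^sub>F (n, id)) \<cdot>\<^sub>F ((m, id) \<oplus>\<^sub>F \<zeta>\<^sub>F n p)"
proof -
  have *: "m + (n + k) = n + (m + k)" for k
    by simp
  have "snd (\<zeta>\<^sub>F m (n + p)) (n + (m + k)) = n + k" if "0 < k" "k \<le> p" for k
    using FO_sum_braid(3)[of "n + k" "n + p" m] that by (simp add: *)
  note [simp] = this
  show "\<zeta>\<^sub>F m (n + p) = ((n, id) \<oplus>\<^sub>F \<zeta>\<^sub>F m p) \<cdot>\<^sub>F (\<zeta>\<^sub>F m n \<oplus>\<^sub>F (p, id))"
    by (rule FO_eqI3[where m = m and n = n and p = p]) (simp_all add: * add.assoc)
  show "\<zeta>\<^sub>F (m + n) p = (\<zeta>\<^sub>F m p \<oplus>\<^sub>F (n, id)) \<cdot>\<^sub>F ((m, id) \<oplus>\<^sub>F \<zeta>\<^sub>F n p)"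
    by (rule FO_eqI3[where m = m and n = n and p = p]; simp; simp add: ac_simps)
qed

lemma FO_sum_braid_nat:
  assumes "f \<in> Arr FO" "g \<in> Arr FO"
  shows "\<zeta>\<^sub>F (fst f) (fst g) \<cdot>\<^sub>F (f \<oplus>\<^sub>F g) = (g \<oplus>\<^sub>F f) \<cdot>\<^sub>F \<zeta>\<^sub>F (fst f) (fst g)"
  using assms by (intro FO_eqI2[where m = "fst f" and n = "fst g"]) auto

lemma FO_sum_symmetry: "\<zeta>\<^sub>F n m \<cdot>\<^sub>F \<zeta>\<^sub>F m n = (m + n, id)"
  by (rule FO_eqI2[where m = m and n = n]) auto

lemma FO_additive: "symmetric_monoidal_category (additive FO)"
  by unfold_locales (auto simp: FO_Hom FO_Iso FO_sum_comp FO_sum_assoc FO_sum_zero FO_sum_braid_nat FO_sum_braid_sum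
    FO_sum_symmetry add.assoc)

subsection \<open>Products of permutations\<close>

lemma sum_index_cases:
  fixes k m n :: nat
  assumes "0 < k" "k \<le> m + n"
  obtains "k \<le> m" | l where "k = m + l" "0 < l" "l \<le> n"
  using that(2)[of "k - m"] assms by (cases "k \<le> m") (auto intro: that(1))

lemma pair_index_range [simp]:
  assumes "0 < i" "i \<le> m" "0 < j" "j \<le> n"
  shows "pair_index m i j \<le> m * n"
proof -
  have "i + (j - 1) * m \<le> m + (n - 1) * m"
    using assms by (intro add_mono mult_right_mono) auto
  also have "\<dots> = m * n"
    using assms by (cases n) auto
  finally show ?thesis
    by (simp add: pair_index_def)
qed

lemma pair_index_pos [simp]: "0 < i \<Longrightarrow> 0 < pair_index m i j"
  by (simp add: pair_index_def)

lemma pair_index_inverse [simp]: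
  assumes "0 < i" "i \<le> m" "0 < j"
  shows "fst_index m (pair_index m i j) = i" "snd_index m (pair_index m i j) = j"
proof -
  obtain a b where "i = Suc a" "j = Suc b"
    using assms by (metis gr0_implies_Suc)
  then show "fst_index m (pair_index m i j) = i" "snd_index m (pair_index m i j) = j"
    using assms by (auto simp: fst_index_def snd_index_def pair_index_def)
qed

lemma pair_index_exhaust:
  assumes "0 < k" "k \<le> m * n"
  obtains i j where "0 < i" "i \<le> m" "0 < j" "j \<le> n" "k = pair_index m i j"
proof
  have m: "0 < m"
    using assms by (cases m) auto
  show "0 < fst_index m k" "0 < snd_index m k"
    by (simp_all add: fst_index_def snd_index_def)
  show "fst_index m k \<le> m"
    using m by (simp add: fst_index_def Suc_le_eq)
  have "k - 1 < n * m"
    using assms by (simp add: mult.commute)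
  then have "(k - 1) div m < n"
    by (rule less_mult_imp_div_less)
  then show "snd_index m k \<le> n"
    by (simp add: snd_index_def)
  have "(k - 1) mod m + (k - 1) div m * m = k - 1"
    by (rule mod_div_mult_eq)
  then show "k = pair_index m (fst_index m k) (snd_index m k)"
    using assms(1) by (simp add: pair_index_def fst_index_def snd_index_def)
qed

lemma FO_eqI_prod:
  assumes "f \<in> Arr FO" "g \<in> Arr FO" "fst f = m * n" "fst g = m * n"
    and "\<And>i j. \<lbrakk>0 < i; i \<le> m; 0 < j; j \<le> n\<rbrakk>
          \<Longrightarrow> snd f (pair_index m i j) = snd g (pair_index m i j)"
  shows "f = g"
  using assms(1-4)
proof (rule FO_eqI)
  show "snd f k = snd g k" if "0 < k" "k \<le> m * n" for k
    using that by (rule pair_index_exhaust) (simp add: assms(5))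
qed

lemma pair_index_units [simp]:
  "0 < j \<Longrightarrow> pair_index 1 1 j = j" "0 < j \<Longrightarrow> pair_index (Suc 0) (Suc 0) j = j"
  "pair_index m i 1 = i" "pair_index m i (Suc 0) = i"
  by (simp_all add: pair_index_def)

lemma pair_index_assoc:
  assumes "0 < j" "0 < l"
  shows "pair_index (m * n) (pair_index m i j) l = pair_index m i (pair_index n j l)"
proof -
  have "j + (l - 1) * n - 1 = (j - 1) + (l - 1) * n"
    using assms by simp
  then show ?thesis
    by (simp add: pair_index_def algebra_simps)
qed

lemma pair_index_sum: "0 < j \<Longrightarrow> pair_index m i (n + j) = m * n + pair_index m i j"
proof -
  assume "0 < j"
  then have "n + j - 1 = n + (j - 1)"
    by simp
  then show ?thesis
    by (simp add: pair_index_def algebra_simps)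
qed

lemma FO_prod_fst [simp]: "fst (f \<otimes>\<^sub>F g) = fst f * fst g"
  by (cases f; cases g) (simp add: finite_ordinal_category_def)

lemma FO_prod_snd [simp]:
  assumes "fst f = m" "0 < i" "i \<le> m" "0 < j" "j \<le> fst g"
  shows "snd (f \<otimes>\<^sub>F g) (pair_index m i j) = pair_index m (snd f i) (snd g j)"
  using assms by (cases f; cases g) (simp add: finite_ordinal_category_def)

lemma FO_prod_arr [simp]:
  assumes "f \<in> Arr FO" "g \<in> Arr FO"
  shows "f \<otimes>\<^sub>F g \<in> Arr FO"
proof -
  obtain m \<sigma> n \<tau> where fg: "f = (m, \<sigma>)" "g = (n, \<tau>)"
    by (cases f; cases g)
  let ?s = "\<lambda>k. pair_index m (\<sigma> (fst_index m k)) (\<tau> (snd_index m k))"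
  have r: "0 < \<sigma> k" "\<sigma> k \<le> m" if "0 < k" "k \<le> m" for k
    using FO_range[OF assms(1), of k] that by (auto simp: fg)
  have r': "0 < \<tau> k" "\<tau> k \<le> n" if "0 < k" "k \<le> n" for k
    using FO_range[OF assms(2), of k] that by (auto simp: fg)
  have i: "\<sigma> a = \<sigma> b \<longleftrightarrow> a = b" "\<tau> a = \<tau> b \<longleftrightarrow> a = b" for a b
    using FO_arr_inj[OF assms(1)] FO_arr_inj[OF assms(2)] by (auto simp: fg)
  have "perm_arrow (m * n) ?s \<in> Arr FO"
  proof (rule perm_arrow_arr)
    fix k
    assume k: "0 < k" "k \<le> m * n"
    then show "0 < ?s k \<and> ?s k \<le> m * n"
      by (rule pair_index_exhaust) (simp add: r r')
    fix l
    assume l: "0 < l" "l \<le> m * n" and eq: "?s k = ?s l"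
    obtain a b where ab: "0 < a" "a \<le> m" "0 < b" "b \<le> n" "k = pair_index m a b"
      using k by (rule pair_index_exhaust)
    obtain c d where cd: "0 < c" "c \<le> m" "0 < d" "d \<le> n" "l = pair_index m c d"
      using l by (rule pair_index_exhaust)
    have *: "pair_index m (\<sigma> a) (\<tau> b) = pair_index m (\<sigma> c) (\<tau> d)"
      using eq ab cd by simp
    have "\<sigma> a = \<sigma> c"
      using arg_cong[OF *, of "fst_index m"] ab cd by (simp add: r r')
    moreover have "\<tau> b = \<tau> d"
      using arg_cong[OF *, of "snd_index m"] ab cd by (simp add: r r')
    ultimately show "k = l"
      using ab cd by (simp add: i)
  qed
  then show ?thesis
    by (simp add: fg finite_ordinal_category_def)
qed

lemma FO_prod_ide [simp]: "(m, id) \<otimes>\<^sub>F (n, id) = (m * n, id)"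
  by (rule FO_eqI_prod[where m = m and n = n]) auto

lemma FO_prod_comp:
  assumes "f \<in> Arr FO" "f' \<in> Arr FO" "g \<in> Arr FO" "g' \<in> Arr FO" "fst f' = fst f" "fst g' = fst g"
  shows "(f' \<cdot>\<^sub>F f) \<otimes>\<^sub>F (g' \<cdot>\<^sub>F g) = (f' \<otimes>\<^sub>F g') \<cdot>\<^sub>F (f \<otimes>\<^sub>F g)"
  using assms by (intro FO_eqI_prod[where m = "fst f" and n = "fst g"]) auto

lemma FO_eqI_prod3:
  assumes "f \<in> Arr FO" "g \<in> Arr FO" "fst f = m * n * p" "fst g = m * n * p"
    and "\<And>i j k. \<lbrakk>0 < i; i \<le> m; 0 < j; j \<le> n; 0 < k; k \<le> p\<rbrakk>
      \<Longrightarrow> snd f (pair_index m i (pair_index n j k)) = snd g (pair_index m i (pair_index n j k))"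
  shows "f = g"
  using assms(1-4)
proof (rule FO_eqI_prod)
  show "snd f (pair_index (m * n) l k) = snd g (pair_index (m * n) l k)"
    if "0 < l" "l \<le> m * n" "0 < k" "k \<le> p" for l k
    using that(1,2) by (rule pair_index_exhaust) (simp add: pair_index_assoc assms(5) that)
qed

lemma FO_prod_snd3 [simp]:
  assumes "fst f = m * n" "0 < i" "i \<le> m" "0 < j" "j \<le> n" "0 < k" "k \<le> fst g"
  shows "snd (f \<otimes>\<^sub>F g) (pair_index m i (pair_index n j k))
       = pair_index (m * n) (snd f (pair_index m i j)) (snd g k)"
  using FO_prod_snd[of f "m * n" "pair_index m i j" k g] assms by (simp add: pair_index_assoc)

lemma FO_prod_assoc:
  assumes "f \<in> Arr FO" "g \<in> Arr FO" "h \<in> Arr FO"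
  shows "(f \<otimes>\<^sub>F g) \<otimes>\<^sub>F h = f \<otimes>\<^sub>F (g \<otimes>\<^sub>F h)"
  using assms
  by (intro FO_eqI_prod3[where m = "fst f" and n = "fst g" and p = "fst h"])
    (auto simp: pair_index_assoc)

lemma FO_prod_one:
  assumes "f \<in> Arr FO"
  shows "(1, id) \<otimes>\<^sub>F f = f" "f \<otimes>\<^sub>F (1, id) = f"
proof -
  show "(1, id) \<otimes>\<^sub>F f = f"
    using assms FO_prod_snd[of "(1, id)" 1 1 _ f] by (intro FO_eqI) auto
  show "f \<otimes>\<^sub>F (1, id) = f"
    using assms FO_prod_snd[of f "fst f" _ 1 "(1, id)"] by (intro FO_eqI) auto
qed

lemma FO_prod_zero:
  assumes "f \<in> Arr FO"
  shows "(0, id) \<otimes>\<^sub>F f = (0, id)" "f \<otimes>\<^sub>F (0, id) = (0, id)"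
  using assms by (auto intro!: FO_eqI)

lemma FO_prod_braid [simp]:
  "fst (\<xi>\<^sub>F m n) = m * n"
  "\<lbrakk>0 < i; i \<le> m; 0 < j; j \<le> n\<rbrakk> \<Longrightarrow> snd (\<xi>\<^sub>F m n) (pair_index m i j) = pair_index n j i"
  by (simp_all add: finite_ordinal_category_def)

lemma FO_prod_braid_arr [simp]: "\<xi>\<^sub>F m n \<in> Arr FO"
proof -
  let ?s = "\<lambda>k. pair_index n (snd_index m k) (fst_index m k)"
  have "perm_arrow (m * n) ?s \<in> Arr FO"
  proof (rule perm_arrow_arr)
    fix k
    assume k: "0 < k" "k \<le> m * n"
    obtain a b where ab: "0 < a" "a \<le> m" "0 < b" "b \<le> n" "k = pair_index m a b"
      using k by (rule pair_index_exhaust)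
    then show "0 < ?s k \<and> ?s k \<le> m * n"
      using pair_index_range[of b n a m] by (simp add: mult.commute)
    fix l
    assume l: "0 < l" "l \<le> m * n" and eq: "?s k = ?s l"
    obtain c d where cd: "0 < c" "c \<le> m" "0 < d" "d \<le> n" "l = pair_index m c d"
      using l by (rule pair_index_exhaust)
    have *: "pair_index n b a = pair_index n d c"
      using eq ab cd by simp
    show "k = l"
      using arg_cong[OF *, of "fst_index n"] arg_cong[OF *, of "snd_index n"] ab cd by simp
  qed
  then show ?thesis
    by (simp add: finite_ordinal_category_def)
qed

lemma FO_prod_braid_nat:
  assumes "f \<in> Arr FO" "g \<in> Arr FO"
  shows "\<xi>\<^sub>F (fst f) (fst g) \<cdot>\<^sub>F (f \<otimes>\<^sub>F g) = (g \<otimes>\<^sub>F f) \<cdot>\<^sub>F \<xi>\<^sub>F (fst f) (fst g)"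
  using assms by (intro FO_eqI_prod[where m = "fst f" and n = "fst g"]) auto

lemma FO_prod_braid_prod:
  "\<xi>\<^sub>F m (n * p) = ((n, id) \<otimes>\<^sub>F \<xi>\<^sub>F m p) \<cdot>\<^sub>F (\<xi>\<^sub>F m n \<otimes>\<^sub>F (p, id))"
  "\<xi>\<^sub>F (m * n) p = (\<xi>\<^sub>F m p \<otimes>\<^sub>F (n, id)) \<cdot>\<^sub>F ((m, id) \<otimes>\<^sub>F \<xi>\<^sub>F n p)"
proof -
  have *: "pair_index (m * n) (pair_index n j i) k = pair_index n j (pair_index m i k)"
    if "0 < i" "0 < k" for i j k
    using pair_index_assoc[of i k n m j] that by (simp add: mult.commute)
  show "\<xi>\<^sub>F m (n * p) = ((n, id) \<otimes>\<^sub>F \<xi>\<^sub>F m p) \<cdot>\<^sub>F (\<xi>\<^sub>F m n \<otimes>\<^sub>F (p, id))"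
    by (rule FO_eqI_prod3[where m = m and n = n and p = p]) (auto simp: * pair_index_assoc)
  have braid3: "snd (\<xi>\<^sub>F (m * n) p) (pair_index m i (pair_index n j k)) = pair_index p k (pair_index m i j)"
    if "0 < i" "i \<le> m" "0 < j" "j \<le> n" "0 < k" "k \<le> p" for i j k
    using FO_prod_braid(2)[of "pair_index m i j" "m * n" k p] that by (simp add: pair_index_assoc)
  show "\<xi>\<^sub>F (m * n) p = (\<xi>\<^sub>F m p \<otimes>\<^sub>F (n, id)) \<cdot>\<^sub>F ((m, id) \<otimes>\<^sub>F \<xi>\<^sub>F n p)"
    by (rule FO_eqI_prod3[where m = m and n = n and p = p])
      (auto simp: braid3 pair_index_assoc[symmetric, where m = p] mult.commute[of p m] )
qed

lemma FO_multiplicative: "braided_monoidal_category (braided_multiplicative FO)"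
  by unfold_locales (auto simp: FO_Hom FO_Iso FO_prod_comp FO_prod_assoc FO_prod_one[simplified] FO_prod_braid_nat FO_prod_braid_prod
    mult.assoc)

subsection \<open>Distributivity\<close>

lemma FO_rdist [simp]:
  "fst (\<delta>\<^sub>F m n p) = (m + n) * p"
  "\<lbrakk>0 < i; i \<le> m; 0 < j; j \<le> p\<rbrakk>
    \<Longrightarrow> snd (\<delta>\<^sub>F m n p) (pair_index (m + n) i j) = pair_index m i j"
  "\<lbrakk>0 < i; i \<le> n; 0 < j; j \<le> p\<rbrakk>
    \<Longrightarrow> snd (\<delta>\<^sub>F m n p) (pair_index (m + n) (m + i) j) = m * p + pair_index n i j"
  by (simp_all add: finite_ordinal_category_def)

lemma FO_eqI_rdist:
  assumes "f \<in> Arr FO" "g \<in> Arr FO" "fst f = (m + n) * p" "fst g = (m + n) * p"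
    and "\<And>i j. \<lbrakk>0 < i; i \<le> m; 0 < j; j \<le> p\<rbrakk>
      \<Longrightarrow> snd f (pair_index (m + n) i j) = snd g (pair_index (m + n) i j)"
    and "\<And>i j. \<lbrakk>0 < i; i \<le> n; 0 < j; j \<le> p\<rbrakk>
      \<Longrightarrow> snd f (pair_index (m + n) (m + i) j) = snd g (pair_index (m + n) (m + i) j)"
  shows "f = g"
  using assms(1-4)
proof (rule FO_eqI_prod)
  fix i j
  assume "0 < i" "i \<le> m + n" "0 < j" "j \<le> p"
  then show "snd f (pair_index (m + n) i j) = snd g (pair_index (m + n) i j)"
    using assms(5)[of i j] assms(6)[of "i - m" j] by (cases "i \<le> m") auto
qed

lemma FO_rdist_arr [simp]: "\<delta>\<^sub>F m n p \<in> Arr FO"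
proof -
  let ?s = "\<lambda>k. let i = fst_index (m + n) k; j = snd_index (m + n) k
              in if i \<le> m then pair_index m i j else m * p + pair_index n (i - m) j"
  have "perm_arrow ((m + n) * p) ?s \<in> Arr FO"
  proof (rule perm_arrow_arr)
    fix k
    assume k: "0 < k" "k \<le> (m + n) * p"
    obtain a b where ab: "0 < a" "a \<le> m + n" "0 < b" "b \<le> p" "k = pair_index (m + n) a b"
      using k by (rule pair_index_exhaust)
    have r: "pair_index m i j \<le> m * p" if "0 < i" "i \<le> m" "0 < j" "j \<le> p" for i j
      using that by (rule pair_index_range)
    have r': "pair_index n i j \<le> n * p" if "0 < i" "i \<le> n" "0 < j" "j \<le> p" for i j
      using that by (rule pair_index_range)
    show "0 < ?s k \<and> ?s k \<le> (m + n) * p"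
      using ab r[of a b] r'[of "a - m" b]
      by (auto simp: Let_def algebra_simps le_diff_conv trans_le_add1)
    fix l
    assume l: "0 < l" "l \<le> (m + n) * p" and eq: "?s k = ?s l"
    obtain c d where cd: "0 < c" "c \<le> m + n" "0 < d" "d \<le> p" "l = pair_index (m + n) c d"
      using l by (rule pair_index_exhaust)
    have *: "(if a \<le> m then pair_index m a b else m * p + pair_index n (a - m) b)
      = (if c \<le> m then pair_index m c d else m * p + pair_index n (c - m) d)"
      using eq ab cd by (simp add: Let_def)
    have pos: "0 < pair_index n (a - m) b" if "\<not> a \<le> m"
      using that by simp
    have pos': "0 < pair_index n (c - m) d" if "\<not> c \<le> m"
      using that by simp
    consider "a \<le> m" "c \<le> m" "pair_index m a b = pair_index m c d"
      | "\<not> a \<le> m" "\<not> c \<le> m" "pair_index n (a - m) b = pair_index n (c - m) d"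
      using * r[of a b] r[of c d] pos pos' ab cd by (cases "a \<le> m"; cases "c \<le> m") (auto simp del: pair_index_range pair_index_pos)
    then show "k = l"
    proof cases
      case 1
      show ?thesis
        using arg_cong[OF 1(3), of "fst_index m"] arg_cong[OF 1(3), of "snd_index m"] ab cd 1(1,2)
        by simp
    next
      case 2
      have "a - m = c - m" "b = d"
        using arg_cong[OF 2(3), of "fst_index n"] arg_cong[OF 2(3), of "snd_index n"] ab cd 2(1,2)
        by (simp_all add: le_diff_conv)
      moreover from this have "a = c"
        using 2(1,2) by arith
      ultimately show ?thesis
        using ab cd by simp
    qed
  qed
  then show ?thesis
    by (simp add: finite_ordinal_category_def)
qed

lemma FO_ldist_nat:
  assumes "f \<in> Arr FO" "g \<in> Arr FO" "h \<in> Arr FO"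
  shows "f \<otimes>\<^sub>F (g \<oplus>\<^sub>F h) = f \<otimes>\<^sub>F g \<oplus>\<^sub>F f \<otimes>\<^sub>F h"
proof (rule FO_eqI2[where m = "fst f * fst g" and n = "fst f * fst h"])
  let ?l = "f \<otimes>\<^sub>F (g \<oplus>\<^sub>F h)" and ?r = "f \<otimes>\<^sub>F g \<oplus>\<^sub>F f \<otimes>\<^sub>F h"
  show "snd ?l k = snd ?r k" if "0 < k" "k \<le> fst f * fst g" for k
    using that by (rule pair_index_exhaust) (simp add: assms)
  show "snd ?l (fst f * fst g + k) = snd ?r (fst f * fst g + k)" if "0 < k" "k \<le> fst f * fst h" for k
    using that by (rule pair_index_exhaust) (simp add: assms pair_index_sum[symmetric], simp add: assms pair_index_sum)
qed (simp_all add: assms algebra_simps)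

lemma FO_rdist_nat:
  assumes "f \<in> Arr FO" "g \<in> Arr FO" "h \<in> Arr FO"
  shows "\<delta>\<^sub>F (fst f) (fst g) (fst h) \<cdot>\<^sub>F ((f \<oplus>\<^sub>F g) \<otimes>\<^sub>F h)
       = (f \<otimes>\<^sub>F h \<oplus>\<^sub>F g \<otimes>\<^sub>F h) \<cdot>\<^sub>F \<delta>\<^sub>F (fst f) (fst g) (fst h)"
  using assms
  by (intro FO_eqI_rdist[where m = "fst f" and n = "fst g" and p = "fst h"]) (auto simp: distrib_right)

lemma FO_rdist_sum_braid:
  "\<delta>\<^sub>F n m p \<cdot>\<^sub>F (\<zeta>\<^sub>F m n \<otimes>\<^sub>F (p, id)) = \<zeta>\<^sub>F (m * p) (n * p) \<cdot>\<^sub>F \<delta>\<^sub>F m n p"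
proof (rule FO_eqI_rdist[where m = m and n = n and p = p])
  fix i j :: nat
  assume *: "0 < i" "0 < j" "j \<le> p"
  let ?l = "\<delta>\<^sub>F n m p \<cdot>\<^sub>F (\<zeta>\<^sub>F m n \<otimes>\<^sub>F (p, id))"
  let ?r = "\<zeta>\<^sub>F (m * p) (n * p) \<cdot>\<^sub>F \<delta>\<^sub>F m n p"
  show "snd ?l (pair_index (m + n) i j) = snd ?r (pair_index (m + n) i j)" if "i \<le> m"
    using * that FO_rdist(3)[of i m j p n] by (simp add: add.commute)
  show "snd ?l (pair_index (m + n) (m + i) j) = snd ?r (pair_index (m + n) (m + i) j)" if "i \<le> n"
    using * that FO_rdist(2)[of i n j p m] by (simp add: add.commute[of n m])
qed (simp_all add: distrib_right)

lemma FO_ldist_sum_braid: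
  "(m, id) \<otimes>\<^sub>F \<zeta>\<^sub>F n p = \<zeta>\<^sub>F (m * n) (m * p)"
proof (rule FO_eqI2[where m = "m * n" and n = "m * p"])
  show "snd ((m, id) \<otimes>\<^sub>F \<zeta>\<^sub>F n p) k = snd (\<zeta>\<^sub>F (m * n) (m * p)) k" if "0 < k" "k \<le> m * n" for k
    using that by (rule pair_index_exhaust) (simp add: pair_index_sum)
  show "snd ((m, id) \<otimes>\<^sub>F \<zeta>\<^sub>F n p) (m * n + k) = snd (\<zeta>\<^sub>F (m * n) (m * p)) (m * n + k)"
    if "0 < k" "k \<le> m * p" for k
    using that by (rule pair_index_exhaust) (simp add: pair_index_sum[symmetric], simp add: pair_index_sum)
qed (simp_all add: algebra_simps)

lemma FO_eqI_rdist3: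
  assumes "f \<in> Arr FO" "g \<in> Arr FO" "fst f = (m + n + q) * p" "fst g = (m + n + q) * p"
    and "\<And>i j. \<lbrakk>0 < i; i \<le> m; 0 < j; j \<le> p\<rbrakk>
      \<Longrightarrow> snd f (pair_index (m + n + q) i j) = snd g (pair_index (m + n + q) i j)"
    and "\<And>i j. \<lbrakk>0 < i; i \<le> n; 0 < j; j \<le> p\<rbrakk>
      \<Longrightarrow> snd f (pair_index (m + n + q) (m + i) j) = snd g (pair_index (m + n + q) (m + i) j)"
    and "\<And>i j. \<lbrakk>0 < i; i \<le> q; 0 < j; j \<le> p\<rbrakk>
      \<Longrightarrow> snd f (pair_index (m + n + q) (m + n + i) j) = snd g (pair_index (m + n + q) (m + n + i) j)"
  shows "f = g"
  using assms(1-4)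
proof (rule FO_eqI_rdist)
  fix i j
  assume "0 < i" "i \<le> m + n" "0 < j" "j \<le> p"
  then show "snd f (pair_index (m + n + q) i j) = snd g (pair_index (m + n + q) i j)"
    using assms(5)[of i j] assms(6)[of "i - m" j] by (cases "i \<le> m") auto
qed (rule assms(7))

lemma FO_rdist_sum_assoc:
  "(\<delta>\<^sub>F m n p \<oplus>\<^sub>F (q * p, id)) \<cdot>\<^sub>F \<delta>\<^sub>F (m + n) q p
 = ((m * p, id) \<oplus>\<^sub>F \<delta>\<^sub>F n q p) \<cdot>\<^sub>F \<delta>\<^sub>F m (n + q) p"
proof (rule FO_eqI_rdist3[where m = m and n = n and p = p and q = q])
  have 1: "snd (\<delta>\<^sub>F m (n + q) p) (pair_index (m + n + q) i j) = pair_index m i j"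
    if "0 < i" "i \<le> m" "0 < j" "j \<le> p" for i j
    using FO_rdist(2)[of i m j p "n + q"] that by (simp add: add.assoc)
  have 2: "snd (\<delta>\<^sub>F m (n + q) p) (pair_index (m + n + q) (m + i) j) = m * p + pair_index (n + q) i j"
    if "0 < i" "i \<le> n + q" "0 < j" "j \<le> p" for i j
    using FO_rdist(3)[of i "n + q" j p m] that by (simp add: add.assoc)
  let ?l = "(\<delta>\<^sub>F m n p \<oplus>\<^sub>F (q * p, id)) \<cdot>\<^sub>F \<delta>\<^sub>F (m + n) q p"
  let ?r = "((m * p, id) \<oplus>\<^sub>F \<delta>\<^sub>F n q p) \<cdot>\<^sub>F \<delta>\<^sub>F m (n + q) p"
  fix i j :: nat
  assume j: "0 < j" "j \<le> p" "0 < i"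
  show "snd ?l (pair_index (m + n + q) i j) = snd ?r (pair_index (m + n + q) i j)" if "i \<le> m"
    using j that by (simp add: 1)
  show "snd ?l (pair_index (m + n + q) (m + i) j) = snd ?r (pair_index (m + n + q) (m + i) j)" if "i \<le> n"
    using j that by (simp add: 2)
  show "snd ?l (pair_index (m + n + q) (m + n + i) j) = snd ?r (pair_index (m + n + q) (m + n + i) j)"
    if "i \<le> q"
  proof -
    have "snd ?l (pair_index (m + n + q) (m + n + i) j) = (m + n) * p + pair_index q i j"
      using j that by simp
    moreover have "snd ?r (pair_index (m + n + q) (m + n + i) j) = m * p + (n * p + pair_index q i j)"
      using j that 2[of "n + i" j] by (simp add: add.assoc[of m n i])
    ultimately show ?thesis
      by (simp add: distrib_right)
  qed
qed (auto simp: algebra_simps)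

lemma FO_rdist_prod_assoc:
  "\<delta>\<^sub>F (m * p) (n * p) q \<cdot>\<^sub>F (\<delta>\<^sub>F m n p \<otimes>\<^sub>F (q, id)) = \<delta>\<^sub>F m n (p * q)"
proof (rule FO_eqI_prod3[where m = "m + n" and n = p and p = q])
  fix i j k
  assume *: "0 < i" "i \<le> m + n" "0 < j" "j \<le> p" "0 < k" "k \<le> q"
  let ?l = "\<delta>\<^sub>F (m * p) (n * p) q \<cdot>\<^sub>F (\<delta>\<^sub>F m n p \<otimes>\<^sub>F (q, id))"
  let ?x = "pair_index (m + n) i (pair_index p j k)"
  consider "i \<le> m" | l where "i = m + l" "0 < l" "l \<le> n"
    using *(1,2) by (rule sum_index_cases)
  then show "snd ?l ?x = snd (\<delta>\<^sub>F m n (p * q)) ?x"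
  proof cases
    case 1
    then show ?thesis
      using * FO_rdist(2)[of "pair_index m i j" "m * p" k q "n * p"]
      by (simp add: pair_index_assoc distrib_right)
  next
    case (2 l)
    then show ?thesis
      using * FO_rdist(3)[of "pair_index n l j" "n * p" k q "m * p"]
      by (simp add: pair_index_assoc distrib_right mult.assoc)
  qed
qed (auto simp: algebra_simps)

lemma FO_ldist_rdist_prod_assoc:
  "\<delta>\<^sub>F (m * n) (m * p) q = (m, id) \<otimes>\<^sub>F \<delta>\<^sub>F n p q"
proof (rule FO_eqI_prod3[where m = m and n = "n + p" and p = q])
  fix i j k
  assume *: "0 < i" "i \<le> m" "0 < j" "j \<le> n + p" "0 < k" "k \<le> q"
  let ?x = "pair_index m i (pair_index (n + p) j k)"
  have x: "?x = pair_index (m * n + m * p) (pair_index m i j) k"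
    using * by (simp add: pair_index_assoc[symmetric] algebra_simps)
  consider "j \<le> n" | l where "j = n + l" "0 < l" "l \<le> p"
    using *(3,4) by (rule sum_index_cases)
  then show "snd (\<delta>\<^sub>F (m * n) (m * p) q) ?x = snd ((m, id) \<otimes>\<^sub>F \<delta>\<^sub>F n p q) ?x"
  proof cases
    case 1
    have "snd (\<delta>\<^sub>F (m * n) (m * p) q) ?x = pair_index (m * n) (pair_index m i j) k"
      unfolding x using * 1 by simp
    moreover have "snd ((m, id) \<otimes>\<^sub>F \<delta>\<^sub>F n p q) ?x = pair_index m i (pair_index n j k)"
      using * 1 by (subst FO_prod_snd) auto
    ultimately show ?thesis
      using * by (simp add: pair_index_assoc)
  next
    case (2 l)
    have "snd (\<delta>\<^sub>F (m * n) (m * p) q) ?x = m * n * q + pair_index (m * p) (pair_index m i l) k"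
      unfolding x using * 2 by (simp add: pair_index_sum)
    moreover have "snd ((m, id) \<otimes>\<^sub>F \<delta>\<^sub>F n p q) ?x = pair_index m i (n * q + pair_index p l k)"
      using * 2 by (subst FO_prod_snd) auto
    ultimately show ?thesis
      using * 2 by (simp add: pair_index_assoc pair_index_sum algebra_simps)
  qed
qed (auto simp: algebra_simps)

lemma FO_middle_exchange:
  "middle_exchange (additive FO) a b c d = (a, id) \<oplus>\<^sub>F (\<zeta>\<^sub>F b c \<oplus>\<^sub>F (d, id))"
  by (simp add: middle_exchange_def algebra_simps)

lemma FO_exchange:
  "middle_exchange (additive FO) (m * p) (m * q) (n * p) (n * q) \<cdot>\<^sub>F \<delta>\<^sub>F m n (p + q)
 = \<delta>\<^sub>F m n p \<oplus>\<^sub>F \<delta>\<^sub>F m n q"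
proof (rule FO_eqI2[where m = "(m + n) * p" and n = "(m + n) * q"])
  let ?l = "middle_exchange (additive FO) (m * p) (m * q) (n * p) (n * q) \<cdot>\<^sub>F \<delta>\<^sub>F m n (p + q)"
  let ?r = "\<delta>\<^sub>F m n p \<oplus>\<^sub>F \<delta>\<^sub>F m n q"
  fix k :: nat
  assume k0: "0 < k"
  show "snd ?l k = snd ?r k" if k: "k \<le> (m + n) * p"
    using k0 k
  proof (rule pair_index_exhaust)
    fix i j
    assume *: "0 < i" "i \<le> m + n" "0 < j" "j \<le> p" "k = pair_index (m + n) i j"
    consider "i \<le> m" | l where "i = m + l" "0 < l" "l \<le> n"
      using *(1,2) by (rule sum_index_cases)
    then show ?thesis
    proof cases
      case 1
      then show ?thesis
        using * by (simp add: FO_middle_exchange)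
    next
      case (2 l)
      then show ?thesis
        using * trans_le_add1[OF pair_index_range[of l n j p], of "n * q"]
        by (simp add: FO_middle_exchange distrib_left add.assoc)
    qed
  qed
  show "snd ?l ((m + n) * p + k) = snd ?r ((m + n) * p + k)" if k: "k \<le> (m + n) * q"
    using k0 k
  proof (rule pair_index_exhaust)
    fix i j
    assume *: "0 < i" "i \<le> m + n" "0 < j" "j \<le> q" "k = pair_index (m + n) i j"
    have x: "(m + n) * p + k = pair_index (m + n) i (p + j)"
      using * by (simp add: pair_index_sum)
    have r: "snd ?r ((m + n) * p + k) = (m + n) * p + snd (\<delta>\<^sub>F m n q) k"
      using * by (intro FO_sum_snd) auto
    consider "i \<le> m" | l where "i = m + l" "0 < l" "l \<le> n"
      using *(1,2) by (rule sum_index_cases)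
    then show ?thesis
    proof cases
      case 1
      then show ?thesis
        unfolding r unfolding x
        using * trans_le_add1[OF pair_index_range[of i m j q], of "n * p + n * q"]
          trans_le_add1[OF pair_index_range[of i m j q], of "n * p"]
        by (simp add: FO_middle_exchange) (simp add: pair_index_sum distrib_right add.assoc)
    next
      case (2 l)
      have "snd (\<zeta>\<^sub>F (m * q) (n * p) \<oplus>\<^sub>F (n * q, id)) (m * q + (n * p + pair_index n l j))
          = m * q + (n * p + pair_index n l j)"
        using 2 * by (subst FO_sum_snd(3)) auto
      then show ?thesis
        unfolding r unfolding x using 2 *
        by (simp add: FO_middle_exchange) (simp add: pair_index_sum distrib_left distrib_right add.assoc)
    qed
  qed
qed (simp_all add: FO_middle_exchange algebra_simps)

lemma FO_rdist_units:
  "\<delta>\<^sub>F 0 n p = (n * p, id)" "\<delta>\<^sub>F m 0 p = (m * p, id)" "\<delta>\<^sub>F m n 0 = (0, id)"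
  "\<delta>\<^sub>F m n 1 = (m + n, id)"
proof -
  show "\<delta>\<^sub>F 0 n p = (n * p, id)"
    using FO_rdist(3)[of _ n _ p 0] by (intro FO_eqI_prod[where m = n and n = p]) auto
  show "\<delta>\<^sub>F m 0 p = (m * p, id)"
    using FO_rdist(2)[of _ m _ p 0] by (intro FO_eqI_prod[where m = m and n = p]) auto
  show "\<delta>\<^sub>F m n 0 = (0, id)"
    by (intro FO_eqI) auto
  show "\<delta>\<^sub>F m n 1 = (m + n, id)"
    using FO_rdist(2)[of _ m 1 1 n] FO_rdist(3)[of _ n 1 1 m] by (intro FO_eqI2) auto
qed

lemma FO_ldist_prod_braid:
  "\<xi>\<^sub>F (m + n) p = (\<xi>\<^sub>F m p \<oplus>\<^sub>F \<xi>\<^sub>F n p) \<cdot>\<^sub>F \<delta>\<^sub>F m n p"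
  by (rule FO_eqI_rdist[where m = m and n = n and p = p]) (auto simp: pair_index_sum distrib_right mult.commute[of p])

lemma FO_rdist_prod_braid:
  "\<delta>\<^sub>F n p m \<cdot>\<^sub>F \<xi>\<^sub>F m (n + p) = \<xi>\<^sub>F m n \<oplus>\<^sub>F \<xi>\<^sub>F m p"
proof (rule FO_eqI2[where m = "m * n" and n = "m * p"])
  let ?l = "\<delta>\<^sub>F n p m \<cdot>\<^sub>F \<xi>\<^sub>F m (n + p)" and ?r = "\<xi>\<^sub>F m n \<oplus>\<^sub>F \<xi>\<^sub>F m p"
  show "snd ?l k = snd ?r k" if "0 < k" "k \<le> m * n" for k
    using that by (rule pair_index_exhaust) simp
  show "snd ?l (m * n + k) = snd ?r (m * n + k)" if "0 < k" "k \<le> m * p" for k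
    using that by (rule pair_index_exhaust) (simp, simp add: pair_index_sum[symmetric] mult.commute)
qed (auto simp: algebra_simps)


text \<open>
  All arrows are permutations, hence isomorphisms, so that every monicity condition holds.
\<close>

theorem FO_flat: "flat_braided_bimonoidal_category FO"
proof -
  interpret add: symmetric_monoidal_category "additive FO"
    by (rule FO_additive)
  interpret mult: braided_monoidal_category "braided_multiplicative FO"
    by (rule FO_multiplicative)
  have monic: "monic FO f" if "f \<in> Arr FO" for f
    using that by (intro FO.iso_monic FO_iso)
  have mult: "monoidal_category (multiplicative FO)"
    using mult.monoidal_category_axioms
    by (simp add: monoidal_category_def monoidal_category_axioms_def category_def)
  have cls: "f \<in> Arr FO" if "f \<in> distributivity_class FO" for f
    using that by induction auto
  interpret bimonoidal_category FO
    using mult FO_additive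
    by unfold_locales
      (auto simp: FO_Hom FO_Iso monic FO_sum_zero FO_prod_zero FO_ldist_nat FO_rdist_nat
        FO_ldist_sum_braid FO_rdist_sum_braid FO_rdist_sum_assoc FO_rdist_prod_assoc
        FO_ldist_rdist_prod_assoc FO_exchange FO_rdist_units FO_rdist_units(4)[simplified]
        FO_prod_comp FO_prod_assoc FO_prod_one[simplified]
        distrib_left distrib_right add.assoc mult.assoc)
  interpret braided_bimonoidal_category FO
    using FO_multiplicative
    by unfold_locales
      (auto simp: FO_ldist_prod_braid FO_rdist_prod_braid distrib_left intro!: FO_eqI)
  show ?thesis
    by unfold_locales (blast intro: monic cls)
qed

section \<open>Powers of an object in a symmetric monoidal category\<close>

locale pointed_symmetric_monoidal_category = symmetric_monoidal_category \<C>
  for \<C> :: "('o, 'm, 'z) braided_data_scheme" (structure) +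
  fixes U :: 'o
  assumes U_ob [simp]: "U \<in> Obj \<C>"
begin

primrec pow :: "nat \<Rightarrow> 'o" where
  "pow 0 = \<I>"
| "pow (Suc n) = U \<odot> pow n"

lemma pow_ob [simp]: "pow n \<in> Obj \<C>"
  by (induction n) simp_all

text \<open>
  On the \<open>n\<close>-fold power, \<open>transp i n\<close> exchanges the factors number \<open>i\<close> and \<open>i + 1\<close>, counted from \<open>0\<close>;
  on the \<open>(n + 1)\<close>-fold power, \<open>cyc p n\<close> moves the first factor behind the next \<open>p\<close>. Only
  the values for \<open>i + 2 \<le> n\<close> and \<open>p \<le> n\<close> matter, where the subtractions do not truncate.
\<close>

primrec transp :: "nat \<Rightarrow> nat \<Rightarrow> 'm" where
  "transp 0 n = twist U U (pow (n - 2))"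
| "transp (Suc i) n = \<iota> U \<odot>\<^sub>a transp i (n - 1)"

primrec cyc :: "nat \<Rightarrow> nat \<Rightarrow> 'm" where
  "cyc 0 n = \<iota> (pow (Suc n))"
| "cyc (Suc p) n = (\<iota> U \<odot>\<^sub>a cyc p (n - 1)) \<cdot> twist U U (pow (n - 1))"

lemma transp_arr' :
  "Suc i < n \<Longrightarrow> transp i n \<in> Arr \<C> \<and> Src \<C> (transp i n) = pow n \<and> Tgt \<C> (transp i n) = pow n"
proof (induction i arbitrary: n)
  case 0
  then obtain m where "n = Suc (Suc m)"
    using less_iff_Suc_add[of 1 n] by auto
  then show ?case
    by simp
next
  case (Suc i)
  then show ?case
    by (cases n) simp_all
qed

lemma transp_arr [simp]:
  assumes "Suc i < n"
  shows "transp i n \<in> Arr \<C>" "Src \<C> (transp i n) = pow n" "Tgt \<C> (transp i n) = pow n"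
  using transp_arr'[OF assms] by auto

lemma transp_transp: "Suc i < n \<Longrightarrow> transp i n \<cdot> transp i n = \<iota> (pow n)"
proof (induction i arbitrary: n)
  case 0
  then obtain m where "n = Suc (Suc m)"
    using less_iff_Suc_add[of 1 n] by auto
  then show ?case
    by simp
next
  case (Suc i)
  then obtain m where "n = Suc m" "Suc i < m"
    by (cases n) auto
  then show ?case
    using Suc.IH[of m] by simp
qed

lemma cyc_arr':
  "p \<le> n \<Longrightarrow> cyc p n \<in> Arr \<C> \<and> Src \<C> (cyc p n) = U \<odot> pow n \<and> Tgt \<C> (cyc p n) = U \<odot> pow n"
proof (induction p arbitrary: n)
  case (Suc p)
  then show ?case
    by (cases n) simp_all
qed simp

lemma cyc_arr [simp]:
  assumes "p \<le> n"
  shows "cyc p n \<in> Arr \<C>" "Src \<C> (cyc p n) = U \<odot> pow n" "Tgt \<C> (cyc p n) = U \<odot> pow n"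
  using cyc_arr'[OF assms] by auto

lemma twist_pow:
  assumes [simp]: "f \<in> Arr \<C>" "Src \<C> f = pow n" "Tgt \<C> f = pow n"
  shows "(\<iota> U \<odot>\<^sub>a (\<iota> U \<odot>\<^sub>a f)) \<cdot> twist U U (pow n) = twist U U (pow n) \<cdot> (\<iota> U \<odot>\<^sub>a (\<iota> U \<odot>\<^sub>a f))"
  using twist_natural[of "\<iota> U" "\<iota> U" f U U "pow n"] by simp

text \<open>
  The next four lemmas multiply a cycle by an adjacent transposition from the left. Only the last one,
  where both exchanged factors are passed by the moving one, needs the Yang-Baxter equation.
\<close>

lemma transp_cyc:
  "i < n \<Longrightarrow> transp i (Suc n) \<cdot> cyc i n = cyc (Suc i) n"
proof (induction i arbitrary: n)
  case 0
  then show ?case by (cases n) simp_all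
next
  case (Suc i)
  then obtain m where m: "n = Suc m" "i < m"
    by (cases n) auto
  then show ?case
    using Suc.IH[of m] by simp
qed

lemma transp_cyc_Suc:
  assumes "i < n"
  shows "transp i (Suc n) \<cdot> cyc (Suc i) n = cyc i n"
proof -
  have "transp i (Suc n) \<cdot> transp i (Suc n) \<cdot> cyc i n = \<iota> (pow (Suc n)) \<cdot> cyc i n"
    using assms by (intro reassoc) (simp_all add: transp_transp del: pow.simps, simp_all)
  then show ?thesis
    using assms by (simp add: transp_cyc)
qed

lemma transp_cyc_less:
  "p \<le> i \<Longrightarrow> Suc i < n \<Longrightarrow> transp (Suc i) (Suc n) \<cdot> cyc p n = cyc p n \<cdot> (\<iota> U \<odot>\<^sub>a transp i n)"
proof (induction p arbitrary: i n)
  case (Suc p)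
  then obtain j m where *: "n = Suc m" "i = Suc j" "p \<le> j" "Suc j < m"
    by (cases n; cases i) auto
  have "transp (Suc i) (Suc n) \<cdot> cyc (Suc p) n
      = (\<iota> U \<odot>\<^sub>a (transp (Suc j) (Suc m) \<cdot> cyc p m)) \<cdot> twist U U (pow m)"
    using * by simp
  also have "\<dots> = (\<iota> U \<odot>\<^sub>a cyc p m) \<cdot> (\<iota> U \<odot>\<^sub>a (\<iota> U \<odot>\<^sub>a transp j m)) \<cdot> twist U U (pow m)"
    using * Suc.IH[of j m] by simp
  also have "\<dots> = cyc (Suc p) n \<cdot> (\<iota> U \<odot>\<^sub>a transp i n)"
    using * by (simp add: twist_pow del: interchange_assoc)
  finally show ?case .
qed simp

lemma transp_cyc_greater:
  "Suc i < p \<Longrightarrow> p \<le> n \<Longrightarrow> transp i (Suc n) \<cdot> cyc p n = cyc p n \<cdot> (\<iota> U \<odot>\<^sub>a transp i n)"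
proof (induction i arbitrary: p n)
  case 0
  then obtain q m where *: "n = Suc (Suc m)" "p = Suc (Suc q)" "q \<le> m"
    by (cases n; cases p; cases "p - 1"; cases "n - 1") auto
  let ?s = "twist U U (U \<odot> pow m)" and ?t = "\<iota> U \<odot>\<^sub>a twist U U (pow m)"
  let ?c = "\<iota> U \<odot>\<^sub>a (\<iota> U \<odot>\<^sub>a cyc q m)"
  have "transp 0 (Suc n) \<cdot> cyc p n = ?s \<cdot> ?c \<cdot> ?t \<cdot> ?s"
    using * by simp
  also have "\<dots> = (?c \<cdot> ?s) \<cdot> ?t \<cdot> ?s"
    using * reassoc[OF twist_pow[of "cyc q m" "Suc m", symmetric], of "?t \<cdot> ?s"] by simp
  also have "\<dots> = ?c \<cdot> ?t \<cdot> ?s \<cdot> ?t"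
    using * yang_baxter[of U U U "pow m"] by (simp del: interchange_assoc)
  also have "\<dots> = cyc p n \<cdot> (\<iota> U \<odot>\<^sub>a transp 0 n)"
    using * by simp
  finally show ?case .
next
  case (Suc i)
  then obtain q m where *: "n = Suc m" "p = Suc q" "Suc i < q" "q \<le> m"
    by (cases n; cases p) auto
  have "transp (Suc i) (Suc n) \<cdot> cyc p n
      = (\<iota> U \<odot>\<^sub>a (transp i (Suc m) \<cdot> cyc q m)) \<cdot> twist U U (pow m)"
    using * by simp
  also have "\<dots> = (\<iota> U \<odot>\<^sub>a cyc q m) \<cdot> (\<iota> U \<odot>\<^sub>a (\<iota> U \<odot>\<^sub>a transp i m)) \<cdot> twist U U (pow m)"
    using * Suc.IH[of q m] by simp
  also have "\<dots> = cyc p n \<cdot> (\<iota> U \<odot>\<^sub>a transp (Suc i) n)"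
    using * by (simp add: twist_pow del: interchange_assoc)
  finally show ?case .
qed

end

subsection \<open>Generators of the symmetric groups\<close>

text \<open>
  The finite ordinals are an instance with \<open>pow n = n\<close>, so that the equations above also hold between
  permutations.
\<close>

interpretation FOp: pointed_symmetric_monoidal_category "additive FO" "Suc 0"
  rewrites "Obj (additive FO) = UNIV" and "Arr (additive FO) = Arr FO"
    and "Src (additive FO) = fst" and "Tgt (additive FO) = fst"
    and "Ide (additive FO) = Ide FO" and "Comp (additive FO) = Comp FO"
    and "tensorO (additive FO) = (+)" and "tensorA (additive FO) = sumA FO"
    and "unitO (additive FO) = 0" and "Ide FO n = (n, id)"
  using FO_additive
  by (auto simp: pointed_symmetric_monoidal_category_def pointed_symmetric_monoidal_category_axioms_def)

text \<open>
  The induction method unfolds the identity permutation into an abstraction.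
\<close>

lemma fold_id [simp]: "(n :: nat, \<lambda>k :: nat. k) = (n, id)"
  by (simp add: id_def)

lemma FO_pow [simp]: "FOp.pow n = n"
  by (induction n) auto

text \<open>
  Together with identities and composition these generate all permutations, see \<open>FO_generated\<close>.
\<close>

abbreviation swap0 :: "nat \<Rightarrow> nat \<times> (nat \<Rightarrow> nat)" where
  "swap0 n \<equiv> \<zeta>\<^sub>F (Suc 0) (Suc 0) \<oplus>\<^sub>F (n, id)"

abbreviation up :: "nat \<times> (nat \<Rightarrow> nat) \<Rightarrow> nat \<times> (nat \<Rightarrow> nat)" where
  "up f \<equiv> (Suc 0, id) \<oplus>\<^sub>F f"

lemma FO_twist [simp]: "FOp.twist (Suc 0) (Suc 0) n = swap0 n"
  by (simp add: FOp.twist_def)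

lemma cyc_first: "p \<le> n \<Longrightarrow> snd (FOp.cyc p n) 1 = Suc p"
proof (induction p arbitrary: n)
  case (Suc p)
  then obtain m where "n = Suc m" "p \<le> m"
    by (cases n) auto
  then show ?case
    using Suc.IH[of m] FO_sum_snd(2)[of 1 "FOp.cyc p m" "(Suc 0, id)" "Suc 0"]
      FO_sum_braid(2)[of "Suc 0" "Suc 0" "Suc 0"]
    by simp
qed simp

lemma up_surj:
  assumes "f \<in> Arr FO" "fst f = Suc n" "snd f 1 = 1"
  obtains g where "g \<in> Arr FO" "fst g = n" "f = up g"
proof -
  let ?s = "\<lambda>k. snd f (Suc k) - 1"
  let ?g = "perm_arrow n ?s"
  have *: "Suc 0 < snd f (Suc k) \<and> snd f (Suc k) \<le> Suc n" if "0 < k" "k \<le> n" for k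
    using FO_range[OF assms(1), of "Suc k"] FO_arr_inj[OF assms(1), of "Suc k" 1] assms(2,3) that
    by (auto simp: neq_iff)
  have g: "?g \<in> Arr FO"
  proof (rule perm_arrow_arr)
    show "a = b" if "0 < a" "a \<le> n" "0 < b" "b \<le> n" "?s a = ?s b" for a b
      using that *[of a] *[of b] FO_arr_inj[OF assms(1), of "Suc a" "Suc b"] by auto
    show "0 < ?s k \<and> ?s k \<le> n" if "0 < k" "k \<le> n" for k
      using *[OF that] by auto
  qed
  moreover have "f = up ?g"
  proof (rule FO_eqI2[where m = "Suc 0" and n = n])
    show "snd f k = snd (up ?g) k" if "0 < k" "k \<le> Suc 0" for k
      using that assms(3) by (auto simp: le_Suc_eq)
    show "snd f (Suc 0 + k) = snd (up ?g) (Suc 0 + k)" if "0 < k" "k \<le> n" for k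
      using that *[OF that] by (subst FO_sum_snd(2)) auto
  qed (use assms g in auto)
  ultimately show ?thesis
    using that[of ?g] by simp
qed

lemma up_inj:
  assumes "up f = up g" "f \<in> Arr FO" "g \<in> Arr FO"
  shows "f = g"
proof (rule FO_eqI)
  show f: "fst g = fst f"
    using arg_cong[OF assms(1), of fst] by simp
  show "snd f k = snd g k" if "0 < k" "k \<le> fst f" for k
    using FO_sum_snd(2)[of k f "(Suc 0, id)" "Suc 0"] FO_sum_snd(2)[of k g "(Suc 0, id)" "Suc 0"] f that assms(1)
    by simp
qed (use assms in auto)

text \<open>
  The cycles represent the cosets of the stabilizer of the first element: a cycle is determined by
  where it sends that element, and every place occurs.
\<close>

lemma FO_decomp:
  assumes f: "f \<in> Arr FO" "fst f = Suc n"
  obtains p g where "p \<le> n" "g \<in> Arr FO" "fst g = n" "f = FOp.cyc p n \<cdot>\<^sub>F up g"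
proof -
  define p where "p = snd f 1 - 1"
  have p: "snd f 1 = Suc p" "p \<le> n"
    using FO_range[OF f(1), of 1] f(2) by (auto simp: p_def)
  have c: "FOp.cyc p n \<in> Arr FO" "fst (FOp.cyc p n) = Suc n"
    using p(2) by auto
  let ?c' = "arr_inv FO (FOp.cyc p n)"
  have i: "is_iso FO (FOp.cyc p n)"
    by (rule FO_iso[OF c(1)])
  have c': "?c' \<in> Arr FO" "fst ?c' = Suc n" "?c' \<cdot>\<^sub>F FOp.cyc p n = (Suc n, id)" "FOp.cyc p n \<cdot>\<^sub>F ?c' = (Suc n, id)"
    using FO.inv_facts[OF i] c by auto
  have "snd (?c' \<cdot>\<^sub>F f) 1 = snd (?c' \<cdot>\<^sub>F FOp.cyc p n) 1"
    using p cyc_first[OF p(2)] by simp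
  then have "snd (?c' \<cdot>\<^sub>F f) 1 = 1"
    unfolding c' by simp
  then obtain g where g: "g \<in> Arr FO" "fst g = n" "?c' \<cdot>\<^sub>F f = up g"
    using up_surj[of "?c' \<cdot>\<^sub>F f" n] c' f by auto
  have "FOp.cyc p n \<cdot>\<^sub>F up g = (FOp.cyc p n \<cdot>\<^sub>F ?c') \<cdot>\<^sub>F f"
    unfolding g(3)[symmetric] using c c' f by (intro FO.comp_ass[symmetric]) auto
  then have "f = FOp.cyc p n \<cdot>\<^sub>F up g"
    unfolding c' by simp
  then show ?thesis
    using that p g by blast
qed

lemma FO_decomp_unique:
  assumes "FOp.cyc p n \<cdot>\<^sub>F up g = FOp.cyc q n \<cdot>\<^sub>F up h"
    and "p \<le> n" "q \<le> n" "g \<in> Arr FO" "fst g = n" "h \<in> Arr FO" "fst h = n"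
  shows "p = q" "g = h"
proof -
  have "snd (FOp.cyc p n \<cdot>\<^sub>F up g) 1 = snd (FOp.cyc q n \<cdot>\<^sub>F up h) 1"
    by (simp add: assms(1))
  then show pq: "p = q"
    using cyc_first[of p n] cyc_first[of q n] assms(2-) by simp
  have "up g = up h"
    using assms FO_iso[of "FOp.cyc p n"] by (intro FO.iso_cancel_left[OF assms(1)[folded pq]]) auto
  then show "g = h"
    by (rule up_inj) (use assms in auto)
qed

lemma FO_generated [consumes 1, case_names ide comp up swap0]:
  assumes "f \<in> Arr FO"
    and ide: "\<And>n. P (n, id)"
    and comp: "\<And>f g. \<lbrakk>f \<in> Arr FO; g \<in> Arr FO; fst g = fst f; P f; P g\<rbrakk> \<Longrightarrow> P (g \<cdot>\<^sub>F f)"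
    and up: "\<And>f. f \<in> Arr FO \<Longrightarrow> P f \<Longrightarrow> P (up f)"
    and swap0: "\<And>n. P (swap0 n)"
  shows "P f"
proof -
  have cyc: "P (FOp.cyc p n)" if "p \<le> n" for p n
    using that
  proof (induction p arbitrary: n)
    case 0
    then show ?case
      using ide[of "Suc n"] by simp
  next
    case (Suc p)
    then obtain m where m: "n = Suc m" "p \<le> m"
      by (cases n) auto
    have "P (up (FOp.cyc p m))"
      using m(2) Suc.IH[of m] by (intro up) auto
    then have "P (up (FOp.cyc p m) \<cdot>\<^sub>F swap0 m)"
      using m(2) by (intro comp swap0) auto
    then show ?case
      using m by simp
  qed
  have "P f" if "f \<in> Arr FO" "fst f = n" for n
    using that
  proof (induction n arbitrary: f)
    case 0
    then have "f = (0, id)"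
      by (intro FO_eqI) auto
    then show ?case
      by (simp add: ide)
  next
    case (Suc n)
    obtain p g where *: "p \<le> n" "g \<in> Arr FO" "fst g = n" "f = FOp.cyc p n \<cdot>\<^sub>F up g"
      using Suc.prems by (rule FO_decomp)
    have "P (up g)"
      using * by (intro up Suc.IH) auto
    then show ?case
      unfolding *(4) using * cyc[of p n] by (intro comp) auto
  qed
  then show ?thesis
    using assms(1) by blast
qed

text \<open>
  The functor below is defined along the decomposition \<open>FO_decomp\<close>, which behaves well under
  multiplication by adjacent transpositions from the left. Hence a second form of generation.
\<close>

inductive_set adjacent :: "(nat \<times> (nat \<Rightarrow> nat)) set" where
  ide: "(n, id) \<in> adjacent"
| transp: "\<lbrakk>f \<in> adjacent; f \<in> Arr FO; Suc i < fst f\<rbrakk> \<Longrightarrow> FOp.transp i (fst f) \<cdot>\<^sub>F f \<in> adjacent"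

lemma adjacent_arr: "f \<in> adjacent \<Longrightarrow> f \<in> Arr FO"
  by (induction rule: adjacent.induct) auto

lemma adjacent_comp:
  "g \<in> adjacent \<Longrightarrow> f \<in> adjacent \<Longrightarrow> fst g = fst f \<Longrightarrow> g \<cdot>\<^sub>F f \<in> adjacent"
proof (induction rule: adjacent.induct)
  case (transp g i)
  have "FOp.transp i (fst (g \<cdot>\<^sub>F f)) \<cdot>\<^sub>F (g \<cdot>\<^sub>F f) \<in> adjacent"
    using transp adjacent_arr[of f] by (intro adjacent.transp) auto
  then show ?case
    using transp adjacent_arr[of f] by simp
qed simp

lemma adjacent_up: "f \<in> adjacent \<Longrightarrow> up f \<in> adjacent"
proof (induction rule: adjacent.induct)
  case (ide n)
  then show ?case
    using adjacent.ide[of "Suc 0 + n"] by (simp only: FO_sum_ide)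
next
  case (transp f i)
  have "FOp.transp (Suc i) (fst (up f)) \<cdot>\<^sub>F up f \<in> adjacent"
    using transp by (intro adjacent.transp) auto
  then show ?case
    using transp by simp
qed

lemma FO_adjacent: "f \<in> Arr FO \<Longrightarrow> f \<in> adjacent"
proof (induction rule: FO_generated)
  case (swap0 n)
  then show ?case
    using adjacent.transp[OF adjacent.ide[of "Suc (Suc n)"], of 0] by simp
qed (auto intro: adjacent.ide adjacent_comp adjacent_up)

subsection \<open>The additive functor determined by an object\<close>

definition decomp :: "nat \<Rightarrow> nat \<times> (nat \<Rightarrow> nat) \<Rightarrow> nat \<times> nat \<times> (nat \<Rightarrow> nat)" where
  "decomp n f = (SOME (p, g). p \<le> n \<and> g \<in> Arr FO \<and> fst g = n \<and> f = FOp.cyc p n \<cdot>\<^sub>F up g)"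

lemma decomp_eq:
  assumes "p \<le> n" "g \<in> Arr FO" "fst g = n"
  shows "decomp n (FOp.cyc p n \<cdot>\<^sub>F up g) = (p, g)"
  unfolding decomp_def
proof (rule some_equality)
  fix x
  assume *: "case x of (q, h) \<Rightarrow> q \<le> n \<and> h \<in> Arr FO \<and> fst h = n \<and>
    FOp.cyc p n \<cdot>\<^sub>F up g = FOp.cyc q n \<cdot>\<^sub>F up h"
  obtain q h where x: "x = (q, h)"
    by (cases x)
  show "x = (p, g)"
    using * FO_decomp_unique[of p n g q h] assms by (auto simp: x)
qed (use assms in auto)

context pointed_symmetric_monoidal_category
begin

primrec perm_map' :: "nat \<Rightarrow> nat \<times> (nat \<Rightarrow> nat) \<Rightarrow> 'm" where
  "perm_map' 0 f = \<iota> \<I>"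
| "perm_map' (Suc n) f = (case decomp n f of (p, g) \<Rightarrow> cyc p n \<cdot> (\<iota> U \<odot>\<^sub>a perm_map' n g))"

definition perm_map :: "nat \<times> (nat \<Rightarrow> nat) \<Rightarrow> 'm" where
  "perm_map f = perm_map' (fst f) f"

lemma perm_map_0 [simp]: "fst f = 0 \<Longrightarrow> perm_map f = \<iota> \<I>"
  by (simp add: perm_map_def)

lemma perm_map_cyc_up:
  assumes "p \<le> n" "g \<in> Arr FO" "fst g = n"
  shows "perm_map (FOp.cyc p n \<cdot>\<^sub>F up g) = cyc p n \<cdot> (\<iota> U \<odot>\<^sub>a perm_map g)"
  using assms by (simp add: perm_map_def decomp_eq)

lemma perm_map_arr':
  "\<lbrakk>f \<in> Arr FO; fst f = n\<rbrakk> \<Longrightarrow> perm_map f \<in> Arr \<C> \<and> Src \<C> (perm_map f) = pow n \<and> Tgt \<C> (perm_map f) = pow n"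
proof (induction n arbitrary: f)
  case (Suc n)
  obtain p g where *: "p \<le> n" "g \<in> Arr FO" "fst g = n" "f = FOp.cyc p n \<cdot>\<^sub>F up g"
    using Suc.prems by (rule FO_decomp)
  then show ?case
    using Suc.IH[of g] by (simp add: perm_map_cyc_up)
qed simp

lemma perm_map_arr [simp]:
  assumes "f \<in> Arr FO"
  shows "perm_map f \<in> Arr \<C>" "Src \<C> (perm_map f) = pow (fst f)" "Tgt \<C> (perm_map f) = pow (fst f)"
  using perm_map_arr'[OF assms refl] by auto

lemma perm_map_up:
  assumes "f \<in> Arr FO"
  shows "perm_map (up f) = \<iota> U \<odot>\<^sub>a perm_map f"
  using perm_map_cyc_up[of 0 "fst f" f] assms by simp

lemma perm_map_ide [simp]: "perm_map (n, id) = \<iota> (pow n)"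
proof (induction n)
  case (Suc n)
  then show ?case
    using perm_map_up[of "(n, id)"] by (simp add: FO_sum_ide[of "Suc 0" n, simplified])
qed simp

text \<open>
  The relation of \<open>i\<close> to the place \<open>p\<close> of the first element selects one of the four rules for
  transpositions and cycles; the same rule applies to permutations and in the category.
\<close>

lemma perm_map_transp:
  "\<lbrakk>f \<in> Arr FO; fst f = n; Suc i < n\<rbrakk> \<Longrightarrow> perm_map (FOp.transp i n \<cdot>\<^sub>F f) = transp i n \<cdot> perm_map f"
proof (induction n arbitrary: f i)
  case (Suc n)
  obtain p g where *: "p \<le> n" "g \<in> Arr FO" "fst g = n" "f = FOp.cyc p n \<cdot>\<^sub>F up g"
    using Suc.prems(1,2) by (rule FO_decomp)
  have i: "i < n"
    using Suc.prems by simp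
  have f: "perm_map f = cyc p n \<cdot> (\<iota> U \<odot>\<^sub>a perm_map g)"
    using * by (simp add: perm_map_cyc_up)
  have assoc: "FOp.transp i (Suc n) \<cdot>\<^sub>F f = (FOp.transp i (Suc n) \<cdot>\<^sub>F FOp.cyc p n) \<cdot>\<^sub>F up g"
    unfolding *(4) using * i by (intro FO.comp_ass[symmetric]) auto
  have assoc': "transp i (Suc n) \<cdot> perm_map f = (transp i (Suc n) \<cdot> cyc p n) \<cdot> (\<iota> U \<odot>\<^sub>a perm_map g)"
    unfolding f using * i by (intro comp_ass[symmetric]) (auto simp del: transp.simps)
  consider "p = i" | "p = Suc i" | j where "i = Suc j" "p \<le> j" | "Suc i < p"
    by (cases "p < i"; cases i) fastforce+
  then show ?case
  proof cases
    case 1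
    then show ?thesis
      unfolding assoc assoc' using * i
      by (simp add: FOp.transp_cyc transp_cyc perm_map_cyc_up del: FOp.transp.simps transp.simps FOp.cyc.simps cyc.simps)
  next
    case 2
    then show ?thesis
      unfolding assoc assoc' using * i
      by (simp add: FOp.transp_cyc_Suc transp_cyc_Suc perm_map_cyc_up del: FOp.transp.simps transp.simps FOp.cyc.simps cyc.simps)
  next
    case (3 j)
    have "FOp.transp i (Suc n) \<cdot>\<^sub>F f = (FOp.cyc p n \<cdot>\<^sub>F up (FOp.transp j n)) \<cdot>\<^sub>F up g"
      unfolding assoc using 3 i by (simp add: FOp.transp_cyc_less del: FOp.transp.simps)
    also have "\<dots> = FOp.cyc p n \<cdot>\<^sub>F up (FOp.transp j n \<cdot>\<^sub>F g)"
      using 3 i * by simp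
    finally have "perm_map (FOp.transp i (Suc n) \<cdot>\<^sub>F f) = cyc p n \<cdot> (\<iota> U \<odot>\<^sub>a (transp j n \<cdot> perm_map g))"
      using 3 i * Suc.IH[of g j] by (simp add: perm_map_cyc_up)
    also have "\<dots> = (cyc p n \<cdot> (\<iota> U \<odot>\<^sub>a transp j n)) \<cdot> (\<iota> U \<odot>\<^sub>a perm_map g)"
      using 3 i * by simp
    also have "\<dots> = transp i (Suc n) \<cdot> perm_map f"
      unfolding assoc' using 3 i by (simp add: transp_cyc_less del: transp.simps)
    finally show ?thesis .
  next
    case 4
    have "FOp.transp i (Suc n) \<cdot>\<^sub>F f = (FOp.cyc p n \<cdot>\<^sub>F up (FOp.transp i n)) \<cdot>\<^sub>F up g"
      unfolding assoc using 4 * by (simp add: FOp.transp_cyc_greater del: FOp.transp.simps)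
    also have "\<dots> = FOp.cyc p n \<cdot>\<^sub>F up (FOp.transp i n \<cdot>\<^sub>F g)"
      using 4 * by simp
    finally have "perm_map (FOp.transp i (Suc n) \<cdot>\<^sub>F f) = cyc p n \<cdot> (\<iota> U \<odot>\<^sub>a (transp i n \<cdot> perm_map g))"
      using 4 * Suc.IH[of g i] by (simp add: perm_map_cyc_up)
    also have "\<dots> = (cyc p n \<cdot> (\<iota> U \<odot>\<^sub>a transp i n)) \<cdot> (\<iota> U \<odot>\<^sub>a perm_map g)"
      using 4 * by simp
    also have "\<dots> = transp i (Suc n) \<cdot> perm_map f"
      unfolding assoc' using 4 * by (simp add: transp_cyc_greater del: transp.simps)
    finally show ?thesis .
  qed
qed simp

text \<open>
  The left factors that satisfy this are closed under multiplication by adjacent transpositions.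
\<close>

lemma perm_map_comp:
  assumes "f \<in> Arr FO" "g \<in> Arr FO" "fst g = fst f"
  shows "perm_map (g \<cdot>\<^sub>F f) = perm_map g \<cdot> perm_map f"
proof -
  have "fst g = fst f \<longrightarrow> perm_map (g \<cdot>\<^sub>F f) = perm_map g \<cdot> perm_map f"
    using FO_adjacent[OF assms(2)]
  proof (induction rule: adjacent.induct)
    case (transp g i)
    show ?case
    proof
      assume "fst (FOp.transp i (fst g) \<cdot>\<^sub>F g) = fst f"
      then have e: "fst g = fst f"
        by simp
      have "perm_map ((FOp.transp i (fst g) \<cdot>\<^sub>F g) \<cdot>\<^sub>F f) = perm_map (FOp.transp i (fst g) \<cdot>\<^sub>F (g \<cdot>\<^sub>F f))"
        using transp e assms(1) by (subst FO.comp_ass) auto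
      also have "\<dots> = transp i (fst g) \<cdot> perm_map g \<cdot> perm_map f"
        using transp e assms(1) perm_map_transp[of "g \<cdot>\<^sub>F f" "fst g" i] by simp
      also have "\<dots> = perm_map (FOp.transp i (fst g) \<cdot>\<^sub>F g) \<cdot> perm_map f"
        using transp e assms(1) perm_map_transp[of g "fst g" i] by simp
      finally show "perm_map ((FOp.transp i (fst g) \<cdot>\<^sub>F g) \<cdot>\<^sub>F f)
        = perm_map (FOp.transp i (fst g) \<cdot>\<^sub>F g) \<cdot> perm_map f" .
    qed
  qed (use assms in simp)
  then show ?thesis
    using assms(3) by simp
qed

lemma perm_map_iso:
  assumes "f \<in> Arr FO"
  shows "is_iso \<C> (perm_map f)"
proof (rule isoI)
  have i: "is_iso FO f"
    by (rule FO_iso[OF assms])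
  let ?g = "arr_inv FO f"
  have g: "?g \<in> Arr FO" "fst ?g = fst f" "?g \<cdot>\<^sub>F f = (fst f, id)" "f \<cdot>\<^sub>F ?g = (fst f, id)"
    using FO.inv_facts[OF i] by auto
  show "perm_map ?g \<cdot> perm_map f = \<iota> (Src \<C> (perm_map f))" "perm_map f \<cdot> perm_map ?g = \<iota> (Tgt \<C> (perm_map f))"
    using perm_map_comp[of f ?g] perm_map_comp[of ?g f] assms g by auto
qed (use assms FO.inv_facts[OF FO_iso[OF assms]] in auto)

lemma perm_map_swap0: "perm_map (swap0 n) = twist U U (pow n)"
  using perm_map_transp[of "(Suc (Suc n), id)" "Suc (Suc n)" 0] by simp

subsection \<open>Its monoidal structure\<close>

primrec merge :: "nat \<Rightarrow> nat \<Rightarrow> 'm" where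
  "merge 0 n = lunit \<C> (pow n)"
| "merge (Suc m) n = (\<iota> U \<odot>\<^sub>a merge m n) \<cdot> assoc \<C> U (pow m) (pow n)"

lemma merge_arr' :
  "merge m n \<in> Arr \<C> \<and> Src \<C> (merge m n) = pow m \<odot> pow n \<and> Tgt \<C> (merge m n) = pow (m + n) \<and> is_iso \<C> (merge m n)"
  by (induction m) simp_all

lemma merge_arr [simp]:
  "merge m n \<in> Arr \<C>" "Src \<C> (merge m n) = pow m \<odot> pow n" "Tgt \<C> (merge m n) = pow (m + n)" "is_iso \<C> (merge m n)"
  using merge_arr' by auto

lemma merge_natural_right:
  assumes [simp]: "g \<in> Arr FO"
  shows "merge m (fst g) \<cdot> (\<iota> (pow m) \<odot>\<^sub>a perm_map g) = perm_map ((m, id) \<oplus>\<^sub>F g) \<cdot> merge m (fst g)"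
proof (induction m)
  case 0
  show ?case
    using lunit_natural[of "perm_map g"] by (simp add: FO_sum_zero)
next
  case (Suc m)
  have e: "(Suc m, id) \<oplus>\<^sub>F g = up ((m, id) \<oplus>\<^sub>F g)"
    using FO_sum_assoc[of "(Suc 0, id)" "(m, id)" g] FO_sum_ide[of "Suc 0" m] by simp
  have "merge (Suc m) (fst g) \<cdot> (\<iota> (pow (Suc m)) \<odot>\<^sub>a perm_map g)
      = (\<iota> U \<odot>\<^sub>a merge m (fst g)) \<cdot> (assoc \<C> U (pow m) (pow (fst g)) \<cdot> ((\<iota> U \<odot>\<^sub>a \<iota> (pow m)) \<odot>\<^sub>a perm_map g))"
    by simp
  also have "\<dots> = ((\<iota> U \<odot>\<^sub>a merge m (fst g)) \<cdot> (\<iota> U \<odot>\<^sub>a (\<iota> (pow m) \<odot>\<^sub>a perm_map g))) \<cdot> assoc \<C> U (pow m) (pow (fst g))"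
    using assoc_natural[of "\<iota> U" "\<iota> (pow m)" "perm_map g" U "pow m" "pow (fst g)"] by simp
  also have "\<dots> = perm_map ((Suc m, id) \<oplus>\<^sub>F g) \<cdot> merge (Suc m) (fst g)"
    unfolding e by (simp add: Suc.IH perm_map_up)
  finally show ?case .
qed

text \<open>
  Checked on generators; the transposition is \<open>twist_tensor\<close>.
\<close>

lemma merge_natural_left:
  "f \<in> Arr FO \<Longrightarrow> merge (fst f) n \<cdot> (perm_map f \<odot>\<^sub>a \<iota> (pow n)) = perm_map (f \<oplus>\<^sub>F (n, id)) \<cdot> merge (fst f) n"
proof (induction rule: FO_generated)
  case (comp f g)
  let ?I = "\<iota> (pow n)"
  have e: "(g \<cdot>\<^sub>F f) \<oplus>\<^sub>F (n, id) = (g \<oplus>\<^sub>F (n, id)) \<cdot>\<^sub>F (f \<oplus>\<^sub>F (n, id))"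
    using comp FO_sum_comp[of f g "(n, id)" "(n, id)"] by simp
  have "merge (fst f) n \<cdot> (perm_map (g \<cdot>\<^sub>F f) \<odot>\<^sub>a ?I)
      = (merge (fst g) n \<cdot> (perm_map g \<odot>\<^sub>a ?I)) \<cdot> (perm_map f \<odot>\<^sub>a ?I)"
    using comp(1-3) by (simp add: perm_map_comp)
  also have "\<dots> = (perm_map (g \<oplus>\<^sub>F (n, id)) \<cdot> merge (fst g) n) \<cdot> (perm_map f \<odot>\<^sub>a ?I)"
    using comp by (simp only: fold_id)
  also have "\<dots> = perm_map (g \<oplus>\<^sub>F (n, id)) \<cdot> (merge (fst f) n \<cdot> (perm_map f \<odot>\<^sub>a ?I))"
    using comp by simp
  also have "\<dots> = perm_map ((g \<cdot>\<^sub>F f) \<oplus>\<^sub>F (n, id)) \<cdot> merge (fst f) n"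
    unfolding e using comp by (simp add: perm_map_comp del: FOp.interchange)
  finally show ?case
    by simp
next
  case (up f)
  have e: "up f \<oplus>\<^sub>F (n, id) = up (f \<oplus>\<^sub>F (n, id))"
    using up FO_sum_assoc[of "(Suc 0, id)" f "(n, id)"] by simp
  have "merge (fst (up f)) n \<cdot> (perm_map (up f) \<odot>\<^sub>a \<iota> (pow n))
      = (\<iota> U \<odot>\<^sub>a merge (fst f) n) \<cdot> (assoc \<C> U (pow (fst f)) (pow n) \<cdot> ((\<iota> U \<odot>\<^sub>a perm_map f) \<odot>\<^sub>a \<iota> (pow n)))"
    using up by (simp add: perm_map_up)
  also have "\<dots> = ((\<iota> U \<odot>\<^sub>a merge (fst f) n) \<cdot> (\<iota> U \<odot>\<^sub>a (perm_map f \<odot>\<^sub>a \<iota> (pow n)))) \<cdot> assoc \<C> U (pow (fst f)) (pow n)"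
    using up assoc_natural[of "\<iota> U" "perm_map f" "\<iota> (pow n)" U "pow (fst f)" "pow n"] by simp
  also have "\<dots> = perm_map (up f \<oplus>\<^sub>F (n, id)) \<cdot> merge (fst (up f)) n"
    unfolding e using up by (simp add: perm_map_up)
  finally show ?case .
next
  case (swap0 m)
  have e: "swap0 m \<oplus>\<^sub>F (n, id) = swap0 (m + n)"
    by (simp add: FO_sum_assoc)
  let ?a = "(\<iota> U \<odot>\<^sub>a assoc \<C> U (pow m) (pow n)) \<cdot> assoc \<C> U (U \<odot> pow m) (pow n)"
  have "merge (fst (swap0 m)) n \<cdot> (perm_map (swap0 m) \<odot>\<^sub>a \<iota> (pow n))
      = (\<iota> U \<odot>\<^sub>a (\<iota> U \<odot>\<^sub>a merge m n)) \<cdot> ?a \<cdot> (twist U U (pow m) \<odot>\<^sub>a \<iota> (pow n))"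
    by (simp add: perm_map_swap0)
  also have "\<dots> = (\<iota> U \<odot>\<^sub>a (\<iota> U \<odot>\<^sub>a merge m n)) \<cdot> twist U U (pow m \<odot> pow n) \<cdot> ?a"
    using twist_tensor[of U U "pow m" "pow n"] by (simp del: interchange_assoc)
  also have "\<dots> = (twist U U (pow (m + n)) \<cdot> (\<iota> U \<odot>\<^sub>a (\<iota> U \<odot>\<^sub>a merge m n))) \<cdot> ?a"
    using twist_natural[of "\<iota> U" "\<iota> U" "merge m n" U U "pow (m + n)"] by (simp del: interchange_assoc)
  also have "\<dots> = perm_map (swap0 m \<oplus>\<^sub>F (n, id)) \<cdot> merge (fst (swap0 m)) n"
    unfolding e by (simp add: perm_map_swap0)
  finally show ?case .
qed simp

lemma merge_natural:
  assumes [simp]: "f \<in> Arr FO" "g \<in> Arr FO"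
  shows "merge (fst f) (fst g) \<cdot> (perm_map f \<odot>\<^sub>a perm_map g) = perm_map (f \<oplus>\<^sub>F g) \<cdot> merge (fst f) (fst g)"
proof -
  let ?m = "fst f" and ?n = "fst g"
  have "merge ?m ?n \<cdot> (perm_map f \<odot>\<^sub>a perm_map g)
      = (merge ?m ?n \<cdot> (perm_map f \<odot>\<^sub>a \<iota> (pow ?n))) \<cdot> (\<iota> (pow ?m) \<odot>\<^sub>a perm_map g)"
    by simp
  also have "\<dots> = perm_map (f \<oplus>\<^sub>F (?n, id)) \<cdot> (merge ?m ?n \<cdot> (\<iota> (pow ?m) \<odot>\<^sub>a perm_map g))"
    by (simp add: merge_natural_left)
  also have "\<dots> = perm_map ((f \<oplus>\<^sub>F (?n, id)) \<cdot>\<^sub>F ((?m, id) \<oplus>\<^sub>F g)) \<cdot> merge ?m ?n"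
    by (simp add: merge_natural_right perm_map_comp del: FOp.interchange)
  also have "(f \<oplus>\<^sub>F (?n, id)) \<cdot>\<^sub>F ((?m, id) \<oplus>\<^sub>F g) = f \<oplus>\<^sub>F g"
    using FO_sum_comp[of "(?m, id)" f g "(?n, id)"] by simp
  finally show ?thesis .
qed

text \<open>
  Both sides only move brackets: the step is a pentagon, the base case a unit identity.
\<close>

lemma merge_assoc:
  "merge (m + n) p \<cdot> (merge m n \<odot>\<^sub>a \<iota> (pow p))
 = merge m (n + p) \<cdot> (\<iota> (pow m) \<odot>\<^sub>a merge n p) \<cdot> assoc \<C> (pow m) (pow n) (pow p)"
proof (induction m)
  case 0
  show ?case
    using reassoc[OF lunit_natural[of "merge n p" "pow (n + p)"], of "assoc \<C> \<I> (pow n) (pow p)"]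
    by (simp add: lunit_tensor)
next
  case (Suc m)
  let ?m = "pow m" and ?n = "pow n" and ?p = "pow p"
  have "merge (Suc m + n) p \<cdot> (merge (Suc m) n \<odot>\<^sub>a \<iota> ?p)
      = (\<iota> U \<odot>\<^sub>a merge (m + n) p) \<cdot> (assoc \<C> U (pow (m + n)) ?p \<cdot> ((\<iota> U \<odot>\<^sub>a merge m n) \<odot>\<^sub>a \<iota> ?p)) \<cdot> (assoc \<C> U ?m ?n \<odot>\<^sub>a \<iota> ?p)"
    by simp
  also have "\<dots> = (\<iota> U \<odot>\<^sub>a (merge (m + n) p \<cdot> (merge m n \<odot>\<^sub>a \<iota> ?p))) \<cdot> assoc \<C> U (?m \<odot> ?n) ?p \<cdot> (assoc \<C> U ?m ?n \<odot>\<^sub>a \<iota> ?p)"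
    using assoc_natural[of "\<iota> U" "merge m n" "\<iota> ?p" U "pow (m + n)" ?p] by (simp del: interchange)
  also have "\<dots> = (\<iota> U \<odot>\<^sub>a merge m (n + p)) \<cdot> (\<iota> U \<odot>\<^sub>a (\<iota> ?m \<odot>\<^sub>a merge n p)) \<cdot> (\<iota> U \<odot>\<^sub>a assoc \<C> ?m ?n ?p) \<cdot> assoc \<C> U (?m \<odot> ?n) ?p \<cdot> (assoc \<C> U ?m ?n \<odot>\<^sub>a \<iota> ?p)"
    by (simp add: Suc.IH)
  also have "\<dots> = (\<iota> U \<odot>\<^sub>a merge m (n + p)) \<cdot> ((\<iota> U \<odot>\<^sub>a (\<iota> ?m \<odot>\<^sub>a merge n p)) \<cdot> assoc \<C> U ?m (?n \<odot> ?p)) \<cdot> assoc \<C> (U \<odot> ?m) ?n ?p"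
    using pentagon[of U ?m ?n ?p] by (simp del: interchange interchange_assoc)
  also have "\<dots> = (\<iota> U \<odot>\<^sub>a merge m (n + p)) \<cdot> (assoc \<C> U ?m (pow (n + p)) \<cdot> ((\<iota> U \<odot>\<^sub>a \<iota> ?m) \<odot>\<^sub>a merge n p)) \<cdot> assoc \<C> (U \<odot> ?m) ?n ?p"
    using assoc_natural[of "\<iota> U" "\<iota> ?m" "merge n p" U ?m "pow (n + p)"] by (simp del: interchange interchange_assoc)
  also have "\<dots> = merge (Suc m) (n + p) \<cdot> (\<iota> (pow (Suc m)) \<odot>\<^sub>a merge n p) \<cdot> assoc \<C> (pow (Suc m)) ?n ?p"
    by simp
  finally show ?case .
qed

lemma merge_runit: "merge m 0 = runit \<C> (pow m)"
  by (induction m) (simp_all add: lunit_unit runit_tensor)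

end

context pointed_symmetric_monoidal_category
begin

lemma merge_nat:
  assumes "f \<in> Arr FO" "g \<in> Arr FO" "fst f = m" "fst g = n"
  shows "merge m n \<cdot> (perm_map f \<odot>\<^sub>a perm_map g) = perm_map (f \<oplus>\<^sub>F g) \<cdot> merge m n"
  using merge_natural[of f g] assms by simp

text \<open>
  By the hexagon, the pairs for which \<open>merge\<close> is compatible with the braiding are closed under addition in
  the second argument, and by symmetry they are closed under interchange. Thus only sums with
  \<open>0\<close> and the pair \<open>(1, 1)\<close> have to be checked.
\<close>

definition merge_braided :: "nat \<Rightarrow> nat \<Rightarrow> bool" where
  "merge_braided m n \<longleftrightarrow> perm_map (\<zeta>\<^sub>F m n) \<cdot> merge m n = merge n m \<cdot> braid \<C> (pow m) (pow n)"

lemma merge_braided_sum: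
  assumes mn: "merge_braided m n" and mp: "merge_braided m p"
  shows "merge_braided m (n + p)"
proof -
  let ?m = "pow m" and ?n = "pow n" and ?p = "pow p"
  let ?z = "\<zeta>\<^sub>F m n" and ?y = "\<zeta>\<^sub>F m p"
  let ?k = "(\<iota> ?m \<odot>\<^sub>a merge n p) \<cdot> assoc \<C> ?m ?n ?p"
  let ?b = "braid \<C> ?m ?n \<odot>\<^sub>a \<iota> ?p"
  have e: "perm_map (\<zeta>\<^sub>F m (n + p)) = perm_map ((n, id) \<oplus>\<^sub>F ?y) \<cdot> perm_map (?z \<oplus>\<^sub>F (p, id))"
    unfolding FO_sum_braid_sum by (rule perm_map_comp) auto
  have n1: "perm_map (?z \<oplus>\<^sub>F (p, id)) \<cdot> merge (m + n) p = merge (n + m) p \<cdot> (perm_map ?z \<odot>\<^sub>a \<iota> ?p)"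
    using merge_nat[of ?z "(p, id)" "n + m" p] by (simp add: add.commute[of n m])
  have n2: "perm_map ((n, id) \<oplus>\<^sub>F ?y) \<cdot> merge n (m + p) = merge n (p + m) \<cdot> (\<iota> ?n \<odot>\<^sub>a perm_map ?y)"
    using merge_nat[of "(n, id)" ?y n "m + p"] by (simp add: add.commute[of p m])
  have mn': "perm_map ?z \<cdot> merge m n = merge n m \<cdot> braid \<C> ?m ?n"
    and mp': "perm_map ?y \<cdot> merge m p = merge p m \<cdot> braid \<C> ?m ?p"
    using mn mp by (auto simp: merge_braided_def)
  have [simp]: "n + m = m + n" "p + m = m + p" "n + (m + p) = m + (n + p)" "n + p + m = m + (n + p)"
    by auto
  have "(perm_map (\<zeta>\<^sub>F m (n + p)) \<cdot> merge m (n + p)) \<cdot> ?k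
      = perm_map ((n, id) \<oplus>\<^sub>F ?y) \<cdot> perm_map (?z \<oplus>\<^sub>F (p, id)) \<cdot> (merge m (n + p) \<cdot> ?k)"
    by (simp add: e add.assoc)
  also have "\<dots> = perm_map ((n, id) \<oplus>\<^sub>F ?y) \<cdot> (perm_map (?z \<oplus>\<^sub>F (p, id)) \<cdot> merge (m + n) p) \<cdot> (merge m n \<odot>\<^sub>a \<iota> ?p)"
    by (simp only: merge_assoc[symmetric]) (simp add: add.assoc)
  also have "\<dots> = perm_map ((n, id) \<oplus>\<^sub>F ?y) \<cdot> merge (n + m) p \<cdot> ((perm_map ?z \<cdot> merge m n) \<odot>\<^sub>a \<iota> ?p)"
    by (simp only: n1) (simp add: add.assoc)
  also have "\<dots> = perm_map ((n, id) \<oplus>\<^sub>F ?y) \<cdot> (merge (n + m) p \<cdot> (merge n m \<odot>\<^sub>a \<iota> ?p)) \<cdot> ?b"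
    by (simp only: mn') (simp add: add.assoc)
  also have "\<dots> = (perm_map ((n, id) \<oplus>\<^sub>F ?y) \<cdot> merge n (m + p)) \<cdot> (\<iota> ?n \<odot>\<^sub>a merge m p) \<cdot> assoc \<C> ?n ?m ?p \<cdot> ?b"
    by (simp only: merge_assoc) (simp add: add.assoc)
  also have "\<dots> = merge n (p + m) \<cdot> (\<iota> ?n \<odot>\<^sub>a (perm_map ?y \<cdot> merge m p)) \<cdot> assoc \<C> ?n ?m ?p \<cdot> ?b"
    by (simp only: n2) (simp add: add.assoc)
  also have "\<dots> = merge n (p + m) \<cdot> (\<iota> ?n \<odot>\<^sub>a merge p m) \<cdot> ((\<iota> ?n \<odot>\<^sub>a braid \<C> ?m ?p) \<cdot> assoc \<C> ?n ?m ?p \<cdot> ?b)"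
    by (simp only: mp') (simp add: add.assoc)
  also have "\<dots> = (merge n (p + m) \<cdot> (\<iota> ?n \<odot>\<^sub>a merge p m) \<cdot> assoc \<C> ?n ?p ?m) \<cdot> braid \<C> ?m (?n \<odot> ?p) \<cdot> assoc \<C> ?m ?n ?p"
    by (simp only: hexagon1[symmetric] pow_ob) (simp add: add.assoc)
  also have "\<dots> = merge (n + p) m \<cdot> ((merge n p \<odot>\<^sub>a \<iota> ?m) \<cdot> braid \<C> ?m (?n \<odot> ?p)) \<cdot> assoc \<C> ?m ?n ?p"
    by (simp only: merge_assoc[symmetric]) (simp add: add.assoc)
  also have "\<dots> = merge (n + p) m \<cdot> (braid \<C> ?m (pow (n + p)) \<cdot> (\<iota> ?m \<odot>\<^sub>a merge n p)) \<cdot> assoc \<C> ?m ?n ?p"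
    using braid_natural[of "\<iota> ?m" "merge n p" ?m "pow (n + p)"] by simp
  finally have "(perm_map (\<zeta>\<^sub>F m (n + p)) \<cdot> merge m (n + p)) \<cdot> ?k
      = (merge (n + p) m \<cdot> braid \<C> ?m (pow (n + p))) \<cdot> ?k"
    by simp
  then show ?thesis
    unfolding merge_braided_def by (rule iso_cancel_right) (simp_all add: ac_simps)
qed

lemma merge_braided_sym:
  assumes "merge_braided m n"
  shows "merge_braided n m"
proof -
  let ?z = "\<zeta>\<^sub>F m n" and ?y = "\<zeta>\<^sub>F n m"
  have [simp]: "n + m = m + n"
    by simp
  have "merge n m = (merge n m \<cdot> braid \<C> (pow m) (pow n)) \<cdot> braid \<C> (pow n) (pow m)"
    by simp
  also have "\<dots> = perm_map ?z \<cdot> merge m n \<cdot> braid \<C> (pow n) (pow m)"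
    using assms[unfolded merge_braided_def, symmetric] by simp
  finally have "perm_map ?y \<cdot> merge n m = (perm_map ?y \<cdot> perm_map ?z) \<cdot> merge m n \<cdot> braid \<C> (pow n) (pow m)"
    by simp
  also have "perm_map ?y \<cdot> perm_map ?z = perm_map (?y \<cdot>\<^sub>F ?z)"
    by (rule perm_map_comp[symmetric]) auto
  finally show ?thesis
    by (simp add: FO_sum_symmetry merge_braided_def)
qed

lemma merge_braided_zero: "merge_braided m 0"
proof -
  have "\<zeta>\<^sub>F m 0 = (m, id)"
    by (rule FO_eqI) auto
  then show ?thesis
    by (simp add: merge_braided_def merge_runit lunit_braid)
qed

lemma merge_braided_one: "merge_braided 1 1"
proof -
  let ?r = "runit \<C> U" and ?V = "U \<odot> \<I>"
  have m: "merge 1 1 = ?r \<odot>\<^sub>a \<iota> ?V"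
    using triangle[of U ?V] by simp
  have z: "perm_map (\<zeta>\<^sub>F 1 1) = twist U U \<I>"
    using perm_map_swap0[of 0] by (simp add: FO_sum_zero)
  have "(\<iota> U \<odot>\<^sub>a ?r) \<cdot> twist U U \<I> = (runit \<C> (U \<odot> U) \<cdot> (braid \<C> U U \<odot>\<^sub>a \<iota> \<I>)) \<cdot> arr_inv \<C> (assoc \<C> U U \<I>)"
    by (simp add: twist_def runit_tensor[symmetric])
  also have "\<dots> = braid \<C> U U \<cdot> (runit \<C> (U \<odot> U) \<cdot> arr_inv \<C> (assoc \<C> U U \<I>))"
    using runit_natural[of "braid \<C> U U"] by simp
  also have "\<dots> = braid \<C> U U \<cdot> (\<iota> U \<odot>\<^sub>a ?r)"
    by (simp add: runit_tensor[symmetric])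
  finally have t: "(\<iota> U \<odot>\<^sub>a ?r) \<cdot> twist U U \<I> = braid \<C> U U \<cdot> (\<iota> U \<odot>\<^sub>a ?r)" .
  have "(\<iota> U \<odot>\<^sub>a ?r) \<cdot> (twist U U \<I> \<cdot> (?r \<odot>\<^sub>a \<iota> ?V)) = ((\<iota> U \<odot>\<^sub>a ?r) \<cdot> twist U U \<I>) \<cdot> (?r \<odot>\<^sub>a \<iota> ?V)"
    by simp
  also have "\<dots> = braid \<C> U U \<cdot> (?r \<odot>\<^sub>a ?r)"
    unfolding t by simp
  also have "\<dots> = (?r \<odot>\<^sub>a ?r) \<cdot> braid \<C> ?V ?V"
    using braid_natural[of ?r ?r U U] by simp
  also have "\<dots> = (\<iota> U \<odot>\<^sub>a ?r) \<cdot> ((?r \<odot>\<^sub>a \<iota> ?V) \<cdot> braid \<C> ?V ?V)"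
    by simp
  finally have "twist U U \<I> \<cdot> (?r \<odot>\<^sub>a \<iota> ?V) = (?r \<odot>\<^sub>a \<iota> ?V) \<cdot> braid \<C> ?V ?V"
    by (rule iso_cancel_left) simp_all
  then show ?thesis
    unfolding merge_braided_def z m by simp
qed

lemma merge_braid: "perm_map (\<zeta>\<^sub>F m n) \<cdot> merge m n = merge n m \<cdot> braid \<C> (pow m) (pow n)"
proof -
  have 1: "merge_braided 1 n" for n
  proof (induction n)
    case (Suc n)
    then show ?case
      using merge_braided_sum[OF merge_braided_one, of n] by simp
  qed (rule merge_braided_zero)
  have "merge_braided m n" for n
  proof (induction n)
    case (Suc n)
    then show ?case
      using merge_braided_sum[OF merge_braided_sym[OF 1], of m n] by simp
  qed (rule merge_braided_zero)
  then show ?thesis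
    by (simp add: merge_braided_def)
qed

end

context pointed_symmetric_monoidal_category
begin

lemma middle_exchange_twist:
  assumes [simp]: "A \<in> Obj \<C>" "B \<in> Obj \<C>" "C \<in> Obj \<C>" "D \<in> Obj \<C>"
  shows "middle_exchange \<C> A B C D
       = arr_inv \<C> (assoc \<C> A C (B \<odot> D)) \<cdot> (\<iota> A \<odot>\<^sub>a twist B C D) \<cdot> assoc \<C> A B (C \<odot> D)"
  by (simp add: middle_exchange_def twist_def)

lemma middle_exchange_arr [simp]:
  assumes [simp]: "A \<in> Obj \<C>" "B \<in> Obj \<C>" "C \<in> Obj \<C>" "D \<in> Obj \<C>"
  shows "middle_exchange \<C> A B C D \<in> Arr \<C>" "Src \<C> (middle_exchange \<C> A B C D) = (A \<odot> B) \<odot> (C \<odot> D)"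
    "Tgt \<C> (middle_exchange \<C> A B C D) = (A \<odot> C) \<odot> (B \<odot> D)"
  by (simp_all add: middle_exchange_twist)

lemma middle_exchange_natural:
  assumes [simp]: "f \<in> Arr \<C>" "g \<in> Arr \<C>" "h \<in> Arr \<C>" "k \<in> Arr \<C>"
    and t: "A = Tgt \<C> f" "B = Tgt \<C> g" "C = Tgt \<C> h" "D = Tgt \<C> k"
  shows "middle_exchange \<C> A B C D \<cdot> ((f \<odot>\<^sub>a g) \<odot>\<^sub>a (h \<odot>\<^sub>a k))
       = ((f \<odot>\<^sub>a h) \<odot>\<^sub>a (g \<odot>\<^sub>a k)) \<cdot> middle_exchange \<C> (Src \<C> f) (Src \<C> g) (Src \<C> h) (Src \<C> k)"
proof -
  let ?b = "assoc \<C> A C (B \<odot> D)" and ?b' = "assoc \<C> (Src \<C> f) (Src \<C> h) (Src \<C> g \<odot> Src \<C> k)"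
  let ?a' = "assoc \<C> (Src \<C> f) (Src \<C> g) (Src \<C> h \<odot> Src \<C> k)"
  let ?t = "twist B C D" and ?t' = "twist (Src \<C> g) (Src \<C> h) (Src \<C> k)"
  have [simp]: "A \<in> Obj \<C>" "B \<in> Obj \<C>" "C \<in> Obj \<C>" "D \<in> Obj \<C>"
    by (simp_all add: t)
  have "?b \<cdot> (middle_exchange \<C> A B C D \<cdot> ((f \<odot>\<^sub>a g) \<odot>\<^sub>a (h \<odot>\<^sub>a k)))
      = (\<iota> A \<odot>\<^sub>a ?t) \<cdot> (assoc \<C> A B (C \<odot> D) \<cdot> ((f \<odot>\<^sub>a g) \<odot>\<^sub>a (h \<odot>\<^sub>a k)))"
    by (simp add: middle_exchange_twist t)
  also have "\<dots> = (\<iota> A \<odot>\<^sub>a ?t) \<cdot> (f \<odot>\<^sub>a (g \<odot>\<^sub>a (h \<odot>\<^sub>a k))) \<cdot> ?a'"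
    using assoc_natural[of f g "h \<odot>\<^sub>a k"] by (simp add: t)
  also have "\<dots> = (f \<odot>\<^sub>a (?t \<cdot> (g \<odot>\<^sub>a (h \<odot>\<^sub>a k)))) \<cdot> ?a'"
    by (simp add: t)
  also have "\<dots> = (f \<odot>\<^sub>a ((h \<odot>\<^sub>a (g \<odot>\<^sub>a k)) \<cdot> ?t')) \<cdot> ?a'"
    by (simp only: twist_natural assms(1-4) t)
  also have "\<dots> = (f \<odot>\<^sub>a (h \<odot>\<^sub>a (g \<odot>\<^sub>a k))) \<cdot> (\<iota> (Src \<C> f) \<odot>\<^sub>a ?t') \<cdot> ?a'"
    by simp
  also have "\<dots> = ((f \<odot>\<^sub>a (h \<odot>\<^sub>a (g \<odot>\<^sub>a k))) \<cdot> ?b') \<cdot> middle_exchange \<C> (Src \<C> f) (Src \<C> g) (Src \<C> h) (Src \<C> k)"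
    by (simp add: middle_exchange_twist del: interchange interchange_assoc)
  also have "\<dots> = ?b \<cdot> ((f \<odot>\<^sub>a h) \<odot>\<^sub>a (g \<odot>\<^sub>a k)) \<cdot> middle_exchange \<C> (Src \<C> f) (Src \<C> g) (Src \<C> h) (Src \<C> k)"
    using assoc_natural[of f h "g \<odot>\<^sub>a k", symmetric] by (simp add: t)
  finally show ?thesis
    by (rule iso_cancel_left) (simp_all add: t)
qed

text \<open>
  The next two lemmas extend compatibility with the braiding to the exchange of the two middle
  summands, which occurs in the axiom relating left and right distributivity.
\<close>

lemma merge_twist:
  "perm_map (\<zeta>\<^sub>F b c \<oplus>\<^sub>F (d, id)) \<cdot> merge b (c + d) \<cdot> (\<iota> (pow b) \<odot>\<^sub>a merge c d)
 = merge c (b + d) \<cdot> (\<iota> (pow c) \<odot>\<^sub>a merge b d) \<cdot> twist (pow b) (pow c) (pow d)"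
proof -
  let ?b = "pow b" and ?c = "pow c" and ?d = "pow d"
  let ?z = "\<zeta>\<^sub>F b c" and ?k = "assoc \<C> (pow b) (pow c) (pow d)"
  let ?P = "perm_map (?z \<oplus>\<^sub>F (d, id))"
  have [simp]: "c + b = b + c" "c + (b + d) = b + (c + d)" "b + c + d = b + (c + d)"
    by auto
  have n: "?P \<cdot> merge (b + c) d = merge (c + b) d \<cdot> (perm_map ?z \<odot>\<^sub>a \<iota> ?d)"
    using merge_nat[of ?z "(d, id)" "b + c" d] by simp
  have "(?P \<cdot> merge b (c + d) \<cdot> (\<iota> ?b \<odot>\<^sub>a merge c d)) \<cdot> ?k
      = ?P \<cdot> (merge b (c + d) \<cdot> (\<iota> ?b \<odot>\<^sub>a merge c d) \<cdot> ?k)"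
    by simp
  also have "\<dots> = (?P \<cdot> merge (b + c) d) \<cdot> (merge b c \<odot>\<^sub>a \<iota> ?d)"
    by (simp only: merge_assoc[symmetric]) simp
  also have "\<dots> = merge (c + b) d \<cdot> ((perm_map ?z \<cdot> merge b c) \<odot>\<^sub>a \<iota> ?d)"
    unfolding n by simp
  also have "\<dots> = (merge (c + b) d \<cdot> (merge c b \<odot>\<^sub>a \<iota> ?d)) \<cdot> (braid \<C> ?b ?c \<odot>\<^sub>a \<iota> ?d)"
    unfolding merge_braid by simp
  also have "\<dots> = merge c (b + d) \<cdot> (\<iota> ?c \<odot>\<^sub>a merge b d) \<cdot> (assoc \<C> ?c ?b ?d \<cdot> (braid \<C> ?b ?c \<odot>\<^sub>a \<iota> ?d))"
    unfolding merge_assoc by simp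
  also have "\<dots> = (merge c (b + d) \<cdot> (\<iota> ?c \<odot>\<^sub>a merge b d) \<cdot> twist ?b ?c ?d) \<cdot> ?k"
    by (simp add: twist_assoc)
  finally show ?thesis
    by (rule iso_cancel_right) simp_all
qed

lemma merge_middle_exchange:
  "perm_map (middle_exchange (additive FO) a b c d) \<cdot> merge (a + b) (c + d) \<cdot> (merge a b \<odot>\<^sub>a merge c d)
 = merge (a + c) (b + d) \<cdot> (merge a c \<odot>\<^sub>a merge b d) \<cdot> middle_exchange \<C> (pow a) (pow b) (pow c) (pow d)"
proof -
  let ?a = "pow a" and ?b = "pow b" and ?c = "pow c" and ?d = "pow d"
  let ?y = "\<zeta>\<^sub>F b c \<oplus>\<^sub>F (d, id)"
  let ?P = "perm_map ((a, id) \<oplus>\<^sub>F ?y)"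
  have unfold: "merge (i + j) (k + l) \<cdot> (merge i j \<odot>\<^sub>a merge k l)
      = merge i (j + (k + l)) \<cdot> (\<iota> (pow i) \<odot>\<^sub>a (merge j (k + l) \<cdot> (\<iota> (pow j) \<odot>\<^sub>a merge k l))) \<cdot> assoc \<C> (pow i) (pow j) (pow k \<odot> pow l)"
    for i j k l
  proof -
    have "merge (i + j) (k + l) \<cdot> (merge i j \<odot>\<^sub>a merge k l)
        = (merge (i + j) (k + l) \<cdot> (merge i j \<odot>\<^sub>a \<iota> (pow (k + l)))) \<cdot> ((\<iota> (pow i) \<odot>\<^sub>a \<iota> (pow j)) \<odot>\<^sub>a merge k l)"
      by simp
    also have "\<dots> = merge i (j + (k + l)) \<cdot> (\<iota> (pow i) \<odot>\<^sub>a merge j (k + l))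
        \<cdot> (assoc \<C> (pow i) (pow j) (pow (k + l)) \<cdot> ((\<iota> (pow i) \<odot>\<^sub>a \<iota> (pow j)) \<odot>\<^sub>a merge k l))"
      unfolding merge_assoc by (simp add: add.assoc)
    also have "\<dots> = merge i (j + (k + l)) \<cdot> (\<iota> (pow i) \<odot>\<^sub>a merge j (k + l))
        \<cdot> ((\<iota> (pow i) \<odot>\<^sub>a (\<iota> (pow j) \<odot>\<^sub>a merge k l)) \<cdot> assoc \<C> (pow i) (pow j) (pow k \<odot> pow l))"
      using assoc_natural[of "\<iota> (pow i)" "\<iota> (pow j)" "merge k l" "pow i" "pow j" "pow (k + l)"]
      by simp
    finally show ?thesis
      by simp
  qed
  have n: "?P \<cdot> merge a (b + (c + d)) = merge a (b + (c + d)) \<cdot> (\<iota> ?a \<odot>\<^sub>a perm_map ?y)"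
    using merge_nat[of "(a, id)" ?y a "b + (c + d)"] by (simp add: add.assoc)
  have [simp]: "c + (b + d) = b + (c + d)" "b + c + d = b + (c + d)" "a + b + (c + d) = a + (b + (c + d))"
    "a + c + (b + d) = a + (b + (c + d))"
    by auto
  have "?P \<cdot> merge (a + b) (c + d) \<cdot> (merge a b \<odot>\<^sub>a merge c d)
      = (?P \<cdot> merge a (b + (c + d))) \<cdot> (\<iota> ?a \<odot>\<^sub>a (merge b (c + d) \<cdot> (\<iota> ?b \<odot>\<^sub>a merge c d))) \<cdot> assoc \<C> ?a ?b (?c \<odot> ?d)"
    unfolding unfold by simp
  also have "\<dots> = merge a (b + (c + d)) \<cdot> (\<iota> ?a \<odot>\<^sub>a (perm_map ?y \<cdot> merge b (c + d) \<cdot> (\<iota> ?b \<odot>\<^sub>a merge c d))) \<cdot> assoc \<C> ?a ?b (?c \<odot> ?d)"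
    unfolding n by simp
  also have "\<dots> = merge a (b + (c + d)) \<cdot> (\<iota> ?a \<odot>\<^sub>a (merge c (b + d) \<cdot> (\<iota> ?c \<odot>\<^sub>a merge b d))) \<cdot> (\<iota> ?a \<odot>\<^sub>a twist ?b ?c ?d) \<cdot> assoc \<C> ?a ?b (?c \<odot> ?d)"
    unfolding merge_twist by simp
  also have "\<dots> = (merge a (c + (b + d)) \<cdot> (\<iota> ?a \<odot>\<^sub>a (merge c (b + d) \<cdot> (\<iota> ?c \<odot>\<^sub>a merge b d))) \<cdot> assoc \<C> ?a ?c (?b \<odot> ?d))
      \<cdot> middle_exchange \<C> ?a ?b ?c ?d"
    by (simp add: middle_exchange_twist del: interchange interchange_assoc)
  also have "\<dots> = merge (a + c) (b + d) \<cdot> (merge a c \<odot>\<^sub>a merge b d) \<cdot> middle_exchange \<C> ?a ?b ?c ?d"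
    unfolding unfold[symmetric] by simp
  finally show ?thesis
    unfolding FO_middle_exchange .
qed

end

section \<open>The canonical functor into a braided bimonoidal category\<close>

context braided_bimonoidal_category
begin

lemma one_obj:
  "\<one> \<in> Obj \<C>"
  using monoidal_category.unit_obj[OF multiplicative_monoidal] by simp

end

sublocale braided_bimonoidal_category \<subseteq> add: pointed_symmetric_monoidal_category "additive \<C>" \<one>
  rewrites "Obj (additive \<C>) = Obj \<C>" and "Arr (additive \<C>) = Arr \<C>" and "Src (additive \<C>) = Src \<C>"
    and "Tgt (additive \<C>) = Tgt \<C>" and "Ide (additive \<C>) = Ide \<C>" and "Comp (additive \<C>) = Comp \<C>"
    and "tensorO (additive \<C>) = sumO \<C>" and "tensorA (additive \<C>) = sumA \<C>"
    and "unitO (additive \<C>) = zeroO \<C>" and "assoc (additive \<C>) = sum_assoc \<C>"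
    and "lunit (additive \<C>) = sum_lunit \<C>" and "runit (additive \<C>) = sum_runit \<C>"
    and "braid (additive \<C>) = sum_braid \<C>" and "is_iso (additive \<C>) = is_iso \<C>"
    and "arr_inv (additive \<C>) = arr_inv \<C>" and "Hom (additive \<C>) = Hom \<C>"
  using additive_symmetric one_obj
  by (auto simp: pointed_symmetric_monoidal_category_def pointed_symmetric_monoidal_category_axioms_def)

sublocale braided_bimonoidal_category \<subseteq> mult: braided_monoidal_category "braided_multiplicative \<C>"
  rewrites "Obj (braided_multiplicative \<C>) = Obj \<C>" and "Arr (braided_multiplicative \<C>) = Arr \<C>"
    and "Src (braided_multiplicative \<C>) = Src \<C>" and "Tgt (braided_multiplicative \<C>) = Tgt \<C>"
    and "Ide (braided_multiplicative \<C>) = Ide \<C>" and "Comp (braided_multiplicative \<C>) = Comp \<C>"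
    and "tensorO (braided_multiplicative \<C>) = prodO \<C>" and "tensorA (braided_multiplicative \<C>) = prodA \<C>"
    and "unitO (braided_multiplicative \<C>) = oneO \<C>" and "assoc (braided_multiplicative \<C>) = prod_assoc \<C>"
    and "lunit (braided_multiplicative \<C>) = prod_lunit \<C>" and "runit (braided_multiplicative \<C>) = prod_runit \<C>"
    and "braid (braided_multiplicative \<C>) = prod_braid \<C>" and "is_iso (braided_multiplicative \<C>) = is_iso \<C>"
    and "arr_inv (braided_multiplicative \<C>) = arr_inv \<C>" and "Hom (braided_multiplicative \<C>) = Hom \<C>"
  using multiplicative_braided by auto

context braided_bimonoidal_category
begin

lemma dist_arr [simp]:
  assumes "A \<in> Obj \<C>" "B \<in> Obj \<C>" "C \<in> Obj \<C>"
  shows "\<delta>\<^sub>l A B C \<in> Arr \<C>" "Src \<C> (\<delta>\<^sub>l A B C) = A \<otimes> (B \<oplus> C)" "Tgt \<C> (\<delta>\<^sub>l A B C) = A \<otimes> B \<oplus> A \<otimes> C"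
    "\<delta>\<^sub>r A B C \<in> Arr \<C>" "Src \<C> (\<delta>\<^sub>r A B C) = (A \<oplus> B) \<otimes> C" "Tgt \<C> (\<delta>\<^sub>r A B C) = A \<otimes> C \<oplus> B \<otimes> C"
  using ldist_hom[OF assms] rdist_hom[OF assms] by (auto simp: hom_iff)

lemma null_arr [simp]:
  assumes "A \<in> Obj \<C>"
  shows "\<Lambda>\<^sub>\<bullet> A \<in> Arr \<C>" "Src \<C> (\<Lambda>\<^sub>\<bullet> A) = \<zero> \<otimes> A" "Tgt \<C> (\<Lambda>\<^sub>\<bullet> A) = \<zero>" "is_iso \<C> (\<Lambda>\<^sub>\<bullet> A)"
    "\<rho>\<^sub>\<bullet> A \<in> Arr \<C>" "Src \<C> (\<rho>\<^sub>\<bullet> A) = A \<otimes> \<zero>" "Tgt \<C> (\<rho>\<^sub>\<bullet> A) = \<zero>" "is_iso \<C> (\<rho>\<^sub>\<bullet> A)"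
  using lnull_iso[OF assms] rnull_iso[OF assms] by (auto simp: Iso_def hom_iff)

lemma ldist_natural:
  assumes "f \<in> Arr \<C>" "g \<in> Arr \<C>" "h \<in> Arr \<C>" "A = Tgt \<C> f" "B = Tgt \<C> g" "C = Tgt \<C> h"
  shows "\<delta>\<^sub>l A B C \<cdot> (f \<otimes>\<^sub>a (g \<oplus>\<^sub>a h)) = (f \<otimes>\<^sub>a g \<oplus>\<^sub>a f \<otimes>\<^sub>a h) \<cdot> \<delta>\<^sub>l (Src \<C> f) (Src \<C> g) (Src \<C> h)"
  using assms by (auto intro!: ldist_nat simp: hom_iff)

lemma null_natural:
  assumes "f \<in> Arr \<C>" "A = Tgt \<C> f"
  shows "\<Lambda>\<^sub>\<bullet> A \<cdot> (\<iota> \<zero> \<otimes>\<^sub>a f) = \<Lambda>\<^sub>\<bullet> (Src \<C> f)" "\<rho>\<^sub>\<bullet> A \<cdot> (f \<otimes>\<^sub>a \<iota> \<zero>) = \<rho>\<^sub>\<bullet> (Src \<C> f)"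
  using assms by (auto intro!: lnull_nat rnull_nat simp: hom_iff)

end

context braided_bimonoidal_category
begin

text \<open>
  The functor is \<open>X\<close> on objects and \<open>K\<close> on arrows; \<open>s\<close> is its additive structure.
\<close>

abbreviation X where "X \<equiv> add.pow"
abbreviation K where "K \<equiv> add.perm_map"
abbreviation s where "s \<equiv> add.merge"

text \<open>
  Left distributivity of the finite ordinals is the identity, so multiplying out the second factor from
  the left puts the summands in the order in which pairs are numbered in a product of ordinals.
\<close>

primrec distribute :: "nat \<Rightarrow> nat \<Rightarrow> 'm" where
  "distribute m 0 = \<rho>\<^sub>\<bullet> (X m)"
| "distribute m (Suc n) = s m (m * n) \<cdot> (\<rho>\<^sub>\<times> (X m) \<oplus>\<^sub>a distribute m n) \<cdot> \<delta>\<^sub>l (X m) \<one> (X n)"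

lemma distribute_arr':
  "distribute m n \<in> Arr \<C> \<and> Src \<C> (distribute m n) = X m \<otimes> X n \<and> Tgt \<C> (distribute m n) = X (m * n)"
  by (induction n) simp_all

lemma distribute_arr [simp]:
  "distribute m n \<in> Arr \<C>" "Src \<C> (distribute m n) = X m \<otimes> X n" "Tgt \<C> (distribute m n) = X (m * n)"
  using distribute_arr' by auto

lemma distribute_natural_left:
  assumes [simp]: "f \<in> Arr FO"
  shows "distribute (fst f) n \<cdot> (K f \<otimes>\<^sub>a \<iota> (X n)) = K (f \<otimes>\<^sub>F (n, id)) \<cdot> distribute (fst f) n"
proof (induction n)
  case 0
  have "\<rho>\<^sub>\<bullet> (X (fst f)) \<cdot> (K f \<otimes>\<^sub>a \<iota> \<zero>) = \<rho>\<^sub>\<bullet> (X (fst f))"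
    using null_natural(2)[of "K f" "X (fst f)"] by simp
  then show ?case
    by simp
next
  case (Suc n)
  let ?m = "fst f"
  have e: "f \<otimes>\<^sub>F (Suc n, id) = f \<oplus>\<^sub>F f \<otimes>\<^sub>F (n, id)"
    using FO_ldist_nat[of f "(1, id)" "(n, id)"] by (simp add: FO_prod_one[simplified])
  have "distribute ?m (Suc n) \<cdot> (K f \<otimes>\<^sub>a \<iota> (X (Suc n)))
      = s ?m (?m * n) \<cdot> (\<rho>\<^sub>\<times> (X ?m) \<oplus>\<^sub>a distribute ?m n) \<cdot> (\<delta>\<^sub>l (X ?m) \<one> (X n) \<cdot> (K f \<otimes>\<^sub>a (\<iota> \<one> \<oplus>\<^sub>a \<iota> (X n))))"
    by simp
  also have "\<dots> = s ?m (?m * n) \<cdot> (\<rho>\<^sub>\<times> (X ?m) \<oplus>\<^sub>a distribute ?m n) \<cdot> ((K f \<otimes>\<^sub>a \<iota> \<one> \<oplus>\<^sub>a K f \<otimes>\<^sub>a \<iota> (X n)) \<cdot> \<delta>\<^sub>l (X ?m) \<one> (X n))"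
    using ldist_natural[of "K f" "\<iota> \<one>" "\<iota> (X n)" "X ?m" \<one> "X n"] by simp
  also have "\<dots> = s ?m (?m * n) \<cdot> ((\<rho>\<^sub>\<times> (X ?m) \<cdot> (K f \<otimes>\<^sub>a \<iota> \<one>)) \<oplus>\<^sub>a (distribute ?m n \<cdot> (K f \<otimes>\<^sub>a \<iota> (X n)))) \<cdot> \<delta>\<^sub>l (X ?m) \<one> (X n)"
    by simp
  also have "\<dots> = s ?m (?m * n) \<cdot> ((K f \<cdot> \<rho>\<^sub>\<times> (X ?m)) \<oplus>\<^sub>a (K (f \<otimes>\<^sub>F (n, id)) \<cdot> distribute ?m n)) \<cdot> \<delta>\<^sub>l (X ?m) \<one> (X n)"
    using Suc mult.runit_natural[of "K f" "X ?m"] by simp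
  also have "\<dots> = (s ?m (?m * n) \<cdot> (K f \<oplus>\<^sub>a K (f \<otimes>\<^sub>F (n, id)))) \<cdot> (\<rho>\<^sub>\<times> (X ?m) \<oplus>\<^sub>a distribute ?m n) \<cdot> \<delta>\<^sub>l (X ?m) \<one> (X n)"
    by simp
  also have "\<dots> = K (f \<otimes>\<^sub>F (Suc n, id)) \<cdot> distribute ?m (Suc n)"
    unfolding e using add.merge_nat[of f "f \<otimes>\<^sub>F (n, id)" ?m "?m * n"] by simp
  finally show ?case .
qed

text \<open>
  Induction on the first summand; the step is the coherence of left distributivity with associativity
  of sums.
\<close>

lemma distribute_ldist:
  "distribute m (n + p) \<cdot> (\<iota> (X m) \<otimes>\<^sub>a s n p)
 = s (m * n) (m * p) \<cdot> (distribute m n \<oplus>\<^sub>a distribute m p) \<cdot> \<delta>\<^sub>l (X m) (X n) (X p)"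
proof (induction n)
  case 0
  have "s (m * 0) (m * p) \<cdot> (distribute m 0 \<oplus>\<^sub>a distribute m p) \<cdot> \<delta>\<^sub>l (X m) (X 0) (X p)
      = (\<Lambda>\<^sub>+ (X (m * p)) \<cdot> (\<iota> \<zero> \<oplus>\<^sub>a distribute m p)) \<cdot> (\<rho>\<^sub>\<bullet> (X m) \<oplus>\<^sub>a \<iota> (X m \<otimes> X p)) \<cdot> \<delta>\<^sub>l (X m) \<zero> (X p)"
    by simp
  also have "\<dots> = distribute m p \<cdot> (\<Lambda>\<^sub>+ (X m \<otimes> X p) \<cdot> (\<rho>\<^sub>\<bullet> (X m) \<oplus>\<^sub>a \<iota> (X m \<otimes> X p)) \<cdot> \<delta>\<^sub>l (X m) \<zero> (X p))"
    using add.lunit_natural[of "distribute m p" "X (m * p)"] by simp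
  also have "\<dots> = distribute m p \<cdot> (\<iota> (X m) \<otimes>\<^sub>a \<Lambda>\<^sub>+ (X p))"
    by (simp add: ldist_zero_left)
  finally show ?case
    by simp
next
  case (Suc n)
  let ?m = "X m" and ?n = "X n" and ?p = "X p"
  let ?r = "\<rho>\<^sub>\<times> ?m" and ?dn = "distribute m n" and ?dp = "distribute m p"
  let ?y = "\<iota> (?m \<otimes> \<one>) \<oplus>\<^sub>a \<delta>\<^sub>l ?m ?n ?p"
  have "distribute m (Suc n + p) \<cdot> (\<iota> ?m \<otimes>\<^sub>a s (Suc n) p)
      = s m (m * (n + p)) \<cdot> (?r \<oplus>\<^sub>a distribute m (n + p)) \<cdot> (\<delta>\<^sub>l ?m \<one> (X (n + p)) \<cdot> (\<iota> ?m \<otimes>\<^sub>a (\<iota> \<one> \<oplus>\<^sub>a s n p))) \<cdot> (\<iota> ?m \<otimes>\<^sub>a \<alpha>\<^sub>+ \<one> ?n ?p)"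
    by simp
  also have "\<dots> = s m (m * (n + p)) \<cdot> (?r \<oplus>\<^sub>a distribute m (n + p)) \<cdot> ((\<iota> (?m \<otimes> \<one>) \<oplus>\<^sub>a \<iota> ?m \<otimes>\<^sub>a s n p) \<cdot> \<delta>\<^sub>l ?m \<one> (?n \<oplus> ?p)) \<cdot> (\<iota> ?m \<otimes>\<^sub>a \<alpha>\<^sub>+ \<one> ?n ?p)"
    using ldist_natural[of "\<iota> ?m" "\<iota> \<one>" "s n p" ?m \<one> "X (n + p)"] by simp
  also have "\<dots> = s m (m * (n + p)) \<cdot> (?r \<oplus>\<^sub>a (distribute m (n + p) \<cdot> (\<iota> ?m \<otimes>\<^sub>a s n p))) \<cdot> \<delta>\<^sub>l ?m \<one> (?n \<oplus> ?p) \<cdot> (\<iota> ?m \<otimes>\<^sub>a \<alpha>\<^sub>+ \<one> ?n ?p)"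
    by simp
  also have "\<dots> = s m (m * n + m * p) \<cdot> (?r \<oplus>\<^sub>a (s (m * n) (m * p) \<cdot> (?dn \<oplus>\<^sub>a ?dp))) \<cdot> (?y \<cdot> \<delta>\<^sub>l ?m \<one> (?n \<oplus> ?p) \<cdot> (\<iota> ?m \<otimes>\<^sub>a \<alpha>\<^sub>+ \<one> ?n ?p))"
    unfolding Suc by (simp add: distrib_left)
  also have "\<dots> = s m (m * n + m * p) \<cdot> (?r \<oplus>\<^sub>a (s (m * n) (m * p) \<cdot> (?dn \<oplus>\<^sub>a ?dp)))
      \<cdot> (\<alpha>\<^sub>+ (?m \<otimes> \<one>) (?m \<otimes> ?n) (?m \<otimes> ?p) \<cdot> (\<delta>\<^sub>l ?m \<one> ?n \<oplus>\<^sub>a \<iota> (?m \<otimes> ?p)) \<cdot> \<delta>\<^sub>l ?m (\<one> \<oplus> ?n) ?p)"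
    by (subst ldist_sum_assoc) simp_all
  also have "\<dots> = s m (m * n + m * p) \<cdot> (\<iota> ?m \<oplus>\<^sub>a s (m * n) (m * p)) \<cdot> ((?r \<oplus>\<^sub>a (?dn \<oplus>\<^sub>a ?dp))
      \<cdot> \<alpha>\<^sub>+ (?m \<otimes> \<one>) (?m \<otimes> ?n) (?m \<otimes> ?p)) \<cdot> (\<delta>\<^sub>l ?m \<one> ?n \<oplus>\<^sub>a \<iota> (?m \<otimes> ?p)) \<cdot> \<delta>\<^sub>l ?m (\<one> \<oplus> ?n) ?p"
    by simp
  also have "\<dots> = s m (m * n + m * p) \<cdot> (\<iota> ?m \<oplus>\<^sub>a s (m * n) (m * p)) \<cdot> (\<alpha>\<^sub>+ ?m (X (m * n)) (X (m * p))
      \<cdot> ((?r \<oplus>\<^sub>a ?dn) \<oplus>\<^sub>a ?dp)) \<cdot> (\<delta>\<^sub>l ?m \<one> ?n \<oplus>\<^sub>a \<iota> (?m \<otimes> ?p)) \<cdot> \<delta>\<^sub>l ?m (\<one> \<oplus> ?n) ?p"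
    using add.assoc_natural[of ?r ?dn ?dp ?m "X (m * n)" "X (m * p)"] by simp
  also have "\<dots> = (s m (m * n + m * p) \<cdot> (\<iota> ?m \<oplus>\<^sub>a s (m * n) (m * p)) \<cdot> \<alpha>\<^sub>+ ?m (X (m * n)) (X (m * p)))
      \<cdot> ((?r \<oplus>\<^sub>a ?dn) \<oplus>\<^sub>a ?dp) \<cdot> (\<delta>\<^sub>l ?m \<one> ?n \<oplus>\<^sub>a \<iota> (?m \<otimes> ?p)) \<cdot> \<delta>\<^sub>l ?m (\<one> \<oplus> ?n) ?p"
    by simp
  also have "\<dots> = s (m * Suc n) (m * p) \<cdot> (distribute m (Suc n) \<oplus>\<^sub>a ?dp) \<cdot> \<delta>\<^sub>l ?m (X (Suc n)) ?p"
    unfolding add.merge_assoc[symmetric] by (simp add: add.assoc)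
  finally show ?case .
qed

lemma distribute_one: "distribute m 1 = \<rho>\<^sub>\<times> (X m) \<cdot> (\<iota> (X m) \<otimes>\<^sub>a \<rho>\<^sub>+ \<one>)"
proof -
  let ?m = "X m"
  have "distribute m 1 = (\<rho>\<^sub>+ ?m \<cdot> (\<rho>\<^sub>\<times> ?m \<oplus>\<^sub>a \<iota> \<zero>)) \<cdot> (\<iota> (?m \<otimes> \<one>) \<oplus>\<^sub>a \<rho>\<^sub>\<bullet> ?m) \<cdot> \<delta>\<^sub>l ?m \<one> \<zero>"
    by (simp add: add.merge_runit)
  also have "\<dots> = \<rho>\<^sub>\<times> ?m \<cdot> (\<rho>\<^sub>+ (?m \<otimes> \<one>) \<cdot> (\<iota> (?m \<otimes> \<one>) \<oplus>\<^sub>a \<rho>\<^sub>\<bullet> ?m) \<cdot> \<delta>\<^sub>l ?m \<one> \<zero>)"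
    using add.runit_natural[of "\<rho>\<^sub>\<times> ?m" ?m] by simp
  also have "\<dots> = \<rho>\<^sub>\<times> ?m \<cdot> (\<iota> ?m \<otimes>\<^sub>a \<rho>\<^sub>+ \<one>)"
    by (simp add: ldist_zero_right)
  finally show ?thesis .
qed

lemma distribute_braid_right:
  "distribute m (p + n) \<cdot> (\<iota> (X m) \<otimes>\<^sub>a K (\<zeta>\<^sub>F n p))
 = K ((m, id) \<otimes>\<^sub>F \<zeta>\<^sub>F n p) \<cdot> distribute m (n + p)"
proof -
  let ?m = "X m" and ?n = "X n" and ?p = "X p"
  let ?z = "\<zeta>\<^sub>F n p" and ?k = "\<iota> (X m) \<otimes>\<^sub>a s n p"
  have [simp]: "p + n = n + p" "m * p + m * n = m * n + m * p"
    by auto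
  have "(distribute m (p + n) \<cdot> (\<iota> ?m \<otimes>\<^sub>a K ?z)) \<cdot> ?k = distribute m (p + n) \<cdot> (\<iota> ?m \<otimes>\<^sub>a (K ?z \<cdot> s n p))"
    by simp
  also have "\<dots> = (distribute m (p + n) \<cdot> (\<iota> ?m \<otimes>\<^sub>a s p n)) \<cdot> (\<iota> ?m \<otimes>\<^sub>a \<zeta>\<^sub>+ ?n ?p)"
    unfolding add.merge_braid by simp
  also have "\<dots> = s (m * p) (m * n) \<cdot> (distribute m p \<oplus>\<^sub>a distribute m n) \<cdot> (\<delta>\<^sub>l ?m ?p ?n \<cdot> (\<iota> ?m \<otimes>\<^sub>a \<zeta>\<^sub>+ ?n ?p))"
    unfolding distribute_ldist by simp
  also have "\<dots> = s (m * p) (m * n) \<cdot> ((distribute m p \<oplus>\<^sub>a distribute m n) \<cdot> \<zeta>\<^sub>+ (?m \<otimes> ?n) (?m \<otimes> ?p)) \<cdot> \<delta>\<^sub>l ?m ?n ?p"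
    by (simp add: ldist_sum_braid)
  also have "\<dots> = (s (m * p) (m * n) \<cdot> \<zeta>\<^sub>+ (X (m * n)) (X (m * p))) \<cdot> (distribute m n \<oplus>\<^sub>a distribute m p) \<cdot> \<delta>\<^sub>l ?m ?n ?p"
    using add.braid_natural[of "distribute m n" "distribute m p" "X (m * n)" "X (m * p)", symmetric]
    by simp
  also have "\<dots> = K (\<zeta>\<^sub>F (m * n) (m * p)) \<cdot> (s (m * n) (m * p) \<cdot> (distribute m n \<oplus>\<^sub>a distribute m p) \<cdot> \<delta>\<^sub>l ?m ?n ?p)"
    unfolding add.merge_braid[symmetric] by simp
  also have "\<dots> = (K ((m, id) \<otimes>\<^sub>F ?z) \<cdot> distribute m (n + p)) \<cdot> ?k"
    unfolding distribute_ldist[symmetric] FO_ldist_sum_braid by (simp add: distrib_left)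
  finally show ?thesis
    by (rule add.iso_cancel_right) (simp_all add: distrib_left)
qed

text \<open>
  This and \<open>distribute_braid_right\<close> give naturality in the second factor on generators.
\<close>

lemma distribute_sum_right:
  assumes [simp]: "f \<in> Arr FO" "g \<in> Arr FO"
    and f: "distribute m (fst f) \<cdot> (\<iota> (X m) \<otimes>\<^sub>a K f) = K ((m, id) \<otimes>\<^sub>F f) \<cdot> distribute m (fst f)"
    and g: "distribute m (fst g) \<cdot> (\<iota> (X m) \<otimes>\<^sub>a K g) = K ((m, id) \<otimes>\<^sub>F g) \<cdot> distribute m (fst g)"
  shows "distribute m (fst f + fst g) \<cdot> (\<iota> (X m) \<otimes>\<^sub>a K (f \<oplus>\<^sub>F g))
       = K ((m, id) \<otimes>\<^sub>F (f \<oplus>\<^sub>F g)) \<cdot> distribute m (fst f + fst g)"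
proof -
  let ?m = "X m" and ?n = "fst f" and ?p = "fst g"
  let ?k = "\<iota> (X m) \<otimes>\<^sub>a s ?n ?p" and ?f = "(m, id) \<otimes>\<^sub>F f" and ?g = "(m, id) \<otimes>\<^sub>F g"
  have "(distribute m (?n + ?p) \<cdot> (\<iota> ?m \<otimes>\<^sub>a K (f \<oplus>\<^sub>F g))) \<cdot> ?k
      = distribute m (?n + ?p) \<cdot> (\<iota> ?m \<otimes>\<^sub>a (K (f \<oplus>\<^sub>F g) \<cdot> s ?n ?p))"
    by simp
  also have "\<dots> = (distribute m (?n + ?p) \<cdot> (\<iota> ?m \<otimes>\<^sub>a s ?n ?p)) \<cdot> (\<iota> ?m \<otimes>\<^sub>a (K f \<oplus>\<^sub>a K g))"
    using add.merge_natural[of f g, symmetric] by simp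
  also have "\<dots> = s (m * ?n) (m * ?p) \<cdot> (distribute m ?n \<oplus>\<^sub>a distribute m ?p) \<cdot> (\<delta>\<^sub>l ?m (X ?n) (X ?p) \<cdot> (\<iota> ?m \<otimes>\<^sub>a (K f \<oplus>\<^sub>a K g)))"
    unfolding distribute_ldist by simp
  also have "\<dots> = s (m * ?n) (m * ?p) \<cdot> ((distribute m ?n \<cdot> (\<iota> ?m \<otimes>\<^sub>a K f)) \<oplus>\<^sub>a (distribute m ?p \<cdot> (\<iota> ?m \<otimes>\<^sub>a K g))) \<cdot> \<delta>\<^sub>l ?m (X ?n) (X ?p)"
    using ldist_natural[of "\<iota> ?m" "K f" "K g" ?m "X ?n" "X ?p"] by simp
  also have "\<dots> = (s (m * ?n) (m * ?p) \<cdot> (K ?f \<oplus>\<^sub>a K ?g)) \<cdot> (distribute m ?n \<oplus>\<^sub>a distribute m ?p) \<cdot> \<delta>\<^sub>l ?m (X ?n) (X ?p)"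
    unfolding f g by simp
  also have "\<dots> = K (?f \<oplus>\<^sub>F ?g) \<cdot> (s (m * ?n) (m * ?p) \<cdot> (distribute m ?n \<oplus>\<^sub>a distribute m ?p) \<cdot> \<delta>\<^sub>l ?m (X ?n) (X ?p))"
    using add.merge_nat[of ?f ?g "m * ?n" "m * ?p"] by simp
  also have "\<dots> = (K ((m, id) \<otimes>\<^sub>F (f \<oplus>\<^sub>F g)) \<cdot> distribute m (?n + ?p)) \<cdot> ?k"
    unfolding distribute_ldist[symmetric] by (simp add: FO_ldist_nat distrib_left)
  finally show ?thesis
    by (rule add.iso_cancel_right) (simp_all add: distrib_left)
qed

lemma distribute_natural_right:
  "f \<in> Arr FO \<Longrightarrow>
    distribute m (fst f) \<cdot> (\<iota> (X m) \<otimes>\<^sub>a K f) = K ((m, id) \<otimes>\<^sub>F f) \<cdot> distribute m (fst f)"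
proof (induction rule: FO_generated)
  case (comp f g)
  have e: "(m, id) \<otimes>\<^sub>F (g \<cdot>\<^sub>F f) = ((m, id) \<otimes>\<^sub>F g) \<cdot>\<^sub>F ((m, id) \<otimes>\<^sub>F f)"
    using comp FO_prod_comp[of "(m, id)" "(m, id)" f g] by simp
  have "distribute m (fst (g \<cdot>\<^sub>F f)) \<cdot> (\<iota> (X m) \<otimes>\<^sub>a K (g \<cdot>\<^sub>F f))
      = (distribute m (fst g) \<cdot> (\<iota> (X m) \<otimes>\<^sub>a K g)) \<cdot> (\<iota> (X m) \<otimes>\<^sub>a K f)"
    using comp(1-3) by (simp add: add.perm_map_comp)
  also have "\<dots> = (K ((m, id) \<otimes>\<^sub>F g) \<cdot> distribute m (fst g)) \<cdot> (\<iota> (X m) \<otimes>\<^sub>a K f)"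
    using comp by (simp only: fold_id)
  also have "\<dots> = K ((m, id) \<otimes>\<^sub>F g) \<cdot> (distribute m (fst f) \<cdot> (\<iota> (X m) \<otimes>\<^sub>a K f))"
    using comp(1-3) by simp
  also have "\<dots> = K ((m, id) \<otimes>\<^sub>F g) \<cdot> K ((m, id) \<otimes>\<^sub>F f) \<cdot> distribute m (fst f)"
    using comp by (simp only: fold_id)
  also have "\<dots> = K ((m, id) \<otimes>\<^sub>F (g \<cdot>\<^sub>F f)) \<cdot> distribute m (fst (g \<cdot>\<^sub>F f))"
    unfolding e using comp(1-3) by (simp add: add.perm_map_comp)
  finally show ?case .
next
  case (up f)
  then show ?case
    using distribute_sum_right[of "(Suc 0, id)" f m] by simp
next
  case (swap0 n)
  show ?case
    using distribute_sum_right[of "\<zeta>\<^sub>F (Suc 0) (Suc 0)" "(n, id)" m]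
      distribute_braid_right[of m "Suc 0" "Suc 0"] by simp
qed simp

lemma distribute_natural:
  assumes [simp]: "f \<in> Arr FO" "g \<in> Arr FO"
  shows "distribute (fst f) (fst g) \<cdot> (K f \<otimes>\<^sub>a K g) = K (f \<otimes>\<^sub>F g) \<cdot> distribute (fst f) (fst g)"
proof -
  let ?m = "fst f" and ?n = "fst g"
  have "distribute ?m ?n \<cdot> (K f \<otimes>\<^sub>a K g)
      = (distribute ?m ?n \<cdot> (K f \<otimes>\<^sub>a \<iota> (X ?n))) \<cdot> (\<iota> (X ?m) \<otimes>\<^sub>a K g)"
    by simp
  also have "\<dots> = K (f \<otimes>\<^sub>F (?n, id)) \<cdot> (distribute ?m ?n \<cdot> (\<iota> (X ?m) \<otimes>\<^sub>a K g))"
    by (simp add: distribute_natural_left)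
  also have "\<dots> = K ((f \<otimes>\<^sub>F (?n, id)) \<cdot>\<^sub>F ((?m, id) \<otimes>\<^sub>F g)) \<cdot> distribute ?m ?n"
    by (simp add: distribute_natural_right add.perm_map_comp)
  also have "(f \<otimes>\<^sub>F (?n, id)) \<cdot>\<^sub>F ((?m, id) \<otimes>\<^sub>F g) = f \<otimes>\<^sub>F g"
    using FO_prod_comp[of "(?m, id)" f g "(?n, id)"] by simp
  finally show ?thesis .
qed

text \<open>
  Induction on the last factor, since all three instances of \<open>distribute\<close> that contain it multiply it
  out.
\<close>

lemma distribute_assoc:
  "distribute (m * n) p \<cdot> (distribute m n \<otimes>\<^sub>a \<iota> (X p))
 = distribute m (n * p) \<cdot> (\<iota> (X m) \<otimes>\<^sub>a distribute n p) \<cdot> \<alpha>\<^sub>\<times> (X m) (X n) (X p)"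
proof (induction p)
  case 0
  have "\<rho>\<^sub>\<bullet> (X (m * n)) \<cdot> (distribute m n \<otimes>\<^sub>a \<iota> \<zero>) = \<rho>\<^sub>\<bullet> (X m \<otimes> X n)"
    using null_natural(2)[of "distribute m n" "X (m * n)"] by simp
  also have "\<dots> = \<rho>\<^sub>\<bullet> (X m) \<cdot> (\<iota> (X m) \<otimes>\<^sub>a \<rho>\<^sub>\<bullet> (X n)) \<cdot> \<alpha>\<^sub>\<times> (X m) (X n) \<zero>"
    by (simp add: rnull_prod)
  finally show ?case
    by simp
next
  case (Suc p)
  let ?m = "X m" and ?n = "X n" and ?p = "X p"
  let ?dmn = "distribute m n" and ?dnp = "distribute n p"
  let ?s = "s (m * n) (m * (n * p))"
  let ?d = "\<delta>\<^sub>l (?m \<otimes> ?n) \<one> ?p" and ?a = "\<alpha>\<^sub>\<times> ?m ?n ?p"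
  have s: "s (m * n) (m * n * p) = ?s"
    by (simp add: mult.assoc)
  have "distribute (m * n) (Suc p) \<cdot> (?dmn \<otimes>\<^sub>a \<iota> (X (Suc p)))
      = ?s \<cdot> (\<rho>\<^sub>\<times> (X (m * n)) \<oplus>\<^sub>a distribute (m * n) p) \<cdot> (\<delta>\<^sub>l (X (m * n)) \<one> ?p \<cdot> (?dmn \<otimes>\<^sub>a (\<iota> \<one> \<oplus>\<^sub>a \<iota> ?p)))"
    by (simp add: s[symmetric])
  also have "\<dots> = ?s \<cdot> ((\<rho>\<^sub>\<times> (X (m * n)) \<cdot> (?dmn \<otimes>\<^sub>a \<iota> \<one>)) \<oplus>\<^sub>a (distribute (m * n) p \<cdot> (?dmn \<otimes>\<^sub>a \<iota> ?p))) \<cdot> ?d"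
    using ldist_natural[of ?dmn "\<iota> \<one>" "\<iota> ?p" "X (m * n)" \<one> ?p] by (simp add: mult.assoc)
  also have "\<dots> = ?s \<cdot> ((?dmn \<cdot> \<rho>\<^sub>\<times> (?m \<otimes> ?n)) \<oplus>\<^sub>a (distribute m (n * p) \<cdot> (\<iota> ?m \<otimes>\<^sub>a ?dnp) \<cdot> ?a)) \<cdot> ?d"
    using mult.runit_natural[of ?dmn "X (m * n)"] Suc by simp
  also have "\<dots> = ?s \<cdot> ((?dmn \<cdot> (\<iota> ?m \<otimes>\<^sub>a \<rho>\<^sub>\<times> ?n) \<cdot> \<alpha>\<^sub>\<times> ?m ?n \<one>) \<oplus>\<^sub>a (distribute m (n * p) \<cdot> (\<iota> ?m \<otimes>\<^sub>a ?dnp) \<cdot> ?a)) \<cdot> ?d"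
    by (simp add: mult.runit_tensor)
  also have "\<dots> = ?s \<cdot> (?dmn \<oplus>\<^sub>a distribute m (n * p)) \<cdot> (\<iota> ?m \<otimes>\<^sub>a \<rho>\<^sub>\<times> ?n \<oplus>\<^sub>a \<iota> ?m \<otimes>\<^sub>a ?dnp) \<cdot> ((\<alpha>\<^sub>\<times> ?m ?n \<one> \<oplus>\<^sub>a ?a) \<cdot> ?d)"
    by simp
  also have "\<dots> = ?s \<cdot> (?dmn \<oplus>\<^sub>a distribute m (n * p)) \<cdot> (\<iota> ?m \<otimes>\<^sub>a \<rho>\<^sub>\<times> ?n \<oplus>\<^sub>a \<iota> ?m \<otimes>\<^sub>a ?dnp)
      \<cdot> \<delta>\<^sub>l ?m (?n \<otimes> \<one>) (?n \<otimes> ?p) \<cdot> (\<iota> ?m \<otimes>\<^sub>a \<delta>\<^sub>l ?n \<one> ?p) \<cdot> \<alpha>\<^sub>\<times> ?m ?n (\<one> \<oplus> ?p)"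
    by (simp only: ldist_prod_assoc add.pow_ob one_obj)
  also have "\<dots> = ?s \<cdot> (?dmn \<oplus>\<^sub>a distribute m (n * p)) \<cdot> ((\<iota> ?m \<otimes>\<^sub>a \<rho>\<^sub>\<times> ?n \<oplus>\<^sub>a \<iota> ?m \<otimes>\<^sub>a ?dnp)
      \<cdot> \<delta>\<^sub>l ?m (?n \<otimes> \<one>) (?n \<otimes> ?p)) \<cdot> (\<iota> ?m \<otimes>\<^sub>a \<delta>\<^sub>l ?n \<one> ?p) \<cdot> \<alpha>\<^sub>\<times> ?m ?n (\<one> \<oplus> ?p)"
    by simp
  also have "\<dots> = (?s \<cdot> (?dmn \<oplus>\<^sub>a distribute m (n * p)) \<cdot> \<delta>\<^sub>l ?m ?n (X (n * p))) \<cdot> (\<iota> ?m \<otimes>\<^sub>a ((\<rho>\<^sub>\<times> ?n \<oplus>\<^sub>a ?dnp) \<cdot> \<delta>\<^sub>l ?n \<one> ?p)) \<cdot> \<alpha>\<^sub>\<times> ?m ?n (\<one> \<oplus> ?p)"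
    using ldist_natural[of "\<iota> ?m" "\<rho>\<^sub>\<times> ?n" ?dnp ?m ?n "X (n * p)", symmetric] by simp
  also have "\<dots> = distribute m (n * Suc p) \<cdot> (\<iota> ?m \<otimes>\<^sub>a distribute n (Suc p)) \<cdot> \<alpha>\<^sub>\<times> ?m ?n (X (Suc p))"
    unfolding distribute_ldist[symmetric] by simp
  finally show ?case .
qed

lemma distribute_one_left: "distribute 1 n = \<Lambda>\<^sub>\<times> (X n) \<cdot> (\<rho>\<^sub>+ \<one> \<otimes>\<^sub>a \<iota> (X n))"
proof (induction n)
  case 0
  have "\<rho>\<^sub>\<bullet> (\<one> \<oplus> \<zero>) = \<rho>\<^sub>\<bullet> \<one> \<cdot> (\<rho>\<^sub>+ \<one> \<otimes>\<^sub>a \<iota> \<zero>)"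
    using null_natural(2)[of "\<rho>\<^sub>+ \<one>" \<one>] by simp
  then show ?case
    by (simp add: rnull_one)
next
  case (Suc n)
  let ?V = "\<one> \<oplus> \<zero>" and ?n = "X n" and ?r = "\<rho>\<^sub>+ \<one>"
  have s: "s 1 n = ?r \<oplus>\<^sub>a \<iota> ?n"
    using add.triangle[of \<one> ?n] by simp
  have "distribute 1 (Suc n) = (?r \<oplus>\<^sub>a \<iota> ?n) \<cdot> (\<rho>\<^sub>\<times> ?V \<oplus>\<^sub>a distribute 1 n) \<cdot> \<delta>\<^sub>l ?V \<one> ?n"
    using s by simp
  also have "\<dots> = ((?r \<cdot> \<rho>\<^sub>\<times> ?V) \<oplus>\<^sub>a (\<Lambda>\<^sub>\<times> ?n \<cdot> (?r \<otimes>\<^sub>a \<iota> ?n))) \<cdot> \<delta>\<^sub>l ?V \<one> ?n"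
    unfolding Suc by simp
  also have "\<dots> = ((\<rho>\<^sub>\<times> \<one> \<cdot> (?r \<otimes>\<^sub>a \<iota> \<one>)) \<oplus>\<^sub>a (\<Lambda>\<^sub>\<times> ?n \<cdot> (?r \<otimes>\<^sub>a \<iota> ?n))) \<cdot> \<delta>\<^sub>l ?V \<one> ?n"
    using mult.runit_natural[of ?r \<one>] by simp
  also have "\<dots> = (\<Lambda>\<^sub>\<times> \<one> \<oplus>\<^sub>a \<Lambda>\<^sub>\<times> ?n) \<cdot> ((?r \<otimes>\<^sub>a \<iota> \<one> \<oplus>\<^sub>a ?r \<otimes>\<^sub>a \<iota> ?n) \<cdot> \<delta>\<^sub>l ?V \<one> ?n)"
    by (simp add: mult.lunit_unit)
  also have "\<dots> = ((\<Lambda>\<^sub>\<times> \<one> \<oplus>\<^sub>a \<Lambda>\<^sub>\<times> ?n) \<cdot> \<delta>\<^sub>l \<one> \<one> ?n) \<cdot> (?r \<otimes>\<^sub>a \<iota> (X (Suc n)))"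
    using ldist_natural[of ?r "\<iota> \<one>" "\<iota> ?n" \<one> \<one> ?n, symmetric] by simp
  also have "\<dots> = \<Lambda>\<^sub>\<times> (X (Suc n)) \<cdot> (?r \<otimes>\<^sub>a \<iota> (X (Suc n)))"
    by (simp add: ldist_one)
  finally show ?case .
qed

lemma distribute_zero_left: "distribute 0 n = \<Lambda>\<^sub>\<bullet> (X n)"
proof (induction n)
  case (Suc n)
  have "distribute 0 (Suc n) = \<Lambda>\<^sub>+ \<zero> \<cdot> (\<Lambda>\<^sub>\<bullet> \<one> \<oplus>\<^sub>a \<Lambda>\<^sub>\<bullet> (X n)) \<cdot> \<delta>\<^sub>l \<zero> \<one> (X n)"
    using Suc by (simp add: lnull_one)
  then show ?case
    by (simp add: lnull_sum)
qed (simp add: null_zero)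

text \<open>
  In the step the axiom on \<open>(A + B) \<times> (C + D)\<close> produces the exchange of the two middle summands,
  which \<open>merge_middle_exchange\<close> turns into a permutation. The same axiom in the finite ordinals
  shows that this permutation accounts for the difference between \<open>\<delta>\<^sub>F\<close> at \<open>p\<close> and at \<open>p + 1\<close>.
\<close>

lemma distribute_rdist:
  "K (\<delta>\<^sub>F m n p) \<cdot> distribute (m + n) p \<cdot> (s m n \<otimes>\<^sub>a \<iota> (X p))
 = s (m * p) (n * p) \<cdot> (distribute m p \<oplus>\<^sub>a distribute n p) \<cdot> \<delta>\<^sub>r (X m) (X n) (X p)"
proof (induction p)
  case 0
  have "\<rho>\<^sub>\<bullet> (X (m + n)) \<cdot> (s m n \<otimes>\<^sub>a \<iota> \<zero>) = \<rho>\<^sub>\<bullet> (X m \<oplus> X n)"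
    using null_natural(2)[of "s m n" "X (m + n)"] by simp
  then show ?case
    by (simp add: FO_rdist_units rnull_sum)
next
  case (Suc p)
  let ?m = "X m" and ?n = "X n" and ?p = "X p" and ?M = "X (m + n)" and ?S = "X m \<oplus> X n"
  let ?e = "middle_exchange (additive FO) m (m * p) n (n * p)"
  let ?E = "middle_exchange (additive \<C>) (?m \<otimes> \<one>) (?m \<otimes> ?p) (?n \<otimes> \<one>) (?n \<otimes> ?p)"
  let ?E' = "middle_exchange (additive \<C>) ?m (X (m * p)) ?n (X (n * p))"
  let ?dm = "distribute m p" and ?dn = "distribute n p" and ?d = "distribute (m + n) p"
  let ?rm = "\<rho>\<^sub>\<times> ?m" and ?rn = "\<rho>\<^sub>\<times> ?n" and ?r = "\<delta>\<^sub>F m n p" and ?r' = "\<delta>\<^sub>F m n (Suc p)"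
  let ?l = "\<delta>\<^sub>l ?S \<one> ?p"
  have [simp]: "(m + n) * p = m * p + n * p" "m + n + (m * p + n * p) = m + (n + (m * p + n * p))"
    "m + m * p + (n + n * p) = m + (n + (m * p + n * p))"
    by (simp_all add: distrib_right)
  have [simp]: "?e \<in> Arr FO" "fst ?e = m + (n + (m * p + n * p))"
    by (simp_all add: FO_middle_exchange)
  have er: "?e \<cdot>\<^sub>F ?r' = (m + n, id) \<oplus>\<^sub>F ?r"
    using FO_exchange[of m 1 p n] by (simp add: FO_rdist_units[simplified])
  have "K ?e \<cdot> K ?r' = K (?e \<cdot>\<^sub>F ?r')"
    by (rule add.perm_map_comp[symmetric]) simp_all
  then have Ker: "K ?e \<cdot> K ?r' = K ((m + n, id) \<oplus>\<^sub>F ?r)"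
    unfolding er .
  have nat: "K ((m + n, id) \<oplus>\<^sub>F ?r) \<cdot> s (m + n) ((m + n) * p) = s (m + n) ((m + n) * p) \<cdot> (\<iota> ?M \<oplus>\<^sub>a K ?r)"
    using add.merge_nat[of "(m + n, id)" ?r "m + n" "(m + n) * p"] by simp
  have dist: "distribute (m + n) (Suc p) \<cdot> (s m n \<otimes>\<^sub>a \<iota> (X (Suc p)))
      = s (m + n) ((m + n) * p) \<cdot> ((s m n \<cdot> \<rho>\<^sub>\<times> ?S) \<oplus>\<^sub>a (?d \<cdot> (s m n \<otimes>\<^sub>a \<iota> ?p))) \<cdot> ?l"
  proof -
    have "distribute (m + n) (Suc p) \<cdot> (s m n \<otimes>\<^sub>a \<iota> (X (Suc p)))
      = s (m + n) ((m + n) * p) \<cdot> (\<rho>\<^sub>\<times> ?M \<oplus>\<^sub>a ?d) \<cdot> (\<delta>\<^sub>l ?M \<one> ?p \<cdot> (s m n \<otimes>\<^sub>a (\<iota> \<one> \<oplus>\<^sub>a \<iota> ?p)))"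
      by simp
    also have "\<dots> = s (m + n) ((m + n) * p) \<cdot> ((\<rho>\<^sub>\<times> ?M \<cdot> (s m n \<otimes>\<^sub>a \<iota> \<one>)) \<oplus>\<^sub>a (?d \<cdot> (s m n \<otimes>\<^sub>a \<iota> ?p))) \<cdot> ?l"
      using ldist_natural[of "s m n" "\<iota> \<one>" "\<iota> ?p" ?M \<one> ?p] by simp
    finally show ?thesis
      using mult.runit_natural[of "s m n" ?M] by simp
  qed
  have "K ?e \<cdot> (K ?r' \<cdot> distribute (m + n) (Suc p) \<cdot> (s m n \<otimes>\<^sub>a \<iota> (X (Suc p))))
      = (K ?e \<cdot> K ?r') \<cdot> distribute (m + n) (Suc p) \<cdot> (s m n \<otimes>\<^sub>a \<iota> (X (Suc p)))"
    by (simp del: distribute.simps)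
  also have "\<dots> = (K ((m + n, id) \<oplus>\<^sub>F ?r) \<cdot> s (m + n) ((m + n) * p)) \<cdot> ((s m n \<cdot> \<rho>\<^sub>\<times> ?S) \<oplus>\<^sub>a (?d \<cdot> (s m n \<otimes>\<^sub>a \<iota> ?p))) \<cdot> ?l"
    unfolding Ker dist by simp
  also have "\<dots> = s (m + n) ((m + n) * p) \<cdot> ((s m n \<cdot> \<rho>\<^sub>\<times> ?S) \<oplus>\<^sub>a (K ?r \<cdot> ?d \<cdot> (s m n \<otimes>\<^sub>a \<iota> ?p))) \<cdot> ?l"
    unfolding nat by simp
  also have "\<dots> = s (m + n) ((m + n) * p) \<cdot> ((s m n \<cdot> (?rm \<oplus>\<^sub>a ?rn) \<cdot> \<delta>\<^sub>r ?m ?n \<one>) \<oplus>\<^sub>a (s (m * p) (n * p) \<cdot> (?dm \<oplus>\<^sub>a ?dn) \<cdot> \<delta>\<^sub>r ?m ?n ?p)) \<cdot> ?l"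
    unfolding Suc by (simp only: rdist_one add.pow_ob)
  also have "\<dots> = s (m + n) ((m + n) * p) \<cdot> (s m n \<oplus>\<^sub>a s (m * p) (n * p)) \<cdot> ((?rm \<oplus>\<^sub>a ?rn) \<oplus>\<^sub>a (?dm \<oplus>\<^sub>a ?dn)) \<cdot> ((\<delta>\<^sub>r ?m ?n \<one> \<oplus>\<^sub>a \<delta>\<^sub>r ?m ?n ?p) \<cdot> ?l)"
    by simp
  also have "\<dots> = s (m + n) ((m + n) * p) \<cdot> (s m n \<oplus>\<^sub>a s (m * p) (n * p)) \<cdot> ((?rm \<oplus>\<^sub>a ?rn) \<oplus>\<^sub>a (?dm \<oplus>\<^sub>a ?dn))
      \<cdot> (?E \<cdot> (\<delta>\<^sub>l ?m \<one> ?p \<oplus>\<^sub>a \<delta>\<^sub>l ?n \<one> ?p) \<cdot> \<delta>\<^sub>r ?m ?n (\<one> \<oplus> ?p))"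
    by (simp only: ldist_rdist_exchange add.pow_ob one_obj)
  also have "\<dots> = s (m + n) ((m + n) * p) \<cdot> (s m n \<oplus>\<^sub>a s (m * p) (n * p)) \<cdot> (((?rm \<oplus>\<^sub>a ?rn) \<oplus>\<^sub>a (?dm \<oplus>\<^sub>a ?dn))
      \<cdot> ?E) \<cdot> (\<delta>\<^sub>l ?m \<one> ?p \<oplus>\<^sub>a \<delta>\<^sub>l ?n \<one> ?p) \<cdot> \<delta>\<^sub>r ?m ?n (\<one> \<oplus> ?p)"
    by simp
  also have "\<dots> = s (m + n) ((m + n) * p) \<cdot> (s m n \<oplus>\<^sub>a s (m * p) (n * p)) \<cdot> (?E' \<cdot> ((?rm \<oplus>\<^sub>a ?dm) \<oplus>\<^sub>a (?rn \<oplus>\<^sub>a ?dn)))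
      \<cdot> (\<delta>\<^sub>l ?m \<one> ?p \<oplus>\<^sub>a \<delta>\<^sub>l ?n \<one> ?p) \<cdot> \<delta>\<^sub>r ?m ?n (\<one> \<oplus> ?p)"
    using add.middle_exchange_natural[of ?rm ?dm ?rn ?dn ?m "X (m * p)" ?n "X (n * p)"] by simp
  also have "\<dots> = (s (m + n) (m * p + n * p) \<cdot> (s m n \<oplus>\<^sub>a s (m * p) (n * p)) \<cdot> ?E')
      \<cdot> ((?rm \<oplus>\<^sub>a ?dm) \<oplus>\<^sub>a (?rn \<oplus>\<^sub>a ?dn)) \<cdot> (\<delta>\<^sub>l ?m \<one> ?p \<oplus>\<^sub>a \<delta>\<^sub>l ?n \<one> ?p) \<cdot> \<delta>\<^sub>r ?m ?n (\<one> \<oplus> ?p)"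
    by simp
  also have "\<dots> = (K ?e \<cdot> s (m + m * p) (n + n * p) \<cdot> (s m (m * p) \<oplus>\<^sub>a s n (n * p)))
      \<cdot> ((?rm \<oplus>\<^sub>a ?dm) \<oplus>\<^sub>a (?rn \<oplus>\<^sub>a ?dn)) \<cdot> (\<delta>\<^sub>l ?m \<one> ?p \<oplus>\<^sub>a \<delta>\<^sub>l ?n \<one> ?p) \<cdot> \<delta>\<^sub>r ?m ?n (\<one> \<oplus> ?p)"
    unfolding add.merge_middle_exchange ..
  also have "\<dots> = K ?e \<cdot> (s (m * Suc p) (n * Suc p) \<cdot> (distribute m (Suc p) \<oplus>\<^sub>a distribute n (Suc p)) \<cdot> \<delta>\<^sub>r ?m ?n (X (Suc p)))"
    by simp
  finally show ?case
  proof (rule add.iso_cancel_left)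
    show "is_iso \<C> (K ?e)"
      using add.perm_map_iso by simp
  qed (simp_all del: distribute.simps)
qed

text \<open>
  The braiding turns left into right distributivity, so the step compares \<open>distribute_ldist\<close> with
  \<open>distribute_rdist\<close>.
\<close>

lemma distribute_braid:
  "K (\<xi>\<^sub>F m n) \<cdot> distribute m n = distribute n m \<cdot> \<zeta>\<^sub>\<times> (X m) (X n)"
proof (induction n)
  case 0
  have "\<xi>\<^sub>F m 0 = (0, id)"
    by (rule FO_eqI) auto
  then show ?case
    by (simp add: distribute_zero_left lnull_prod_braid)
next
  case (Suc n)
  let ?m = "X m" and ?n = "X n" and ?V = "X 1"
  let ?z = "\<xi>\<^sub>F m n" and ?z1 = "\<xi>\<^sub>F m 1" and ?z' = "\<xi>\<^sub>F m (1 + n)" and ?r = "\<delta>\<^sub>F 1 n m"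
  let ?k = "\<iota> ?m \<otimes>\<^sub>a s 1 n"
  have one: "K ?z1 \<cdot> distribute m 1 = distribute 1 m \<cdot> \<zeta>\<^sub>\<times> ?m ?V"
  proof -
    have "?z1 = (m, id)"
      using FO_prod_braid(2)[of _ m 1 1] by (intro FO_eqI) auto
    then have "K ?z1 \<cdot> distribute m 1 = (\<Lambda>\<^sub>\<times> ?m \<cdot> \<zeta>\<^sub>\<times> ?m \<one>) \<cdot> (\<iota> ?m \<otimes>\<^sub>a \<rho>\<^sub>+ \<one>)"
      unfolding distribute_one mult.lunit_braid[OF add.pow_ob] by simp
    also have "\<dots> = \<Lambda>\<^sub>\<times> ?m \<cdot> (\<rho>\<^sub>+ \<one> \<otimes>\<^sub>a \<iota> ?m) \<cdot> \<zeta>\<^sub>\<times> ?m ?V"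
      using mult.braid_natural[of "\<iota> ?m" "\<rho>\<^sub>+ \<one>" ?m \<one>] by simp
    also have "\<dots> = distribute 1 m \<cdot> \<zeta>\<^sub>\<times> ?m ?V"
      unfolding distribute_one_left by simp
    finally show ?thesis .
  qed
  have "K ?r \<cdot> K ?z' = K (?r \<cdot>\<^sub>F ?z')"
    by (rule add.perm_map_comp[symmetric]) simp_all
  then have rz: "K ?r \<cdot> K ?z' = K (?z1 \<oplus>\<^sub>F ?z)"
    unfolding FO_rdist_prod_braid .
  have [simp]: "m * n = n * m" "m * (1 + n) = m + n * m" "(1 + n) * m = m + n * m"
    by simp_all
  have nat: "K (?z1 \<oplus>\<^sub>F ?z) \<cdot> s (m * 1) (m * n) = s (1 * m) (n * m) \<cdot> (K ?z1 \<oplus>\<^sub>a K ?z)"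
    using add.merge_nat[of ?z1 ?z m "n * m"] by simp
  note [simp del] = distribute.simps add.merge.simps add.pow.simps plus_1_eq_Suc One_nat_def
  have "(K ?r \<cdot> K ?z' \<cdot> distribute m (1 + n)) \<cdot> ?k = (K ?r \<cdot> K ?z') \<cdot> (distribute m (1 + n) \<cdot> ?k)"
    by simp
  also have "\<dots> = (K (?z1 \<oplus>\<^sub>F ?z) \<cdot> s (m * 1) (m * n)) \<cdot> (distribute m 1 \<oplus>\<^sub>a distribute m n) \<cdot> \<delta>\<^sub>l ?m ?V ?n"
    unfolding rz distribute_ldist by simp
  also have "\<dots> = s (1 * m) (n * m) \<cdot> ((K ?z1 \<cdot> distribute m 1) \<oplus>\<^sub>a (K ?z \<cdot> distribute m n)) \<cdot> \<delta>\<^sub>l ?m ?V ?n"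
    unfolding nat by simp
  also have "\<dots> = s (1 * m) (n * m) \<cdot> (distribute 1 m \<oplus>\<^sub>a distribute n m) \<cdot> ((\<zeta>\<^sub>\<times> ?m ?V \<oplus>\<^sub>a \<zeta>\<^sub>\<times> ?m ?n) \<cdot> \<delta>\<^sub>l ?m ?V ?n)"
    unfolding one Suc by simp
  also have "\<dots> = (s (1 * m) (n * m) \<cdot> (distribute 1 m \<oplus>\<^sub>a distribute n m) \<cdot> \<delta>\<^sub>r ?V ?n ?m) \<cdot> \<zeta>\<^sub>\<times> ?m (?V \<oplus> ?n)"
    by (simp add: rdist_prod_braid[symmetric])
  also have "\<dots> = K ?r \<cdot> distribute (1 + n) m \<cdot> ((s 1 n \<otimes>\<^sub>a \<iota> ?m) \<cdot> \<zeta>\<^sub>\<times> ?m (?V \<oplus> ?n))"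
    unfolding distribute_rdist[symmetric] by simp
  also have "\<dots> = (K ?r \<cdot> distribute (1 + n) m \<cdot> \<zeta>\<^sub>\<times> ?m (X (1 + n))) \<cdot> ?k"
    using mult.braid_natural[of "\<iota> ?m" "s 1 n" ?m "X (1 + n)", symmetric] by simp
  finally have "K ?r \<cdot> K ?z' \<cdot> distribute m (1 + n) = K ?r \<cdot> distribute (1 + n) m \<cdot> \<zeta>\<^sub>\<times> ?m (X (1 + n))"
    by (rule add.iso_cancel_right) simp_all
  then have "K ?z' \<cdot> distribute m (1 + n) = distribute (1 + n) m \<cdot> \<zeta>\<^sub>\<times> ?m (X (1 + n))"
    by (rule add.iso_cancel_left) (simp_all add: add.perm_map_iso)
  then show ?case
    by (simp add: plus_1_eq_Suc)
qed

end

section \<open>Comparison of robust functors\<close>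

text \<open>
  This is what a robust functor on the finite ordinals amounts to when the structure isomorphisms of
  the finite ordinals that are identities are removed.
\<close>

locale FO_functor = braided_bimonoidal_category \<C>
  for \<C> :: "('o, 'm, 'z) braided_bimonoidal_data_scheme" (structure) +
  fixes F :: "(nat, nat \<times> (nat \<Rightarrow> nat), 'o, 'm) bimonoidal_functor_data"
  assumes ob [simp]: "ob_map F n \<in> Obj \<C>"
    and ar [simp]: "f \<in> Arr FO \<Longrightarrow> ar_map F f \<in> Arr \<C>" "f \<in> Arr FO \<Longrightarrow> Src \<C> (ar_map F f) = ob_map F (fst f)"
      "f \<in> Arr FO \<Longrightarrow> Tgt \<C> (ar_map F f) = ob_map F (fst f)"
    and ar_ide [simp]: "ar_map F (n, id) = \<iota> (ob_map F n)"
    and ar_comp: "\<lbrakk>f \<in> Arr FO; g \<in> Arr FO; fst g = fst f\<rbrakk>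
      \<Longrightarrow> ar_map F (g \<cdot>\<^sub>F f) = ar_map F g \<cdot> ar_map F f"
    and sum2 [simp]: "sum2 F m n \<in> Arr \<C>" "Src \<C> (sum2 F m n) = ob_map F m \<oplus> ob_map F n"
      "Tgt \<C> (sum2 F m n) = ob_map F (m + n)" "is_iso \<C> (sum2 F m n)"
    and sum0 [simp]: "sum0 F \<in> Arr \<C>" "Src \<C> (sum0 F) = \<zero>" "Tgt \<C> (sum0 F) = ob_map F 0" "is_iso \<C> (sum0 F)"
    and prod2 [simp]: "prod2 F m n \<in> Arr \<C>" "Src \<C> (prod2 F m n) = ob_map F m \<otimes> ob_map F n"
      "Tgt \<C> (prod2 F m n) = ob_map F (m * n)"
    and prod0 [simp]: "prod0 F \<in> Arr \<C>" "Src \<C> (prod0 F) = \<one>" "Tgt \<C> (prod0 F) = ob_map F 1" "is_iso \<C> (prod0 F)"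
    and sum2_natural: "\<lbrakk>f \<in> Arr FO; g \<in> Arr FO\<rbrakk>
      \<Longrightarrow> sum2 F (fst f) (fst g) \<cdot> (ar_map F f \<oplus>\<^sub>a ar_map F g) = ar_map F (f \<oplus>\<^sub>F g) \<cdot> sum2 F (fst f) (fst g)"
    and sum2_assoc: "sum2 F (m + n) p \<cdot> (sum2 F m n \<oplus>\<^sub>a \<iota> (ob_map F p))
      = sum2 F m (n + p) \<cdot> (\<iota> (ob_map F m) \<oplus>\<^sub>a sum2 F n p) \<cdot> \<alpha>\<^sub>+ (ob_map F m) (ob_map F n) (ob_map F p)"
    and sum2_lunit: "sum2 F 0 n \<cdot> (sum0 F \<oplus>\<^sub>a \<iota> (ob_map F n)) = \<Lambda>\<^sub>+ (ob_map F n)"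
    and sum2_runit: "sum2 F n 0 \<cdot> (\<iota> (ob_map F n) \<oplus>\<^sub>a sum0 F) = \<rho>\<^sub>+ (ob_map F n)"
    and sum2_braid: "ar_map F (\<zeta>\<^sub>F m n) \<cdot> sum2 F m n = sum2 F n m \<cdot> \<zeta>\<^sub>+ (ob_map F m) (ob_map F n)"
    and prod2_runit: "prod2 F n 1 \<cdot> (\<iota> (ob_map F n) \<otimes>\<^sub>a prod0 F) = \<rho>\<^sub>\<times> (ob_map F n)"
    and prod2_lnull: "prod2 F 0 n \<cdot> (sum0 F \<otimes>\<^sub>a \<iota> (ob_map F n)) = sum0 F \<cdot> \<Lambda>\<^sub>\<bullet> (ob_map F n)"
    and prod2_braid: "ar_map F (\<xi>\<^sub>F m n) \<cdot> prod2 F m n = prod2 F n m \<cdot> \<zeta>\<^sub>\<times> (ob_map F m) (ob_map F n)"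
    and prod2_ldist: "prod2 F m (n + p) \<cdot> (\<iota> (ob_map F m) \<otimes>\<^sub>a sum2 F n p)
      = sum2 F (m * n) (m * p) \<cdot> (prod2 F m n \<oplus>\<^sub>a prod2 F m p) \<cdot> \<delta>\<^sub>l (ob_map F m) (ob_map F n) (ob_map F p)"
begin

text \<open>
  The condition on \<open>A \<times> 0\<close> follows from the one on \<open>0 \<times> A\<close> by means of the braiding.
\<close>

lemma prod2_rnull: "prod2 F n 0 \<cdot> (\<iota> (ob_map F n) \<otimes>\<^sub>a sum0 F) = sum0 F \<cdot> \<rho>\<^sub>\<bullet> (ob_map F n)"
proof -
  have "\<xi>\<^sub>F n 0 = (0, id)"
    by (rule FO_eqI) auto
  then have "prod2 F n 0 = prod2 F 0 n \<cdot> \<zeta>\<^sub>\<times> (ob_map F n) (ob_map F 0)"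
    using prod2_braid[of n 0] by simp
  then have "prod2 F n 0 \<cdot> (\<iota> (ob_map F n) \<otimes>\<^sub>a sum0 F)
      = prod2 F 0 n \<cdot> (\<zeta>\<^sub>\<times> (ob_map F n) (ob_map F 0) \<cdot> (\<iota> (ob_map F n) \<otimes>\<^sub>a sum0 F))"
    by simp
  also have "\<dots> = (prod2 F 0 n \<cdot> (sum0 F \<otimes>\<^sub>a \<iota> (ob_map F n))) \<cdot> \<zeta>\<^sub>\<times> (ob_map F n) \<zero>"
    using mult.braid_natural[of "\<iota> (ob_map F n)" "sum0 F" "ob_map F n" "ob_map F 0"] by simp
  also have "\<dots> = sum0 F \<cdot> \<rho>\<^sub>\<bullet> (ob_map F n)"
    unfolding prod2_lnull by (simp add: lnull_prod_braid)
  finally show ?thesis .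
qed

end

locale FO_functor_pair = F: FO_functor \<C> F + G: FO_functor \<C> G
  for \<C> :: "('o, 'm, 'z) braided_bimonoidal_data_scheme" (structure) and F G
begin

text \<open>
  These are the only possible components of a transformation from \<open>F\<close> to \<open>G\<close>: compatibility with the
  units forces those at \<open>0\<close> and \<open>1\<close>, and compatibility with \<open>1 + n\<close> forces the others.
\<close>

definition compare_one :: 'm where
  "compare_one = prod0 G \<cdot> arr_inv \<C> (prod0 F)"

primrec compare :: "nat \<Rightarrow> 'm" where
  "compare 0 = sum0 G \<cdot> arr_inv \<C> (sum0 F)"
| "compare (Suc n) = sum2 G 1 n \<cdot> (compare_one \<oplus>\<^sub>a compare n) \<cdot> arr_inv \<C> (sum2 F 1 n)"

declare compare.simps [simp del]

lemma compare_one_arr [simp]: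
  "compare_one \<in> Arr \<C>" "Src \<C> compare_one = ob_map F (Suc 0)" "Tgt \<C> compare_one = ob_map G (Suc 0)"
  using F.prod0 G.prod0 by (simp_all add: compare_one_def)

lemma compare_arr':
  "compare n \<in> Arr \<C> \<and> Src \<C> (compare n) = ob_map F n \<and> Tgt \<C> (compare n) = ob_map G n"
  by (induction n) (simp_all add: compare.simps)

lemma compare_arr [simp]:
  "compare n \<in> Arr \<C>" "Src \<C> (compare n) = ob_map F n" "Tgt \<C> (compare n) = ob_map G n"
  using compare_arr' by auto

lemma compare_zero [simp]: "compare 0 \<cdot> sum0 F = sum0 G"
  by (simp add: compare.simps)

lemma compare_Suc: "compare (Suc n) \<cdot> sum2 F 1 n = sum2 G 1 n \<cdot> (compare_one \<oplus>\<^sub>a compare n)"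
  by (simp add: compare.simps)

lemma compare_1: "compare 1 = compare_one"
proof -
  let ?k = "\<iota> (ob_map F 1) \<oplus>\<^sub>a sum0 F"
  have "(compare 1 \<cdot> sum2 F 1 0) \<cdot> ?k = (sum2 G 1 0 \<cdot> (compare_one \<oplus>\<^sub>a compare 0)) \<cdot> ?k"
    using compare_Suc[of 0] by simp
  also have "\<dots> = (sum2 G 1 0 \<cdot> (\<iota> (ob_map G 1) \<oplus>\<^sub>a sum0 G)) \<cdot> (compare_one \<oplus>\<^sub>a \<iota> \<zero>)"
    by simp
  also have "\<dots> = compare_one \<cdot> \<rho>\<^sub>+ (ob_map F 1)"
    unfolding G.sum2_runit using F.add.runit_natural[of compare_one "ob_map G 1"] by simp
  also have "\<dots> = (compare_one \<cdot> sum2 F 1 0) \<cdot> ?k"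
    unfolding F.sum2_runit[symmetric] by simp
  finally have "compare 1 \<cdot> sum2 F 1 0 = compare_one \<cdot> sum2 F 1 0"
    by (rule F.iso_cancel_right) simp_all
  then show ?thesis
    by (rule F.iso_cancel_right) simp_all
qed

lemma compare_prod0: "compare 1 \<cdot> prod0 F = prod0 G"
  unfolding compare_1 compare_one_def by simp

lemma compare_sum: "compare (m + n) \<cdot> sum2 F m n = sum2 G m n \<cdot> (compare m \<oplus>\<^sub>a compare n)"
proof (induction m)
  case 0
  let ?k = "sum0 F \<oplus>\<^sub>a \<iota> (ob_map F n)"
  have "(compare n \<cdot> sum2 F 0 n) \<cdot> ?k = compare n \<cdot> (sum2 F 0 n \<cdot> ?k)"
    by simp
  also have "\<dots> = \<Lambda>\<^sub>+ (ob_map G n) \<cdot> (\<iota> \<zero> \<oplus>\<^sub>a compare n)"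
    unfolding F.sum2_lunit using F.add.lunit_natural[of "compare n" "ob_map G n"] by simp
  also have "\<dots> = (sum2 G 0 n \<cdot> (compare 0 \<oplus>\<^sub>a compare n)) \<cdot> ?k"
    unfolding G.sum2_lunit[symmetric] by simp
  finally have "compare n \<cdot> sum2 F 0 n = sum2 G 0 n \<cdot> (compare 0 \<oplus>\<^sub>a compare n)"
    by (rule F.iso_cancel_right) simp_all
  then show ?case
    by simp
next
  case (Suc m)
  let ?k = "sum2 F 1 m \<oplus>\<^sub>a \<iota> (ob_map F n)"
  let ?F = "ob_map F" and ?G = "ob_map G" and ?c = "compare_one" and ?m = "compare m" and ?n = "compare n"
  have "(compare (Suc m + n) \<cdot> sum2 F (Suc m) n) \<cdot> ?k = compare (Suc (m + n)) \<cdot> (sum2 F (1 + m) n \<cdot> ?k)"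
    by simp
  also have "\<dots> = (compare (Suc (m + n)) \<cdot> sum2 F 1 (m + n)) \<cdot> (\<iota> (?F 1) \<oplus>\<^sub>a sum2 F m n) \<cdot> \<alpha>\<^sub>+ (?F 1) (?F m) (?F n)"
    unfolding F.sum2_assoc by simp
  also have "\<dots> = sum2 G 1 (m + n) \<cdot> (?c \<oplus>\<^sub>a (compare (m + n) \<cdot> sum2 F m n)) \<cdot> \<alpha>\<^sub>+ (?F 1) (?F m) (?F n)"
    unfolding compare_Suc by simp
  also have "\<dots> = sum2 G 1 (m + n) \<cdot> (\<iota> (?G 1) \<oplus>\<^sub>a sum2 G m n) \<cdot> ((?c \<oplus>\<^sub>a (?m \<oplus>\<^sub>a ?n)) \<cdot> \<alpha>\<^sub>+ (?F 1) (?F m) (?F n))"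
    unfolding Suc by simp
  also have "\<dots> = (sum2 G 1 (m + n) \<cdot> (\<iota> (?G 1) \<oplus>\<^sub>a sum2 G m n) \<cdot> \<alpha>\<^sub>+ (?G 1) (?G m) (?G n)) \<cdot> ((?c \<oplus>\<^sub>a ?m) \<oplus>\<^sub>a ?n)"
    using F.add.assoc_natural[of ?c ?m ?n "?G 1" "?G m" "?G n"] by simp
  also have "\<dots> = sum2 G (1 + m) n \<cdot> ((sum2 G 1 m \<cdot> (?c \<oplus>\<^sub>a ?m)) \<oplus>\<^sub>a ?n)"
    unfolding G.sum2_assoc[symmetric] by simp
  also have "\<dots> = (sum2 G (Suc m) n \<cdot> (compare (Suc m) \<oplus>\<^sub>a ?n)) \<cdot> ?k"
    unfolding compare_Suc[symmetric] by simp
  finally show ?case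
    by (rule F.iso_cancel_right) simp_all
qed

text \<open>
  Naturality is inherited by sums because \<open>sum2 F\<close> is invertible. Together with
  \<open>compare_natural_braid\<close> this covers the generators.
\<close>

lemma compare_natural_sum:
  assumes [simp]: "f \<in> Arr FO" "g \<in> Arr FO"
    and f: "compare (fst f) \<cdot> ar_map F f = ar_map G f \<cdot> compare (fst f)"
    and g: "compare (fst g) \<cdot> ar_map F g = ar_map G g \<cdot> compare (fst g)"
  shows "compare (fst f + fst g) \<cdot> ar_map F (f \<oplus>\<^sub>F g) = ar_map G (f \<oplus>\<^sub>F g) \<cdot> compare (fst f + fst g)"
proof -
  let ?m = "fst f" and ?n = "fst g" and ?h = "f \<oplus>\<^sub>F g"
  have "(compare (?m + ?n) \<cdot> ar_map F ?h) \<cdot> sum2 F ?m ?n = compare (?m + ?n) \<cdot> (ar_map F ?h \<cdot> sum2 F ?m ?n)"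
    by simp
  also have "\<dots> = (compare (?m + ?n) \<cdot> sum2 F ?m ?n) \<cdot> (ar_map F f \<oplus>\<^sub>a ar_map F g)"
    by (simp add: F.sum2_natural[symmetric])
  also have "\<dots> = sum2 G ?m ?n \<cdot> ((compare ?m \<cdot> ar_map F f) \<oplus>\<^sub>a (compare ?n \<cdot> ar_map F g))"
    unfolding compare_sum by simp
  also have "\<dots> = (sum2 G ?m ?n \<cdot> (ar_map G f \<oplus>\<^sub>a ar_map G g)) \<cdot> (compare ?m \<oplus>\<^sub>a compare ?n)"
    unfolding f g by simp
  also have "\<dots> = ar_map G ?h \<cdot> (sum2 G ?m ?n \<cdot> (compare ?m \<oplus>\<^sub>a compare ?n))"
    by (simp add: G.sum2_natural)
  also have "\<dots> = (ar_map G ?h \<cdot> compare (?m + ?n)) \<cdot> sum2 F ?m ?n"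
    unfolding compare_sum[symmetric] by simp
  finally show ?thesis
    by (rule F.iso_cancel_right) simp_all
qed

lemma compare_natural_braid:
  "compare (m + n) \<cdot> ar_map F (\<zeta>\<^sub>F m n) = ar_map G (\<zeta>\<^sub>F m n) \<cdot> compare (m + n)"
proof -
  let ?z = "\<zeta>\<^sub>F m n"
  have [simp]: "n + m = m + n"
    by simp
  have "(compare (m + n) \<cdot> ar_map F ?z) \<cdot> sum2 F m n = compare (m + n) \<cdot> (ar_map F ?z \<cdot> sum2 F m n)"
    by simp
  also have "\<dots> = (compare (n + m) \<cdot> sum2 F n m) \<cdot> \<zeta>\<^sub>+ (ob_map F m) (ob_map F n)"
    unfolding F.sum2_braid by simp
  also have "\<dots> = sum2 G n m \<cdot> ((compare n \<oplus>\<^sub>a compare m) \<cdot> \<zeta>\<^sub>+ (ob_map F m) (ob_map F n))"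
    unfolding compare_sum by simp
  also have "\<dots> = (sum2 G n m \<cdot> \<zeta>\<^sub>+ (ob_map G m) (ob_map G n)) \<cdot> (compare m \<oplus>\<^sub>a compare n)"
    using F.add.braid_natural[of "compare m" "compare n" "ob_map G m" "ob_map G n"] by simp
  also have "\<dots> = ar_map G ?z \<cdot> (sum2 G m n \<cdot> (compare m \<oplus>\<^sub>a compare n))"
    unfolding G.sum2_braid[symmetric] by simp
  also have "\<dots> = (ar_map G ?z \<cdot> compare (m + n)) \<cdot> sum2 F m n"
    unfolding compare_sum[symmetric] by simp
  finally show ?thesis
    by (rule F.iso_cancel_right) simp_all
qed

lemma compare_natural:
  "f \<in> Arr FO \<Longrightarrow> compare (fst f) \<cdot> ar_map F f = ar_map G f \<cdot> compare (fst f)"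
proof (induction rule: FO_generated)
  case (comp f g)
  have "compare (fst f) \<cdot> ar_map F (g \<cdot>\<^sub>F f) = (compare (fst g) \<cdot> ar_map F g) \<cdot> ar_map F f"
    using comp(1-3) by (simp add: F.ar_comp)
  also have "\<dots> = (ar_map G g \<cdot> compare (fst g)) \<cdot> ar_map F f"
    using comp by (simp only:)
  also have "\<dots> = ar_map G g \<cdot> (compare (fst f) \<cdot> ar_map F f)"
    using comp(1-3) by simp
  also have "\<dots> = ar_map G g \<cdot> ar_map G f \<cdot> compare (fst f)"
    using comp by (simp only:)
  also have "\<dots> = ar_map G (g \<cdot>\<^sub>F f) \<cdot> compare (fst (g \<cdot>\<^sub>F f))"
    using comp(1-3) by (simp add: G.ar_comp)
  finally show ?case
    by simp
next
  case (up f)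
  then show ?case
    using compare_natural_sum[of "(Suc 0, id)" f] by simp
next
  case (swap0 n)
  show ?case
    using compare_natural_sum[of "\<zeta>\<^sub>F (Suc 0) (Suc 0)" "(n, id)"]
      compare_natural_braid[of "Suc 0" "Suc 0"] by simp
qed simp

text \<open>
  Induction on the second factor. By \<open>prod2_ldist\<close> the products by \<open>1 + n\<close> are determined by those by \<open>1\<close>
  and \<open>n\<close>, and the products by \<open>0\<close> and \<open>1\<close> by the nullity and unit isomorphisms.
\<close>

lemma compare_prod: "compare (m * n) \<cdot> prod2 F m n = prod2 G m n \<cdot> (compare m \<otimes>\<^sub>a compare n)"
proof -
  let ?F = "ob_map F" and ?G = "ob_map G" and ?m = "compare m"
  have one: "compare (m * 1) \<cdot> prod2 F m 1 = prod2 G m 1 \<cdot> (compare m \<otimes>\<^sub>a compare 1)"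
  proof -
    let ?k = "\<iota> (?F m) \<otimes>\<^sub>a prod0 F"
    have "(compare (m * 1) \<cdot> prod2 F m 1) \<cdot> ?k = compare m \<cdot> (prod2 F m 1 \<cdot> ?k)"
      using F.prod0 F.prod2[of m 1] by simp
    also have "\<dots> = \<rho>\<^sub>\<times> (?G m) \<cdot> (compare m \<otimes>\<^sub>a \<iota> \<one>)"
      unfolding F.prod2_runit using F.mult.runit_natural[of "compare m" "?G m"] by simp
    also have "\<dots> = prod2 G m 1 \<cdot> (compare m \<otimes>\<^sub>a prod0 G)"
      unfolding G.prod2_runit[symmetric] using G.prod0 G.prod2[of m 1] by simp
    also have "\<dots> = (prod2 G m 1 \<cdot> (compare m \<otimes>\<^sub>a compare 1)) \<cdot> ?k"
      unfolding compare_prod0[symmetric] using F.prod0 G.prod2[of m 1] by simp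
    finally show ?thesis
      by (rule F.iso_cancel_right) (use F.prod0 in simp_all)
  qed
  show ?thesis
  proof (induction n)
    case 0
    let ?k = "\<iota> (?F m) \<otimes>\<^sub>a sum0 F"
    have "(compare 0 \<cdot> prod2 F m 0) \<cdot> ?k = compare 0 \<cdot> (prod2 F m 0 \<cdot> ?k)"
      by simp
    also have "\<dots> = sum0 G \<cdot> (\<rho>\<^sub>\<bullet> (?G m) \<cdot> (compare m \<otimes>\<^sub>a \<iota> \<zero>))"
      unfolding F.prod2_rnull using F.null_natural(2)[of "compare m" "?G m"] by (simp add: compare.simps)
    also have "\<dots> = (prod2 G m 0 \<cdot> (\<iota> (?G m) \<otimes>\<^sub>a sum0 G)) \<cdot> (compare m \<otimes>\<^sub>a \<iota> \<zero>)"
      unfolding G.prod2_rnull by simp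
    also have "\<dots> = (prod2 G m 0 \<cdot> (compare m \<otimes>\<^sub>a compare 0)) \<cdot> ?k"
      by simp
    finally have "compare 0 \<cdot> prod2 F m 0 = prod2 G m 0 \<cdot> (compare m \<otimes>\<^sub>a compare 0)"
      by (rule F.iso_cancel_right) simp_all
    then show ?case
      by simp
  next
    case (Suc n)
    let ?n = "compare n" and ?one = "compare 1" and ?k = "\<iota> (?F m) \<otimes>\<^sub>a sum2 F 1 n"
    have "(compare (m * (1 + n)) \<cdot> prod2 F m (1 + n)) \<cdot> ?k = compare (m * 1 + m * n) \<cdot> (prod2 F m (1 + n) \<cdot> ?k)"
      by simp
    also have "\<dots> = (compare (m * 1 + m * n) \<cdot> sum2 F (m * 1) (m * n)) \<cdot> (prod2 F m 1 \<oplus>\<^sub>a prod2 F m n) \<cdot> \<delta>\<^sub>l (?F m) (?F 1) (?F n)"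
      unfolding F.prod2_ldist using F.prod2[of m 1] by simp
    also have "\<dots> = sum2 G (m * 1) (m * n) \<cdot> ((compare (m * 1) \<cdot> prod2 F m 1) \<oplus>\<^sub>a (compare (m * n) \<cdot> prod2 F m n)) \<cdot> \<delta>\<^sub>l (?F m) (?F 1) (?F n)"
      unfolding compare_sum using F.prod2[of m 1] by simp
    also have "\<dots> = sum2 G (m * 1) (m * n) \<cdot> (prod2 G m 1 \<oplus>\<^sub>a prod2 G m n) \<cdot> ((?m \<otimes>\<^sub>a ?one \<oplus>\<^sub>a ?m \<otimes>\<^sub>a ?n) \<cdot> \<delta>\<^sub>l (?F m) (?F 1) (?F n))"
      unfolding one Suc using G.prod2[of m 1] by simp
    also have "\<dots> = (sum2 G (m * 1) (m * n) \<cdot> (prod2 G m 1 \<oplus>\<^sub>a prod2 G m n) \<cdot> \<delta>\<^sub>l (?G m) (?G 1) (?G n)) \<cdot> (?m \<otimes>\<^sub>a (?one \<oplus>\<^sub>a ?n))"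
      using F.ldist_natural[of ?m ?one ?n "?G m" "?G 1" "?G n"] G.prod2[of m 1] by simp
    also have "\<dots> = prod2 G m (1 + n) \<cdot> (?m \<otimes>\<^sub>a (sum2 G 1 n \<cdot> (?one \<oplus>\<^sub>a ?n)))"
      unfolding G.prod2_ldist[symmetric] by simp
    also have "\<dots> = (prod2 G m (1 + n) \<cdot> (?m \<otimes>\<^sub>a compare (1 + n))) \<cdot> ?k"
      unfolding compare_sum[symmetric] by simp
    finally have "compare (m * (1 + n)) \<cdot> prod2 F m (1 + n) = prod2 G m (1 + n) \<cdot> (?m \<otimes>\<^sub>a compare (1 + n))"
      by (rule F.iso_cancel_right) simp_all
    then show ?case
      by simp
  qed
qed

lemma compare_unique:
  assumes arr: "\<And>n. \<tau> n \<in> Arr \<C>" "\<And>n. Src \<C> (\<tau> n) = ob_map F n" "\<And>n. Tgt \<C> (\<tau> n) = ob_map G n"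
    and zero: "\<tau> 0 \<cdot> sum0 F = sum0 G" and one: "\<tau> 1 \<cdot> prod0 F = prod0 G"
    and sum: "\<And>n. \<tau> (1 + n) \<cdot> sum2 F 1 n = sum2 G 1 n \<cdot> (\<tau> 1 \<oplus>\<^sub>a \<tau> n)"
  shows "\<tau> = compare"
proof
  fix n
  have 1: "\<tau> 1 = compare_one"
    unfolding compare_one_def by (rule F.iso_move_right[OF one]) (use arr F.prod0 in auto)
  show "\<tau> n = compare n"
  proof (induction n)
    case 0
    have "\<tau> 0 = sum0 G \<cdot> arr_inv \<C> (sum0 F)"
      by (rule F.iso_move_right[OF zero]) (use arr in auto)
    then show ?case
      by (simp add: compare.simps)
  next
    case (Suc n)
    have "\<tau> (1 + n) = (sum2 G 1 n \<cdot> (\<tau> 1 \<oplus>\<^sub>a \<tau> n)) \<cdot> arr_inv \<C> (sum2 F 1 n)"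
      by (rule F.iso_move_right[OF sum]) (use arr in auto)
    then show ?case
      unfolding 1 Suc by (simp add: compare.simps)
  qed
qed

end

lemma underlying_category [simp]:
  "category (additive \<C>) = category \<C>" "category (multiplicative \<C>) = category \<C>"
  "category (braided_multiplicative \<D>) = category \<D>"
  by (simp_all add: category_def)

lemma underlying_functor [simp]:
  "is_functor (additive \<C>) (additive \<D>) F = is_functor \<C> \<D> F"
  "is_functor (multiplicative \<C>) (multiplicative \<D>) F = is_functor \<C> \<D> F"
  "is_functor (braided_multiplicative \<A>) (braided_multiplicative \<B>) F = is_functor \<A> \<B> F"
  by (simp_all add: is_functor_def is_functor_axioms_def)

lemma underlying_nat_trans [simp]:
  "nat_trans (additive \<C>) (additive \<D>) F G \<tau> = nat_trans \<C> \<D> F G \<tau>"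
  "nat_trans (multiplicative \<C>) (multiplicative \<D>) F G \<tau> = nat_trans \<C> \<D> F G \<tau>"
  by (simp_all add: nat_trans_def nat_trans_axioms_def)

lemma underlying_monoidal_functor:
  "monoidal_functor (braided_multiplicative \<A>) (braided_multiplicative \<B>) F F2 F0
 = monoidal_functor (multiplicative \<A>) (multiplicative \<B>) F F2 F0"
  by (simp add: monoidal_functor_def monoidal_functor_axioms_def monoidal_category_def monoidal_category_axioms_def)

lemma robust_FO_functor:
  assumes "robust_braided_bimonoidal_functor FO \<C> F"
  shows "FO_functor \<C> F"
proof -
  have bf: "braided_bimonoidal_functor FO \<C> F"
    using assms by (rule robust_braided_bimonoidal_functor.axioms)
  have C: "braided_bimonoidal_category \<C>" and fu: "is_functor FO \<C> F"
    using bf by (auto dest: braided_bimonoidal_functor.axioms)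
  have sm: "symmetric_monoidal_functor (additive FO) (additive \<C>) F (sum2 F) (sum0 F)"
    using bf by (rule braided_bimonoidal_functor.additive_functor)
  have bm: "braided_monoidal_functor (additive FO) (additive \<C>) F (sum2 F) (sum0 F)"
    using sm by (rule symmetric_monoidal_functor.axioms)
  have m: "monoidal_functor (additive FO) (additive \<C>) F (sum2 F) (sum0 F)"
    using bm by (rule braided_monoidal_functor.axioms)
  have bm': "braided_monoidal_functor (braided_multiplicative FO) (braided_multiplicative \<C>) F (prod2 F) (prod0 F)"
    using bf by (rule braided_bimonoidal_functor.multiplicative_functor)
  have m': "monoidal_functor (braided_multiplicative FO) (braided_multiplicative \<C>) F (prod2 F) (prod0 F)"
    using bm' by (rule braided_monoidal_functor.axioms)
  have ar: "ar_map F f \<in> Hom \<C> (ob_map F (fst f)) (ob_map F (fst f))" if "f \<in> Arr FO" for f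
    using is_functor.ar_map_hom[OF fu, of f "fst f" "fst f"] that by (simp add: FO_Hom)
  have ide: "ar_map F (n, id) = \<iota>\<^bsub>\<C>\<^esub> (ob_map F n)" for n
    using is_functor.ar_map_ide[OF fu, of n] by simp
  note hom = Hom_def[of \<C>]
  have s: "sum2 F a b \<in> Hom \<C> (ob_map F a \<oplus>\<^bsub>\<C>\<^esub> ob_map F b) (ob_map F (a + b))" for a b
    using monoidal_functor.F2_hom[OF m, of a b] by simp
  have p: "prod2 F a b \<in> Hom \<C> (ob_map F a \<otimes>\<^bsub>\<C>\<^esub> ob_map F b) (ob_map F (a * b))" for a b
    using monoidal_functor.F2_hom[OF m', of a b] by simp
  have s0: "sum0 F \<in> Hom \<C> \<zero>\<^bsub>\<C>\<^esub> (ob_map F 0)"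
    using monoidal_functor.F0_hom[OF m] by simp
  have p0: "prod0 F \<in> Hom \<C> \<one>\<^bsub>\<C>\<^esub> (ob_map F 1)"
    using monoidal_functor.F0_hom[OF m'] by simp
  interpret C: braided_bimonoidal_category \<C>
    by (rule C)
  have ob [simp]: "ob_map F n \<in> Obj \<C>" for n
    using is_functor.ob_map_obj[OF fu, of n] by simp
  have arrs [simp]: "sum2 F a b \<in> Arr \<C>" "Src \<C> (sum2 F a b) = ob_map F a \<oplus>\<^bsub>\<C>\<^esub> ob_map F b"
    "Tgt \<C> (sum2 F a b) = ob_map F (a + b)"
    "prod2 F a b \<in> Arr \<C>" "Src \<C> (prod2 F a b) = ob_map F a \<otimes>\<^bsub>\<C>\<^esub> ob_map F b"
    "Tgt \<C> (prod2 F a b) = ob_map F (a * b)"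
    "sum0 F \<in> Arr \<C>" "Src \<C> (sum0 F) = \<zero>\<^bsub>\<C>\<^esub>" "Tgt \<C> (sum0 F) = ob_map F 0" for a b
    using s[of a b] p[of a b] s0 by (auto simp: hom)
  show ?thesis
  proof (intro FO_functor.intro C FO_functor_axioms.intro)
    fix a b c :: nat and f g :: "nat \<times> (nat \<Rightarrow> nat)"
    show "ar_map F (g \<cdot>\<^sub>F f) = ar_map F g \<cdot>\<^bsub>\<C>\<^esub> ar_map F f" if "f \<in> Arr FO" "g \<in> Arr FO" "fst g = fst f"
      using is_functor.ar_map_comp[OF fu, of f "fst f" "fst f" g "fst f"] that by (simp add: FO_Hom)
    show "is_iso \<C> (sum2 F a b)" "is_iso \<C> (sum0 F)" "is_iso \<C> (prod0 F)"
      using assms by (auto intro: robust_braided_bimonoidal_functor.sum2_iso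
        robust_braided_bimonoidal_functor.sum0_iso robust_braided_bimonoidal_functor.prod0_iso)
    show "sum2 F (fst f) (fst g) \<cdot>\<^bsub>\<C>\<^esub> (ar_map F f \<oplus>\<^sub>a\<^bsub>\<C>\<^esub> ar_map F g)
        = ar_map F (f \<oplus>\<^sub>F g) \<cdot>\<^bsub>\<C>\<^esub> sum2 F (fst f) (fst g)" if "f \<in> Arr FO" "g \<in> Arr FO"
      using monoidal_functor.F2_nat[OF m, of f "fst f" "fst f" g "fst g" "fst g"] that by (simp add: FO_Hom)
    show "sum2 F (a + b) c \<cdot>\<^bsub>\<C>\<^esub> (sum2 F a b \<oplus>\<^sub>a\<^bsub>\<C>\<^esub> \<iota>\<^bsub>\<C>\<^esub> (ob_map F c))
        = sum2 F a (b + c) \<cdot>\<^bsub>\<C>\<^esub> (\<iota>\<^bsub>\<C>\<^esub> (ob_map F a) \<oplus>\<^sub>a\<^bsub>\<C>\<^esub> sum2 F b c)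
            \<cdot>\<^bsub>\<C>\<^esub> sum_assoc \<C> (ob_map F a) (ob_map F b) (ob_map F c)"
      using monoidal_functor.F2_assoc[OF m, of a b c] by (simp add: ide add.assoc)
    show "sum2 F 0 a \<cdot>\<^bsub>\<C>\<^esub> (sum0 F \<oplus>\<^sub>a\<^bsub>\<C>\<^esub> \<iota>\<^bsub>\<C>\<^esub> (ob_map F a)) = sum_lunit \<C> (ob_map F a)"
      using monoidal_functor.F2_lunit[OF m, of a] by (simp add: ide)
    show "sum2 F a 0 \<cdot>\<^bsub>\<C>\<^esub> (\<iota>\<^bsub>\<C>\<^esub> (ob_map F a) \<oplus>\<^sub>a\<^bsub>\<C>\<^esub> sum0 F) = sum_runit \<C> (ob_map F a)"
      using monoidal_functor.F2_runit[OF m, of a] by (simp add: ide)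
    show "ar_map F (sum_braid FO a b) \<cdot>\<^bsub>\<C>\<^esub> sum2 F a b = sum2 F b a \<cdot>\<^bsub>\<C>\<^esub> sum_braid \<C> (ob_map F a) (ob_map F b)"
      using braided_monoidal_functor.F2_braid[OF bm, of a b] by simp
    show "prod2 F a 1 \<cdot>\<^bsub>\<C>\<^esub> (\<iota>\<^bsub>\<C>\<^esub> (ob_map F a) \<otimes>\<^sub>a\<^bsub>\<C>\<^esub> prod0 F) = prod_runit \<C> (ob_map F a)"
      using monoidal_functor.F2_runit[OF m', of a] p0 arrs(4-6)[of a 1] by (simp add: ide hom)
    show "prod2 F 0 a \<cdot>\<^bsub>\<C>\<^esub> (sum0 F \<otimes>\<^sub>a\<^bsub>\<C>\<^esub> \<iota>\<^bsub>\<C>\<^esub> (ob_map F a)) = sum0 F \<cdot>\<^bsub>\<C>\<^esub> lnull \<C> (ob_map F a)"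
      using braided_bimonoidal_functor.functor_lnull[OF bf, of a] by (simp add: ide)
    show "ar_map F (prod_braid FO a b) \<cdot>\<^bsub>\<C>\<^esub> prod2 F a b = prod2 F b a \<cdot>\<^bsub>\<C>\<^esub> prod_braid \<C> (ob_map F a) (ob_map F b)"
      using braided_monoidal_functor.F2_braid[OF bm', of a b] by simp
    show "prod2 F a (b + c) \<cdot>\<^bsub>\<C>\<^esub> (\<iota>\<^bsub>\<C>\<^esub> (ob_map F a) \<otimes>\<^sub>a\<^bsub>\<C>\<^esub> sum2 F b c)
        = sum2 F (a * b) (a * c) \<cdot>\<^bsub>\<C>\<^esub> (prod2 F a b \<oplus>\<^sub>a\<^bsub>\<C>\<^esub> prod2 F a c)
            \<cdot>\<^bsub>\<C>\<^esub> ldist \<C> (ob_map F a) (ob_map F b) (ob_map F c)"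
      using braided_bimonoidal_functor.functor_ldist[OF bf, of a b c] by (simp add: ide distrib_left)
  qed (use ar p0 in \<open>auto simp: ide hom\<close>)
qed

lemma robust_pair:
  assumes "robust_braided_bimonoidal_functor FO \<C> F" "robust_braided_bimonoidal_functor FO \<C> G"
  shows "FO_functor_pair \<C> F G"
  using assms by (auto intro: FO_functor_pair.intro robust_FO_functor)

abbreviation comparison where
  "comparison \<equiv> FO_functor_pair.compare"

lemma robust_is_functor:
  "robust_braided_bimonoidal_functor \<C> \<D> F \<Longrightarrow> is_functor \<C> \<D> F"
  by (auto dest: robust_braided_bimonoidal_functor.axioms braided_bimonoidal_functor.axioms)

lemma robust_monoidal:
  assumes "robust_braided_bimonoidal_functor \<C> \<D> F"
  shows "monoidal_functor (additive \<C>) (additive \<D>) F (sum2 F) (sum0 F)"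
    and "monoidal_functor (multiplicative \<C>) (multiplicative \<D>) F (prod2 F) (prod0 F)"
  using braided_bimonoidal_functor.additive_functor[OF robust_braided_bimonoidal_functor.axioms(1)[OF assms]]
    braided_bimonoidal_functor.multiplicative_functor[OF robust_braided_bimonoidal_functor.axioms(1)[OF assms]]
  unfolding underlying_monoidal_functor[symmetric]
  by (auto dest: symmetric_monoidal_functor.axioms braided_monoidal_functor.axioms)

text \<open>
  Consequently there is exactly one arrow between any two robust functors.
\<close>

lemma bimonoidal_nat_trans_iff:
  assumes F: "robust_braided_bimonoidal_functor FO \<C> F" and G: "robust_braided_bimonoidal_functor FO \<C> G"
  shows "bimonoidal_nat_trans FO \<C> F G \<tau> \<longleftrightarrow> \<tau> = comparison \<C> F G"
proof -
  interpret FO_functor_pair \<C> F G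
    using assms by (rule robust_pair)
  show ?thesis
  proof
    assume t: "bimonoidal_nat_trans FO \<C> F G \<tau>"
    have n: "nat_trans FO \<C> F G \<tau>"
      using t by (rule bimonoidal_nat_trans.axioms)
    have a: "monoidal_nat_trans (additive FO) (additive \<C>) F (sum2 F) (sum0 F) G (sum2 G) (sum0 G) \<tau>"
      using t by (rule bimonoidal_nat_trans.additive_nat_trans)
    have b: "monoidal_nat_trans (multiplicative FO) (multiplicative \<C>) F (prod2 F) (prod0 F) G (prod2 G) (prod0 G) \<tau>"
      using t by (rule bimonoidal_nat_trans.multiplicative_nat_trans)
    show "\<tau> = compare"
    proof (rule compare_unique)
      fix n
      show "\<tau> n \<in> Arr \<C>" "Src \<C> (\<tau> n) = ob_map F n" "Tgt \<C> (\<tau> n) = ob_map G n"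
        using nat_trans.component_hom[OF n, of n] by (auto simp: F.hom_iff)
      show "\<tau> (1 + n) \<cdot>\<^bsub>\<C>\<^esub> sum2 F 1 n = sum2 G 1 n \<cdot>\<^bsub>\<C>\<^esub> (\<tau> 1 \<oplus>\<^sub>a\<^bsub>\<C>\<^esub> \<tau> n)"
        using monoidal_nat_trans.component_tensor[OF a, of 1 n] by simp
      show "\<tau> 0 \<cdot>\<^bsub>\<C>\<^esub> sum0 F = sum0 G"
        using monoidal_nat_trans.component_unit[OF a] by simp
      show "\<tau> 1 \<cdot>\<^bsub>\<C>\<^esub> prod0 F = prod0 G"
        using monoidal_nat_trans.component_unit[OF b] by simp
    qed
  next
    assume t: "\<tau> = compare"
    have n: "nat_trans FO \<C> F G compare"
      using assms
      by (intro nat_trans.intro nat_trans_axioms.intro robust_is_functor)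
        (auto simp: F.hom_iff FO_Hom compare_natural)
    show "bimonoidal_nat_trans FO \<C> F G \<tau>"
      unfolding t using n robust_monoidal[OF F] robust_monoidal[OF G] compare_prod0
      by (intro bimonoidal_nat_trans.intro bimonoidal_nat_trans_axioms.intro monoidal_nat_trans.intro
          monoidal_nat_trans_axioms.intro)
        (auto simp: compare_sum compare_prod compare_zero)
  qed
qed

lemma comparison_comp:
  assumes "FO_functor \<C> F" "FO_functor \<C> G" "FO_functor \<C> H"
  shows "comparison \<C> G H n \<cdot>\<^bsub>\<C>\<^esub> comparison \<C> F G n = comparison \<C> F H n"
proof -
  interpret FG: FO_functor_pair \<C> F G
    using assms by (intro FO_functor_pair.intro)
  interpret GH: FO_functor_pair \<C> G H
    using assms by (intro FO_functor_pair.intro)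
  interpret FH: FO_functor_pair \<C> F H
    using assms by (intro FO_functor_pair.intro)
  have one: "GH.compare_one \<cdot>\<^bsub>\<C>\<^esub> FG.compare_one = FH.compare_one"
    using FG.F.prod0 FG.G.prod0 GH.G.prod0
    by (simp add: GH.compare_one_def FG.compare_one_def FH.compare_one_def)
  show ?thesis
    by (induction n) (simp_all add: one FG.compare.simps GH.compare.simps FH.compare.simps)
qed

lemma comparison_self:
  assumes "FO_functor \<C> F"
  shows "comparison \<C> F F n = \<iota>\<^bsub>\<C>\<^esub> (ob_map F n)"
proof -
  interpret FO_functor_pair \<C> F F
    using assms by (intro FO_functor_pair.intro)
  have "compare_one = \<iota>\<^bsub>\<C>\<^esub> (ob_map F 1)"
    using F.prod0 by (simp add: compare_one_def)
  then show ?thesis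
    by (induction n) (simp_all add: compare.simps)
qed

section \<open>The canonical functor is robust\<close>

context braided_bimonoidal_category
begin

definition canonical :: "(nat, nat \<times> (nat \<Rightarrow> nat), 'o, 'm) bimonoidal_functor_data" where
  "canonical = \<lparr>ob_map = X, ar_map = (\<lambda>f \<in> Arr FO. K f), sum2 = s, sum0 = \<iota> \<zero>,
     prod2 = distribute, prod0 = arr_inv \<C> (\<rho>\<^sub>+ \<one>)\<rparr>"

lemma canonical_simps [simp]:
  "ob_map canonical = X" "f \<in> Arr FO \<Longrightarrow> ar_map canonical f = K f" "sum2 canonical = s"
  "sum0 canonical = \<iota> \<zero>" "prod2 canonical = distribute" "prod0 canonical = arr_inv \<C> (\<rho>\<^sub>+ \<one>)"
  by (simp_all add: canonical_def)

lemma canonical_functor: "is_functor FO \<C> canonical"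
proof (intro is_functor.intro is_functor_axioms.intro)
  show "ar_map canonical \<in> extensional (Arr FO)"
    by (simp add: canonical_def)
qed (auto simp: FO_category category_axioms FO_Hom hom_iff add.perm_map_comp)

lemma canonical_robust: "robust_braided_bimonoidal_functor FO \<C> canonical"
proof -
  have FO: "braided_bimonoidal_category FO"
    using FO_flat by (rule flat_braided_bimonoidal_category.axioms)
  have mFO: "monoidal_category (additive FO)" "monoidal_category (braided_multiplicative FO)"
    "braided_monoidal_category (additive FO)" "braided_monoidal_category (braided_multiplicative FO)"
    using FO_additive FO_multiplicative
    by (auto dest: symmetric_monoidal_category.axioms braided_monoidal_category.axioms)
  have mC: "monoidal_category (additive \<C>)" "monoidal_category (braided_multiplicative \<C>)"
    "braided_monoidal_category (additive \<C>)" "braided_monoidal_category (braided_multiplicative \<C>)"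
    using additive_symmetric multiplicative_braided
    by (auto dest: symmetric_monoidal_category.axioms braided_monoidal_category.axioms)
  have one: "X 1 = \<one> \<oplus> \<zero>" "X (Suc 0) = \<one> \<oplus> \<zero>"
    by simp_all
  have add: "symmetric_monoidal_functor (additive FO) (additive \<C>) canonical s (\<iota> \<zero>)"
    using mFO mC FO_additive additive_symmetric canonical_functor
    by (intro symmetric_monoidal_functor.intro braided_monoidal_functor.intro
        braided_monoidal_functor_axioms.intro monoidal_functor.intro monoidal_functor_axioms.intro)
      (auto simp: FO_Hom hom_iff add.merge_natural add.merge_assoc add.merge_runit add.merge_braid add.assoc)
  have runit: "distribute n 1 \<cdot> (\<iota> (X n) \<otimes>\<^sub>a arr_inv \<C> (\<rho>\<^sub>+ \<one>)) = \<rho>\<^sub>\<times> (X n)" for n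
    unfolding distribute_one by simp
  have lunit: "distribute 1 n \<cdot> (arr_inv \<C> (\<rho>\<^sub>+ \<one>) \<otimes>\<^sub>a \<iota> (X n)) = \<Lambda>\<^sub>\<times> (X n)" for n
    unfolding distribute_one_left by simp
  have mult: "braided_monoidal_functor (braided_multiplicative FO) (braided_multiplicative \<C>) canonical
    distribute (arr_inv \<C> (\<rho>\<^sub>+ \<one>))"
    using mFO mC canonical_functor runit lunit
    by (intro braided_monoidal_functor.intro
        braided_monoidal_functor_axioms.intro monoidal_functor.intro monoidal_functor_axioms.intro)
      (auto simp: FO_Hom hom_iff distribute_natural distribute_assoc distribute_braid mult.assoc
        simp del: distribute.simps)
  show ?thesis
    using FO canonical_functor add mult
    by (intro robust_braided_bimonoidal_functor.intro robust_braided_bimonoidal_functor_axioms.intro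
        braided_bimonoidal_functor.intro braided_bimonoidal_functor_axioms.intro)
      (auto simp: braided_bimonoidal_category_axioms distribute_zero_left distribute_ldist distrib_left)
qed

end

section \<open>The bicolimit property\<close>

context braided_bimonoidal_category
begin

abbreviation functors where
  "functors \<equiv> robust_functor_category FO \<C>"

lemma functors_obj [simp]: "F \<in> Obj functors \<longleftrightarrow> robust_braided_bimonoidal_functor FO \<C> F"
  by (simp add: robust_functor_category_def)

lemma functors_arr:
  "x \<in> Arr functors \<longleftrightarrow> (\<exists>F G. x = (F, G, comparison \<C> F G) \<and> F \<in> Obj functors \<and> G \<in> Obj functors)"
  by (auto simp: robust_functor_category_def bimonoidal_nat_trans_iff)

lemma functors_hom:
  "Hom functors F G = (if F \<in> Obj functors \<and> G \<in> Obj functors then {(F, G, comparison \<C> F G)} else {})"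
  by (auto simp: Hom_def functors_arr) (auto simp: robust_functor_category_def)

lemma functors_comp:
  assumes "F \<in> Obj functors" "G \<in> Obj functors" "H \<in> Obj functors"
  shows "(G, H, comparison \<C> G H) \<cdot>\<^bsub>functors\<^esub> (F, G, comparison \<C> F G) = (F, H, comparison \<C> F H)"
  using assms comparison_comp[of \<C> F G H, OF robust_FO_functor robust_FO_functor robust_FO_functor]
  by (auto simp: robust_functor_category_def)

lemma functors_ide: "F \<in> Obj functors \<Longrightarrow> \<iota>\<^bsub>functors\<^esub> F = (F, F, comparison \<C> F F)"
  using comparison_self[of \<C> F, OF robust_FO_functor] by (auto simp: robust_functor_category_def fun_eq_iff)

lemma functors_src: "Src functors (F, G, t) = F" "Tgt functors (F, G, t) = G"
  by (simp_all add: robust_functor_category_def)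

lemma functors_category: "category functors"
  by standard
    (auto simp: functors_arr functors_hom functors_src functors_comp functors_ide simp del: functors_obj split: if_splits)

end

lemma terminal_category: "category terminal_category"
  by standard (auto simp: terminal_category_def Hom_def)

lemma is_functor_to_terminal:
  fixes T :: "('o, 'm, unit, unit) functor_data"
  assumes "category \<C>"
  shows "is_functor \<C> terminal_category T"
  using assms
  by (intro is_functor.intro is_functor_axioms.intro terminal_category)
    (auto simp: extensional_def terminal_category_def Hom_def)

lemma terminal_functor_unique:
  fixes S T :: "('o, 'm, unit, unit) functor_data"
  shows "S = T"
  by (cases S; cases T) (simp add: fun_eq_iff)

context braided_bimonoidal_category
begin

text \<open>
  All hom-sets are singletons, so any object, such as the canonical functor, provides an inverse.
\<close>

lemma functors_equivalence:
  fixes T :: "((nat, nat \<times> (nat \<Rightarrow> nat), 'o, 'm) bimonoidal_functor_data, _, unit, unit) functor_data"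
  shows "is_equivalence functors terminal_category T"
proof -
  interpret H: category functors
    by (rule functors_category)
  have c: "canonical \<in> Obj functors"
    by (simp add: canonical_robust)
  let ?G = "\<lparr>ob_map = (\<lambda>_. canonical), ar_map = (\<lambda>_. \<iota>\<^bsub>functors\<^esub> canonical)\<rparr> :: (unit, unit, _, _) functor_data"
  let ?\<eta> = "\<lambda>F \<in> Obj functors. (F, canonical, comparison \<C> F canonical)"
  let ?\<epsilon> = "\<lambda>_ :: unit. ()"
  have T: "is_functor functors terminal_category T"
    by (rule is_functor_to_terminal[OF functors_category])
  have G: "is_functor terminal_category functors ?G"
    using c terminal_category functors_category
    by (intro is_functor.intro is_functor_axioms.intro)
      (auto simp: terminal_category_def extensional_def H.hom_iff simp del: functors_obj)
  have iso: "is_iso functors (F, G, comparison \<C> F G)" if "F \<in> Obj functors" "G \<in> Obj functors" for F G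
    by (rule H.isoI(1)[where g = "(G, F, comparison \<C> G F)"])
      (use that in \<open>auto simp: functors_arr functors_src functors_comp functors_ide simp del: functors_obj\<close>)
  have idf: "is_functor functors functors (id_functor functors)"
    by (intro is_functor.intro is_functor_axioms.intro functors_category)
      (auto simp: id_functor_def H.hom_iff simp del: functors_obj)
  have GT: "is_functor functors functors (comp_functor functors ?G T)"
    using c by (intro is_functor.intro is_functor_axioms.intro functors_category)
      (auto simp: comp_functor_def H.hom_iff simp del: functors_obj)
  have \<eta>: "nat_iso functors functors (id_functor functors) (comp_functor functors ?G T) ?\<eta>"
    using c idf GT
    by (intro nat_iso.intro nat_iso_axioms.intro nat_trans.intro nat_trans_axioms.intro)
      (auto simp: id_functor_def comp_functor_def functors_hom functors_arr functors_comp functors_ide iso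
        simp del: functors_obj split: if_splits)
  have TG: "is_functor terminal_category terminal_category S" for S :: "(unit, unit, unit, unit) functor_data"
    by (rule is_functor_to_terminal[OF terminal_category])
  have \<epsilon>: "nat_iso terminal_category terminal_category (comp_functor terminal_category T ?G)
      (id_functor terminal_category) ?\<epsilon>"
    by (intro nat_iso.intro nat_iso_axioms.intro nat_trans.intro nat_trans_axioms.intro TG)
      (auto simp: extensional_def terminal_category_def Hom_def is_iso_def inverse_arrows_def)
  show ?thesis
    unfolding is_equivalence_def using T G \<eta> \<epsilon> by blast
qed

end

theorem mainTheorem12:
  shows "flat_braided_bimonoidal_category finite_ordinal_category \<and>
    (\<forall>\<C> :: ('o, 'm) braided_bimonoidal_data. flat_braided_bimonoidal_category \<C> \<longrightarrow>
       (\<exists>!T :: (_, _, unit, unit) functor_data.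
          is_functor (robust_functor_category finite_ordinal_category \<C>) terminal_category T) \<and>
       (\<forall>T :: (_, _, unit, unit) functor_data.
          is_functor (robust_functor_category finite_ordinal_category \<C>) terminal_category T \<longrightarrow>
          is_equivalence (robust_functor_category finite_ordinal_category \<C>) terminal_category T))"
proof (intro conjI allI impI)
  show "flat_braided_bimonoidal_category FO"
    by (rule FO_flat)
next
  fix \<C> :: "('o, 'm) braided_bimonoidal_data"
  assume "flat_braided_bimonoidal_category \<C>"
  then interpret braided_bimonoidal_category \<C>
    by (rule flat_braided_bimonoidal_category.axioms)
  show "\<exists>!T :: (_, _, unit, unit) functor_data. is_functor functors terminal_category T"
    using is_functor_to_terminal[OF functors_category] terminal_functor_unique by blast
  show "is_equivalence functors terminal_category T" for T :: "(_, _, unit, unit) functor_data"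
    by (rule functors_equivalence)
qed

end
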